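(* Let $n$ be a positive integer. Then every group of order $n$ is integrable if and only if $n$ is cube-free and there do not exist prime divisors $p$, $q$ of $n$ with $q\mid p-1$.
   Context: For a group $H$, $H'$ denotes its derived group (commutator subgroup). A group $G$ is integrable if there exists a group $H$ (an integral of $G$) such that $H'$ is isomorphic to $G$. An integer is cube-free if it is not divisible by the cube of any prime. *)

theory Defs
  imports
    "HOL-Algebra.Solvable_Groups"
    "HOL-Computational_Algebra.Primes"
    "HOL-Library.Countable_Set"
    "HOL-Library.Infinite_Typeclass"
begin

definition integral_of :: "('b, 'm) monoid_scheme \<Rightarrow> ('a, 'k) monoid_scheme \<Rightarrow> bool" where
  "integral_of H G \<longleftrightarrow> group H \<and> H\<lparr>carrier := derived H (carrier H)\<rparr> \<cong> G"

(* HOL cannot quantify existentially over the type of the elements of H, so that type is an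
   explicit parameter. For finite G its choice is immaterial as long as it is infinite: by
   integrable_group_universe below, an integral over any type whatsoever yields one over
   every infinite type. *)
definition integrable_group :: "'b itself \<Rightarrow> ('a, 'k) monoid_scheme \<Rightarrow> bool" where
  "integrable_group _ G \<longleftrightarrow> (\<exists>H :: 'b monoid. integral_of H G)"

definition cube_free :: "nat \<Rightarrow> bool" where
  "cube_free n \<longleftrightarrow> (\<forall>p. Factorial_Ring.prime p \<longrightarrow> \<not> p ^ 3 dvd n)"


lemma (in group) derived_finite_support:
  assumes "x \<in> derived G (carrier G)"
  shows "\<exists>T. finite T \<and> T \<subseteq> carrier G \<and> x \<in> derived G T"
  using assms unfolding derived_def
proof (induction rule: generate.induct)
  case one
  show ?case by (rule exI[of _ "{}"]) (simp add: generate.one)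
next
  case (incl h)
  then obtain a b where "a \<in> carrier G" "b \<in> carrier G" "h = a \<otimes> b \<otimes> inv a \<otimes> inv b" by auto
  then show ?case by (intro exI[of _ "{a, b}"]) (auto intro: generate.incl)
next
  case (inv h)
  then obtain a b where "a \<in> carrier G" "b \<in> carrier G" "h = a \<otimes> b \<otimes> inv a \<otimes> inv b" by auto
  then show ?case by (intro exI[of _ "{a, b}"]) (auto intro: generate.inv)
next
  case (eng h1 h2)
  then obtain T1 T2 where T: "finite T1" "T1 \<subseteq> carrier G" "h1 \<in> generate G (derived_set G T1)"
    "finite T2" "T2 \<subseteq> carrier G" "h2 \<in> generate G (derived_set G T2)" by blast
  have "generate G (derived_set G T1) \<subseteq> generate G (derived_set G (T1 \<union> T2))"
    by (intro mono_generate mono_derived_set) simp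
  moreover have "generate G (derived_set G T2) \<subseteq> generate G (derived_set G (T1 \<union> T2))"
    by (intro mono_generate mono_derived_set) simp
  ultimately show ?case using T by (intro exI[of _ "T1 \<union> T2"]) (auto intro: generate.eng)
qed

lemma (in group) countable_generate:
  assumes "countable T" "T \<subseteq> carrier G"
  shows "countable (generate G T)"
proof -
  define S where "S = T \<union> m_inv G ` T"
  have S: "S \<subseteq> carrier G" using assms by (auto simp: S_def)
  define f where "f = (\<lambda>ws. foldr (\<otimes>) ws \<one>)"
  have fc: "f ws \<in> carrier G" if "ws \<in> lists S" for ws
    using that S by (induction ws) (auto simp: f_def)
  have fapp: "f (us @ ws) = f us \<otimes> f ws" if "us \<in> lists S" "ws \<in> lists S" for us ws
    using that
  proof (induction us)
    case Nil
    then show ?case using fc by (simp add: f_def)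
  next
    case (Cons u us)
    then have "f (u # us @ ws) = u \<otimes> (f us \<otimes> f ws)" by (simp add: f_def)
    also have "\<dots> = u \<otimes> f us \<otimes> f ws"
      using Cons S fc[of us] fc[of ws] by (auto simp: m_assoc)
    finally show ?case by (simp add: f_def)
  qed
  have "generate G T \<subseteq> f ` lists S"
  proof
    fix x assume "x \<in> generate G T"
    then show "x \<in> f ` lists S"
    proof (induction rule: generate.induct)
      case one
      show ?case by (rule image_eqI[of _ _ "[]"]) (auto simp: f_def)
    next
      case (incl h)
      then show ?case using S by (intro image_eqI[of _ _ "[h]"]) (auto simp: f_def S_def)
    next
      case (inv h)
      then show ?case using S by (intro image_eqI[of _ _ "[inv h]"]) (auto simp: f_def S_def)
    next
      case (eng h1 h2)
      then obtain us ws where "us \<in> lists S" "ws \<in> lists S" "h1 = f us" "h2 = f ws" by auto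
      then show ?case by (intro image_eqI[of _ _ "us @ ws"]) (auto simp: fapp)
    qed
  qed
  moreover have "countable (f ` lists S)" using assms by (auto simp: S_def)
  ultimately show ?thesis by (rule countable_subset)
qed

lemma integrable_group_universe:
  fixes H :: "('c, 'm) monoid_scheme" and G :: "('a, 'k) monoid_scheme"
  assumes "integral_of H G" "finite (carrier G)"
  shows "integrable_group TYPE('b::infinite) G"
proof -
  from assms(1) interpret H: group H by (simp add: integral_of_def)
  define D where "D = derived H (carrier H)"
  have iso: "H\<lparr>carrier := D\<rparr> \<cong> G" using assms(1) by (simp add: integral_of_def D_def)
  have finD: "finite D" using iso_finite[OF iso] assms(2) by simp
  obtain T where T: "finite (T x)" "T x \<subseteq> carrier H" "x \<in> derived H (T x)" if "x \<in> D" for x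
    using H.derived_finite_support unfolding D_def by metis
  define U where "U = (\<Union>x\<in>D. T x)"
  define K where "K = generate H U"
  have U: "finite U" "U \<subseteq> carrier H" using finD T by (auto simp: U_def)
  have subK: "subgroup K H" unfolding K_def by (rule H.generate_is_subgroup[OF U(2)])
  have UK: "U \<subseteq> K" by (auto simp: K_def intro: generate.incl)
  have "D \<subseteq> derived H K"
  proof
    fix x assume x: "x \<in> D"
    then have "T x \<subseteq> K" using UK by (auto simp: U_def)
    then show "x \<in> derived H K" using T(3)[OF x] H.mono_derived by blast
  qed
  moreover have "derived H K \<subseteq> D"
    unfolding D_def by (rule H.mono_derived[OF subgroup.subset[OF subK]])
  ultimately have DK: "derived H K = D" by simp
  interpret K: group "H\<lparr>carrier := K\<rparr>" by (rule H.subgroup_imp_group[OF subK])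
  have "countable K" unfolding K_def using U by (intro H.countable_generate) (auto intro: countable_finite)
  obtain e :: "nat \<Rightarrow> 'b" where e: "inj e" using arb_countable_map[of "{}"] by auto
  define f where "f = e \<circ> to_nat_on K"
  have injf: "inj_on f K"
    unfolding f_def using \<open>countable K\<close> e by (intro comp_inj_on) (auto intro: inj_on_subset)
  define g where "g = inv_into K f"
  have gf: "g (f x) = x" if "x \<in> K" for x using that injf by (simp add: g_def)
  define L :: "'b monoid" where
    "L = \<lparr>carrier = f ` K, monoid.mult = \<lambda>x y. f (g x \<otimes>\<^bsub>H\<^esub> g y), monoid.one = f \<one>\<^bsub>H\<^esub>\<rparr>"
  have fiso: "f \<in> iso (H\<lparr>carrier := K\<rparr>) L"
    using injf by (auto simp: iso_def hom_def L_def gf bij_betw_def)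
  have "group (L\<lparr>one := f \<one>\<^bsub>H\<^esub>\<rparr>)" using K.iso_imp_img_group[OF fiso] by simp
  then have grpL: "group L" by (simp add: L_def)
  interpret h: group_hom "H\<lparr>carrier := K\<rparr>" L f
    using fiso grpL K.group_axioms by (auto simp: group_hom_def group_hom_axioms_def iso_def)
  have "derived L (f ` K) = f ` derived (H\<lparr>carrier := K\<rparr>) K"
    using h.derived_img[of K] by simp
  then have dL: "derived L (carrier L) = f ` D"
    using H.derived_consistent[OF _ subK, of K] by (simp add: DK L_def)
  have DsubK: "D \<subseteq> K" using H.derived_incl[OF _ subK, of K] DK by simp
  have "f \<in> iso (H\<lparr>carrier := D\<rparr>) (L\<lparr>carrier := f ` D\<rparr>)"
    using injf DsubK by (auto simp: iso_def hom_def L_def gf bij_betw_def subset_iff intro: inj_on_subset)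
  then have isoL: "H\<lparr>carrier := D\<rparr> \<cong> L\<lparr>carrier := f ` D\<rparr>" by (rule is_isoI)
  have "group (H\<lparr>carrier := D\<rparr>)"
    unfolding D_def by (intro H.subgroup_imp_group H.derived_is_subgroup) simp
  then have "L\<lparr>carrier := f ` D\<rparr> \<cong> G"
    using iso isoL group.iso_sym iso_trans by blast
  then have "integral_of L G" using grpL dL by (simp add: integral_of_def)
  then show ?thesis by (auto simp: integrable_group_def)
qed

end

(*
  Let H' = G. Conjugation by the elements of H induces a set of automorphisms of G which commute
  up to inner automorphisms, and an element of G at which they all commute is centralised by every
  commutator of H, hence is central in G. So G has no integral if a noncentral element is mapped to
  one of its powers by all automorphisms. For n divisible by primes p and q with q | p - 1 this
  applies to an element of order p of a suitable group C_{n/q} : C_q, and for 8 | n to the rotations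
  of the dihedral group. If p^3 | n with p odd, the group a^{n/p} = b^p = 1, b a b^{-1} = a^{1+n/p^2}
  needs the set of automorphisms itself: they commute at b or all map some a b^l to its powers.

  Conversely let n satisfy the condition. If n is even, then n divides 4, and an abelian group A is
  the derived group of the extension of A x A by the swap. If n is odd, every group G of order n
  has an automorphism t with t^2 = 1 and g t(g) in G' for all g; then the derived group of G : <t>
  contains G' and all squares, so it is G. To find t, Burnside's transfer theorem for the smallest
  prime divisor and induction give a normal Sylow subgroup V, which has a complement M. If M
  acts nontrivially on V, then V = F_r^2 and M acts by matrices of determinant 1 that stabilise no
  line unless they are trivial. This forces M to act as an abelian group, whose action is inverted by
  an involution of V, and t is assembled from this involution and its analogue for M.
*)

theory Submission
  imports Defs "HOL-Algebra.Sylow" "HOL-Algebra.Group_Action" "HOL-Algebra.Left_Coset"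
    "HOL-Number_Theory.Number_Theory"
begin

section \<open>Fixed points of actions of groups of prime power order\<close>

text \<open>Transfer yields a normal complement of a Sylow subgroup, whereas t is built on a normal
  Sylow subgroup V with a complement M; this is why a descent through the complements precedes the
  construction. A prime q dividing the order of M that acts nontrivially on V, of order r or r^2,
  divides r - 1 or r^2 - 1, and the hypothesis on n excludes the former. The remaining case, q
  dividing r + 1, is the obstacle that shapes the construction. An automorphism with g t(g) in G' is
  one that inverts G/G', so for abelian groups inversion serves. But t inverts M only modulo M', and
  M' turns out to act trivially on V, so t must turn the action of each h in M on V into that of its
  inverse; inversion on V commutes with M and does not do this. In exchange, a nontrivial action
  forces V = [V, M], so that V lies in G' and no further condition is left on V.\<close>

lemma (in group) card_fixed_points_cong:
  fixes act :: "'a \<Rightarrow> 'x \<Rightarrow> 'x"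
  assumes p: "Factorial_Ring.prime p" and oG: "order G = p ^ a" and fE: "finite E"
    and cl: "\<And>g x. g \<in> carrier G \<Longrightarrow> x \<in> E \<Longrightarrow> act g x \<in> E"
    and one: "\<And>x. x \<in> E \<Longrightarrow> act \<one> x = x"
    and comp: "\<And>g h x. g \<in> carrier G \<Longrightarrow> h \<in> carrier G \<Longrightarrow> x \<in> E \<Longrightarrow>
                 act (g \<otimes> h) x = act g (act h x)"
  shows "[card E = card {x \<in> E. \<forall>g\<in>carrier G. act g x = x}] (mod p)"
proof -
  \<comment> \<open>\<open>Bij E\<close> consists of extensional maps, hence the restriction of the
    action to \<open>E\<close>.\<close>
  define \<phi> where "\<phi> g = restrict (act g) E" for g
  have bij: "bij_betw (act g) E E" if g: "g \<in> carrier G" for g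
  proof (rule bij_betw_byWitness[where f' = "act (inv g)"])
    show "\<forall>x\<in>E. act (inv g) (act g x) = x"
      using g comp[of "inv g" g] one by simp
    show "\<forall>x\<in>E. act g (act (inv g) x) = x"
      using g comp[of g "inv g"] one by simp
  qed (use g cl in auto)
  have Bij: "\<phi> g \<in> Bij E" if "g \<in> carrier G" for g
    using bij[OF that] by (auto simp: Bij_def \<phi>_def cong: bij_betw_cong)
  have hom: "\<phi> \<in> hom G (BijGroup E)"
  proof (rule homI)
    fix g h assume gh: "g \<in> carrier G" "h \<in> carrier G"
    show "\<phi> (g \<otimes> h) = \<phi> g \<otimes>\<^bsub>BijGroup E\<^esub> \<phi> h"
      using gh Bij cl comp by (auto simp: BijGroup_def compose_def \<phi>_def restrict_def fun_eq_iff)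
  qed (use Bij in \<open>simp add: BijGroup_def\<close>)
  interpret ga: group_action G E \<phi>
    by (intro group_action.intro group_hom.intro group_hom_axioms.intro group_axioms group_BijGroup hom)
  have orb: "orbit G \<phi> x = {act g x | g. g \<in> carrier G}" if "x \<in> E" for x
    using that by (auto simp: orbit_def \<phi>_def)
  define O1 where "O1 = {R \<in> orbits G E \<phi>. card R = 1}"
  define F where "F = {x \<in> E. \<forall>g\<in>carrier G. act g x = x}"
  have orbE: "R \<subseteq> E" if "R \<in> orbits G E \<phi>" for R using that ga.orbits_coverture by auto
  have finO: "finite (orbits G E \<phi>)"
    by (rule finite_subset[of _ "Pow E"]) (use orbE fE in auto)
  have pd: "p dvd card R" if R: "R \<in> orbits G E \<phi>" "card R \<noteq> 1" for R
  proof -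
    obtain x where x: "x \<in> E" "R = orbit G \<phi> x" using R by (auto simp: orbits_def)
    have "card R dvd p ^ a" using ga.orbit_stabilizer_theorem[OF x(1)] x oG by (metis dvd_triv_left)
    then obtain k where "card R = p ^ k" using p divides_primepow_nat by blast
    then show ?thesis using R by (cases k) auto
  qed
  have F1: "bij_betw (\<lambda>x. {x}) F O1"
  proof (rule bij_betwI')
    fix x assume x: "x \<in> F"
    then have "x \<in> E" by (simp add: F_def)
    moreover have "orbit G \<phi> x = {x}"
      using x one_closed by (auto simp: F_def orb[OF \<open>x \<in> E\<close>]) (metis one_closed)
    ultimately show "{x} \<in> O1" by (auto simp: O1_def orbits_def)
  next
    fix R assume R: "R \<in> O1"
    then obtain x where x: "x \<in> E" "R = orbit G \<phi> x" "card R = 1" by (auto simp: O1_def orbits_def)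
    have "x \<in> R" using x ga.orbit_refl by simp
    then have "R = {x}" using x(3) by (metis card_1_singletonE singletonD)
    moreover have "x \<in> F" using x \<open>R = {x}\<close> by (auto simp: F_def orb)
    ultimately show "\<exists>x\<in>F. R = {x}" by auto
  qed auto
  have "card E = (\<Sum>R\<in>orbits G E \<phi>. card R)"
    using ga.disjoint_sum[OF fE, of "\<lambda>_. 1::nat"] by simp
  also have "\<dots> = (\<Sum>R\<in>O1. card R) + (\<Sum>R\<in>orbits G E \<phi> - O1. card R)"
    using finO by (subst sum.subset_diff[of O1]) (auto simp: O1_def)
  also have "(\<Sum>R\<in>O1. card R) = card F"
    using bij_betw_same_card[OF F1] by (simp add: O1_def)
  finally have cE: "card E = card F + (\<Sum>R\<in>orbits G E \<phi> - O1. card R)" .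
  have "p dvd (\<Sum>R\<in>orbits G E \<phi> - O1. card R)"
    by (rule dvd_sum) (use pd in \<open>auto simp: O1_def\<close>)
  then obtain m where "(\<Sum>R\<in>orbits G E \<phi> - O1. card R) = p * m" by (elim dvdE)
  with cE show ?thesis unfolding F_def by (simp add: cong_def)
qed

lemma (in group) subgroup_card_fixed_points_cong:
  fixes act :: "'a \<Rightarrow> 'x \<Rightarrow> 'x"
  assumes p: "Factorial_Ring.prime p" and Q: "subgroup Q G" "card Q = p ^ a" and fE: "finite E"
    and cl: "\<And>g x. g \<in> Q \<Longrightarrow> x \<in> E \<Longrightarrow> act g x \<in> E"
    and one: "\<And>x. x \<in> E \<Longrightarrow> act \<one> x = x"
    and comp: "\<And>g h x. g \<in> Q \<Longrightarrow> h \<in> Q \<Longrightarrow> x \<in> E \<Longrightarrow> act (g \<otimes> h) x = act g (act h x)"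
  shows "[card E = card {x \<in> E. \<forall>g\<in>Q. act g x = x}] (mod p)"
  using group.card_fixed_points_cong[OF subgroup_imp_group[OF Q(1)] p, of a E act] assms
  by (simp add: order_def)

section \<open>Conjugation, centralizers, normalizers and Sylow subgroups of subgroups\<close>

abbreviation conjg :: "('a, 'b) monoid_scheme \<Rightarrow> 'a \<Rightarrow> 'a \<Rightarrow> 'a" where
  "conjg G g x \<equiv> g \<otimes>\<^bsub>G\<^esub> x \<otimes>\<^bsub>G\<^esub> inv\<^bsub>G\<^esub> g"

lemma (in group) conjg_mult:
  "\<lbrakk>g \<in> carrier G; h \<in> carrier G; x \<in> carrier G\<rbrakk> \<Longrightarrow> conjg G (g \<otimes> h) x = conjg G g (conjg G h x)"
  by (simp add: inv_mult_group m_assoc)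

lemma (in group) conjg_hom:
  "\<lbrakk>g \<in> carrier G; x \<in> carrier G; y \<in> carrier G\<rbrakk> \<Longrightarrow> conjg G g (x \<otimes> y) = conjg G g x \<otimes> conjg G g y"
  by (simp add: m_assoc inv_solve_left)

lemma (in group) conjg_eq_iff:
  "\<lbrakk>g \<in> carrier G; x \<in> carrier G; y \<in> carrier G\<rbrakk> \<Longrightarrow> conjg G g x = y \<longleftrightarrow> g \<otimes> x = y \<otimes> g"
  by (metis inv_solve_right m_closed)

lemma (in group) card_subgroup_dvd:
  assumes "finite (carrier G)" "subgroup H G" "subgroup K G" "H \<subseteq> K"
  shows "card H dvd card K"
proof -
  interpret K: group "G\<lparr>carrier := K\<rparr>" by (rule subgroup_imp_group[OF assms(3)])
  have "subgroup H (G\<lparr>carrier := K\<rparr>)"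
    by (rule subgroup_incl[OF assms(2,3,4)])
  from K.lagrange[OF this] have "card (rcosets\<^bsub>G\<lparr>carrier := K\<rparr>\<^esub> H) * card H = card K"
    by (simp add: order_def)
  then show ?thesis by (metis dvd_triv_right)
qed

text \<open>If \<open>C\<close> contains a subgroup of the full q-power order for each prime q, the
  order of \<open>M\<close> divides that of \<open>C\<close>. Claims about all of \<open>M\<close>
  can thus be checked on one Sylow subgroup for each prime.\<close>

lemma (in group) subgroup_eq_of_sylows:
  assumes fin: "finite (carrier G)" and C: "subgroup C G" and M: "subgroup M G" and "C \<subseteq> M"
    and S: "\<And>q. Factorial_Ring.prime q \<Longrightarrow> q dvd card M \<Longrightarrow>
           \<exists>Q. subgroup Q G \<and> Q \<subseteq> C \<and> card Q = q ^ multiplicity q (card M)"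
  shows "C = M"
proof -
  have fC: "finite C" "finite M" using fin C M subgroup.finite_imp_card_positive subgroup.subset finite_subset by metis+
  have pos: "card M > 0" "card C > 0" using fin C M subgroup.finite_imp_card_positive by auto
  have "card M dvd card C"
  proof (rule multiplicity_le_imp_dvd)
    fix q :: nat assume q: "Factorial_Ring.prime q"
    show "multiplicity q (card M) \<le> multiplicity q (card C)"
    proof (cases "q dvd card M")
      case True
      then obtain Q where Q: "subgroup Q G" "Q \<subseteq> C" "card Q = q ^ multiplicity q (card M)" using S q by blast
      then have "q ^ multiplicity q (card M) dvd card C" using card_subgroup_dvd[OF fin Q(1) C Q(2)] by simp
      then show ?thesis using pos q by (intro multiplicity_geI) (auto simp: prime_gt_1_nat)
    qed (simp add: not_dvd_imp_multiplicity_0)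
  qed (use pos in auto)
  then have "card M \<le> card C" using pos by (auto dest: dvd_imp_le)
  then show ?thesis using card_seteq[OF fC(2) \<open>C \<subseteq> M\<close>] by simp
qed

lemma (in group) subgroup_sylow:
  assumes fin: "finite (carrier G)" and M: "subgroup M G" and q: "Factorial_Ring.prime q"
  obtains Q where "subgroup Q G" "Q \<subseteq> M" "card Q = q ^ multiplicity q (card M)"
proof -
  interpret M: group "G\<lparr>carrier := M\<rparr>" by (rule subgroup_imp_group[OF M])
  have fM: "finite M" using fin M finite_subset subgroup.subset by metis
  have "order (G\<lparr>carrier := M\<rparr>) = q ^ multiplicity q (card M) * (card M div q ^ multiplicity q (card M))"
    by (simp add: order_def multiplicity_dvd)
  from sylow_thm[OF q M.group_axioms this] fM obtain Q where
    Q: "subgroup Q (G\<lparr>carrier := M\<rparr>)" "card Q = q ^ multiplicity q (card M)" by auto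
  then have "subgroup Q G" "Q \<subseteq> M" using incl_subgroup[OF M Q(1)] subgroup.subset[OF Q(1)] by auto
  then show ?thesis using Q that by blast
qed

lemma (in group) centralizer_subgroup:
  assumes "S \<subseteq> carrier G"
  shows "subgroup {g \<in> carrier G. \<forall>x\<in>S. conjg G g x = x} G"
proof (rule subgroupI)
  show "{g \<in> carrier G. \<forall>x\<in>S. conjg G g x = x} \<noteq> {}"
    using assms by (intro ex_in_conv[THEN iffD1] exI[of _ \<one>]) auto
next
  fix g assume g: "g \<in> {g \<in> carrier G. \<forall>x\<in>S. conjg G g x = x}"
  have "conjg G (inv g) x = x" if "x \<in> S" for x
  proof -
    have x: "x \<in> carrier G" using assms that by auto
    have "conjg G (inv g) x = conjg G (inv g) (conjg G g x)" using g that by auto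
    also have "\<dots> = x" using g x conjg_mult[of "inv g" g x] by simp
    finally show ?thesis .
  qed
  then show "inv g \<in> {g \<in> carrier G. \<forall>x\<in>S. conjg G g x = x}" using g by auto
next
  fix g h assume "g \<in> {g \<in> carrier G. \<forall>x\<in>S. conjg G g x = x}" "h \<in> {g \<in> carrier G. \<forall>x\<in>S. conjg G g x = x}"
  then show "g \<otimes> h \<in> {g \<in> carrier G. \<forall>x\<in>S. conjg G g x = x}"
    using assms conjg_mult by (auto simp: subset_iff)
qed auto

text \<open>Only an inclusion of the conjugate in \<open>P\<close> is demanded. As conjugation is
  injective and \<open>P\<close> finite, it is an equality, which yields closure under
  inverses.\<close>

lemma (in group) normalizer_subgroup:
  assumes fin: "finite (carrier G)" and P: "P \<subseteq> carrier G"
  shows "subgroup {g \<in> carrier G. \<forall>x\<in>P. conjg G g x \<in> P} G" (is "subgroup ?N G")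
proof (rule subgroupI)
  show "?N \<noteq> {}"
    using assms by (intro ex_in_conv[THEN iffD1] exI[of _ \<one>]) auto
next
  fix g assume g: "g \<in> ?N"
  have inj: "inj_on (conjg G g) P"
    using g P by (auto intro!: inj_onI simp: subset_iff)
  have fP: "finite P" using P fin finite_subset by auto
  have surj: "conjg G g ` P = P"
    using g by (intro card_subset_eq fP) (auto simp: card_image[OF inj])
  have "conjg G (inv g) x \<in> P" if "x \<in> P" for x
  proof -
    have "x \<in> conjg G g ` P" using surj \<open>x \<in> P\<close> by simp
    then obtain y where y: "y \<in> P" "x = conjg G g y" by (elim imageE)
    then have "y \<in> carrier G" using P by auto
    have "conjg G (inv g) x = y" using g y \<open>y \<in> carrier G\<close> conjg_mult[of "inv g" g y] by simp
    then show ?thesis using y by simp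
  qed
  then show "inv g \<in> ?N" using g by auto
next
  fix g h assume "g \<in> ?N" "h \<in> ?N"
  then show "g \<otimes> h \<in> ?N"
    using P conjg_mult by (auto simp: subset_iff)
qed auto

text \<open>If x and y did not commute, the centre of \<open>P\<close>, the centralizer of x and
  \<open>P\<close> would be strictly increasing subgroups of p-power order. With at most two factors
  p available the centre would be trivial, but its order is congruent to that of \<open>P\<close>
  modulo p.\<close>

lemma (in group) prime_square_abelian:
  assumes p: "Factorial_Ring.prime p" and P: "subgroup P G" "card P = p ^ k" "k \<le> 2"
    and xy: "x \<in> P" "y \<in> P"
  shows "x \<otimes> y = y \<otimes> x"
proof -
  interpret P: group "G\<lparr>carrier := P\<rparr>" by (rule subgroup_imp_group[OF P(1)])
  let ?P = "G\<lparr>carrier := P\<rparr>"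
  have sub: "P \<subseteq> carrier G" by (rule subgroup.subset[OF P(1)])
  have p1: "p > 1" using p prime_gt_1_nat by auto
  have fP: "finite P" using P(2) p1 by (metis card.infinite power_eq_0_iff not_less_zero)
  have cj: "conjg ?P g z = conjg G g z" if "g \<in> P" for g z using that P(1) by simp
  define Z where "Z = {z \<in> P. \<forall>g\<in>P. conjg G g z = z}"
  \<comment> \<open>Commuting is symmetric: as defined, \<open>Z\<close> is the set of fixed points
    of \<open>P\<close> under conjugation; in this form it is a centralizer and hence a
    subgroup.\<close>
  have Zalt: "Z = {z \<in> P. \<forall>g\<in>P. conjg G z g = g}"
    using sub by (auto simp: Z_def conjg_eq_iff subset_iff)
  have Zs: "subgroup Z ?P"
    using P.centralizer_subgroup[of P] cj by (simp add: Zalt cong: conj_cong)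
  have "[card P = card Z] (mod p)"
    unfolding Z_def
  proof (rule subgroup_card_fixed_points_cong[OF p P(1,2) fP])
    show "conjg G g x \<in> P" if "g \<in> P" "x \<in> P" for g x
      using that P(1) by (simp add: subgroup.m_closed subgroup.m_inv_closed)
  qed (use sub conjg_mult in \<open>auto simp: subset_iff\<close>)
  show ?thesis
  proof (rule ccontr)
    assume nc: "x \<otimes> y \<noteq> y \<otimes> x"
    then have xZ: "x \<notin> Z" using xy sub by (auto simp: Zalt conjg_eq_iff subset_iff)
    define C where "C = {g \<in> P. conjg G g x = x}"
    have Cs: "subgroup C ?P"
      using P.centralizer_subgroup[of "{x}"] cj xy by (simp add: C_def cong: conj_cong)
    have "x \<in> C" using xy sub by (auto simp: C_def conjg_eq_iff subset_iff)
    moreover have "Z \<subseteq> C" using xy by (auto simp: Zalt Z_def C_def)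
    ultimately have ZC: "Z \<subset> C" using xZ by auto
    have "y \<notin> C" using nc xy sub conjg_eq_iff by (auto simp: C_def subset_iff)
    then have CP: "C \<subset> P" using xy by (auto simp: C_def)
    have fin: "finite Z" "finite C" using fP by (auto simp: Z_def C_def)
    have c1: "card Z < card C" "card C < card P" using ZC CP fin fP by (auto intro: psubset_card_mono)
    have d: "card Z dvd p ^ k" "card C dvd p ^ k"
      using P.card_subgroup_dvd[OF _ Zs P.subgroup_self] P.card_subgroup_dvd[OF _ Cs P.subgroup_self] fP P(2) ZC CP by auto
    obtain i where i: "card Z = p ^ i" using d(1) divides_primepow_nat[OF p] by blast
    obtain j where "card C = p ^ j" using d(2) divides_primepow_nat[OF p] by blast
    note ij = i this
    have "i < j" "j < k" using ij c1 P(2) p1 by auto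
    then have "i = 0" "k = 2" using P(3) by auto
    then have "[p ^ 2 = 1] (mod p)" using \<open>[card P = card Z] (mod p)\<close> ij P by simp
    then show False using p1 by (metis cong_0_iff cong_def dvd_triv_left mod_less power2_eq_square zero_neq_one mod_mult_self1_is_0)
  qed
qed

lemma (in group) inj_on_mult_subgroups:
  assumes A: "subgroup A G" and B: "subgroup B G" and AB: "A \<inter> B = {\<one>}"
  shows "inj_on (\<lambda>(a, b). a \<otimes> b) (A \<times> B)"
proof (rule inj_onI, clarify)
  fix a b a' b' assume x: "a \<in> A" "b \<in> B" "a' \<in> A" "b' \<in> B" and e: "a \<otimes> b = a' \<otimes> b'"
  have c: "a \<in> carrier G" "b \<in> carrier G" "a' \<in> carrier G" "b' \<in> carrier G"
    using x A B subgroup.subset by blast+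
  have "inv a' \<otimes> a = b' \<otimes> inv b" using c e
    by (metis inv_closed inv_solve_left inv_solve_right m_assoc m_closed)
  moreover have "inv a' \<otimes> a \<in> A" "b' \<otimes> inv b \<in> B"
    using x A B by (auto simp: subgroup.m_closed subgroup.m_inv_closed)
  ultimately have "inv a' \<otimes> a = \<one>" using AB by auto
  then have "a = a'" using c by (metis inv_equality inv_inv inv_closed)
  then show "a = a' \<and> b = b'" using e c by simp
qed

section \<open>Transfer into an abelian Sylow subgroup\<close>

locale abelian_subgroup_cosets = group G for G (structure) +
  fixes P :: "'a set"
  assumes fin: "finite (carrier G)" and P: "subgroup P G"
    and Pab: "\<And>x y. x \<in> P \<Longrightarrow> y \<in> P \<Longrightarrow> x \<otimes> y = y \<otimes> x"
begin

abbreviation translate :: "'a \<Rightarrow> 'a set \<Rightarrow> 'a set" (infixr \<open>\<cdot>\<close> 75) where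
  "g \<cdot> C \<equiv> g <#\<^bsub>G\<^esub> C"

definition cosets where "cosets = lcosets P"
definition rep where "rep C = (SOME x. x \<in> C)"

text \<open>\<open>x \<otimes> rep C\<close> equals
  \<open>rep (x \<cdot> C) \<otimes> cocyc x C\<close>. The product of these factors over all cosets
  is the classical transfer into \<open>P\<close>.\<close>

definition cocyc where "cocyc x C = inv (rep (x \<cdot> C)) \<otimes> x \<otimes> rep C"

abbreviation GP where "GP \<equiv> G\<lparr>carrier := P\<rparr>"

definition transfer where "transfer x = finprod GP (cocyc x) cosets"

lemma Psub: "P \<subseteq> carrier G" by (rule subgroup.subset[OF P])

sublocale GP: comm_group GP
proof -
  interpret GP: group GP by (rule subgroup_imp_group[OF P])
  show "comm_group GP" by (rule GP.group_comm_groupI) (use Pab in simp)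
qed

lemma fin_cosets: "finite cosets"
  unfolding cosets_def LCOSETS_def using fin by auto

lemma coset_sub: "C \<in> cosets \<Longrightarrow> C \<subseteq> carrier G"
  using lcosets_subset_PowG[OF P] by (auto simp: cosets_def)

lemma coset_eq: "C \<in> cosets \<Longrightarrow> y \<in> C \<Longrightarrow> C = y \<cdot> P"
  using l_repr_independence[OF _ _ P] by (auto simp: cosets_def LCOSETS_def)

lemma coset_in: "y \<in> carrier G \<Longrightarrow> y \<cdot> P \<in> cosets"
  by (auto simp: cosets_def LCOSETS_def)

lemma rep_in: "C \<in> cosets \<Longrightarrow> rep C \<in> C"
  unfolding rep_def using lcos_self[OF _ P]
  by (intro someI_ex[of "\<lambda>x. x \<in> C"]) (auto simp: cosets_def LCOSETS_def)

lemma rep_carrier: "C \<in> cosets \<Longrightarrow> rep C \<in> carrier G"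
  using rep_in coset_sub by blast

lemma act_closed: "g \<in> carrier G \<Longrightarrow> C \<in> cosets \<Longrightarrow> g \<cdot> C \<in> cosets"
  using coset_in lcos_m_assoc[OF Psub] by (auto simp: cosets_def LCOSETS_def)

lemma act_mult: "g \<in> carrier G \<Longrightarrow> h \<in> carrier G \<Longrightarrow> C \<in> cosets \<Longrightarrow> (g \<otimes> h) \<cdot> C = g \<cdot> (h \<cdot> C)"
  using lcos_m_assoc coset_sub by simp

lemma act_one: "C \<in> cosets \<Longrightarrow> \<one> \<cdot> C = C"
  using lcos_mult_one coset_sub by simp

lemma act_mem: "y \<in> C \<Longrightarrow> g \<otimes> y \<in> g \<cdot> C"
  by (auto simp: l_coset_def)

lemma coset_diff: "C \<in> cosets \<Longrightarrow> y \<in> C \<Longrightarrow> z \<in> C \<Longrightarrow> inv y \<otimes> z \<in> P"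
  using coset_eq[of C y] coset_sub subgroup.lcos_module_imp[OF P group_axioms, of y z] by blast

lemma cocyc_in: "x \<in> carrier G \<Longrightarrow> C \<in> cosets \<Longrightarrow> cocyc x C \<in> P"
  unfolding cocyc_def
  using coset_diff[of "x \<cdot> C" "rep (x \<cdot> C)" "x \<otimes> rep C"] act_closed rep_in act_mem rep_carrier
  by (simp add: m_assoc)

lemma cocyc_mult:
  assumes "x \<in> carrier G" "y \<in> carrier G" "C \<in> cosets"
  shows "cocyc (x \<otimes> y) C = cocyc x (y \<cdot> C) \<otimes> cocyc y C"
proof -
  have c: "rep C \<in> carrier G" "rep (y \<cdot> C) \<in> carrier G" "rep (x \<cdot> (y \<cdot> C)) \<in> carrier G"
    using assms act_closed rep_carrier by auto
  have "rep (y \<cdot> C) \<otimes> (inv (rep (y \<cdot> C)) \<otimes> (y \<otimes> rep C)) = y \<otimes> rep C"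
    using c assms by (simp flip: m_assoc)
  then show ?thesis using assms c by (simp add: cocyc_def act_mult m_assoc)
qed

lemma cocyc_one: "C \<in> cosets \<Longrightarrow> cocyc \<one> C = \<one>"
  using rep_carrier by (simp add: cocyc_def act_one)

lemma act_bij: "g \<in> carrier G \<Longrightarrow> bij_betw (\<lambda>C. g \<cdot> C) cosets cosets"
  by (rule bij_betw_byWitness[where f' = "\<lambda>C. inv g \<cdot> C"])
    (auto simp: act_closed act_one simp flip: act_mult)

lemma transfer_hom: "transfer \<in> hom G GP"
proof (rule homI)
  fix x assume "x \<in> carrier G"
  then show "transfer x \<in> carrier GP"
    unfolding transfer_def using GP.finprod_closed[of "cocyc x" cosets] cocyc_in by auto
next
  fix x y assume xy: "x \<in> carrier G" "y \<in> carrier G"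
  have "transfer (x \<otimes> y) = finprod GP (\<lambda>C. cocyc x (y \<cdot> C) \<otimes>\<^bsub>GP\<^esub> cocyc y C) cosets"
    unfolding transfer_def using xy cocyc_in act_closed
    by (intro GP.finprod_cong') (auto simp: cocyc_mult subgroup.m_closed[OF P])
  also have "\<dots> = finprod GP (\<lambda>C. cocyc x (y \<cdot> C)) cosets \<otimes>\<^bsub>GP\<^esub> transfer y"
    unfolding transfer_def using xy cocyc_in act_closed by (intro GP.finprod_multf) auto
  also have "finprod GP (\<lambda>C. cocyc x (y \<cdot> C)) cosets = finprod GP (cocyc x) ((\<lambda>C. y \<cdot> C) ` cosets)"
    using xy cocyc_in act_closed act_bij[OF xy(2)]
    by (intro GP.finprod_reindex[symmetric]) (auto simp: bij_betw_def)
  also have "(\<lambda>C. y \<cdot> C) ` cosets = cosets"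
    using act_bij[OF xy(2)] by (simp add: bij_betw_def)
  finally show "transfer (x \<otimes> y) = transfer x \<otimes>\<^bsub>GP\<^esub> transfer y" unfolding transfer_def .
qed

lemma finprod_cocyc_powers:
  assumes "x \<in> carrier G" "C \<in> cosets"
  shows "finprod GP (\<lambda>i. cocyc x ((x [^] i) \<cdot> C)) {..<m::nat} = cocyc (x [^] m) C"
proof (induction m)
  case 0
  then show ?case using assms by (simp add: cocyc_one)
next
  case (Suc m)
  have fs: "(\<lambda>i::nat. cocyc x ((x [^] i) \<cdot> C)) \<in> {..<m} \<rightarrow> P" "cocyc x ((x [^] m) \<cdot> C) \<in> P"
    using assms act_closed cocyc_in by auto
  have "finprod GP (\<lambda>i. cocyc x ((x [^] i) \<cdot> C)) {..<Suc m}
     = cocyc x ((x [^] m) \<cdot> C) \<otimes> finprod GP (\<lambda>i. cocyc x ((x [^] i) \<cdot> C)) {..<m}"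
    using fs by (simp add: lessThan_Suc)
  also have "\<dots> = cocyc x ((x [^] m) \<cdot> C) \<otimes> cocyc (x [^] m) C"
    using Suc by simp
  also have "\<dots> = cocyc (x \<otimes> x [^] m) C"
    using assms by (simp add: cocyc_mult)
  also have "x \<otimes> x [^] m = x [^] Suc m" using assms nat_pow_Suc2 by simp
  finally show ?case .
qed

text \<open>The product telescopes along every cycle of \<open>x\<close>.\<close>

lemma finprod_cocyc_moved:
  fixes p :: nat
  assumes x: "x \<in> carrier G" "x [^] p = \<one>" and p: "Factorial_Ring.prime p"
  shows "finprod GP (cocyc x) {C \<in> cosets. x \<cdot> C \<noteq> C} = \<one>"
proof -
  define M where "M = {C \<in> cosets. x \<cdot> C \<noteq> C}"
  define R where "R C = (\<lambda>i. (x [^] i) \<cdot> C) ` {..<p}" for C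
  have Mc: "M \<subseteq> cosets" by (auto simp: M_def)
  have p0: "p > 0" using p prime_gt_0_nat by blast
  have xmod: "x [^] (i mod p) = x [^] i" for i :: nat
  proof -
    have "x [^] i = x [^] (p * (i div p) + i mod p)" by simp
    also have "\<dots> = (x [^] p) [^] (i div p) \<otimes> x [^] (i mod p)"
      using x(1) by (simp add: nat_pow_mult nat_pow_pow del: mult_div_mod_eq)
    finally show ?thesis using x by simp
  qed
  have Ralt: "R C = range (\<lambda>i::nat. (x [^] i) \<cdot> C)" for C
  proof -
    have "(x [^] i) \<cdot> C \<in> R C" for i :: nat
      unfolding R_def using p0 xmod[of i] by (intro image_eqI[of _ _ "i mod p"]) auto
    then show ?thesis by (auto simp: R_def)
  qed
  have pw: "(x [^] i) \<cdot> ((x [^] j) \<cdot> C) = (x [^] (i + j)) \<cdot> C" if "C \<in> cosets" for C and i j :: nat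
    using that x by (simp add: nat_pow_mult flip: act_mult)
  \<comment> \<open>As p is prime, x is a power of \<open>x [^] d\<close>, so a coset fixed by the
    latter is fixed by x.\<close>
  have moved: "(x [^] d) \<cdot> C \<noteq> C" if C: "C \<in> M" and d: "\<not> p dvd d" for C d
  proof
    assume fix_: "(x [^] d) \<cdot> C = C"
    have it: "(x [^] (d * k)) \<cdot> C = C" for k
    proof (induction k)
      case 0
      then show ?case using C Mc act_one by auto
    next
      case (Suc k)
      have "(x [^] (d * Suc k)) \<cdot> C = (x [^] d) \<cdot> ((x [^] (d * k)) \<cdot> C)"
        using pw[of C d "d * k"] C Mc by auto
      then show ?case using Suc fix_ by simp
    qed
    have "coprime d p" using p d by (metis coprime_commute prime_imp_coprime)
    then obtain k where "[d * k = 1] (mod p)" using cong_solve_coprime_nat[of d p] by auto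
    then have "x [^] (d * k) = x"
      using xmod[of "d * k"] xmod[of 1] x(1) by (simp add: cong_def)
    then show False using it[of k] C by (simp add: M_def)
  qed
  have inj: "inj_on (\<lambda>i. (x [^] i) \<cdot> C) {..<p}" if C: "C \<in> M" for C
  proof (rule linorder_inj_onI)
    fix i j :: nat assume ij: "i < j" "i \<in> {..<p}" "j \<in> {..<p}"
    show "(x [^] i) \<cdot> C \<noteq> (x [^] j) \<cdot> C"
    proof
      assume "(x [^] i) \<cdot> C = (x [^] j) \<cdot> C"
      then have "(x [^] (p - i)) \<cdot> ((x [^] i) \<cdot> C) = (x [^] (p - i)) \<cdot> ((x [^] j) \<cdot> C)" by simp
      then have "(x [^] p) \<cdot> C = (x [^] (p + (j - i))) \<cdot> C"
        using pw C Mc ij by (auto simp: subset_iff)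
      also have "x [^] (p + (j - i)) = x [^] (j - i)"
        using xmod[of "p + (j - i)"] xmod[of "j - i"] by simp
      finally have "(x [^] (j - i)) \<cdot> C = C" using x act_one C Mc by auto
      moreover have "\<not> p dvd j - i" using ij by (auto dest: dvd_imp_le)
      ultimately show False using moved C by blast
    qed
  qed auto
  have RM: "R C \<subseteq> M" if C: "C \<in> M" for C
  proof
    fix D assume "D \<in> R C"
    then obtain i :: nat where D: "D = (x [^] i) \<cdot> C" by (auto simp: Ralt)
    have Cc: "C \<in> cosets" using C Mc by auto
    have "x \<cdot> D = (x [^] i) \<cdot> (x \<cdot> C)"
      using pw[OF Cc, of 1 i] pw[OF Cc, of i 1] x(1) by (simp add: D add.commute)
    then have "x \<cdot> D \<noteq> D"
      using act_bij[of "x [^] i"] C Cc x(1) act_closed[of x C] by (auto simp: D M_def bij_betw_def inj_on_def)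
    then show "D \<in> M" using D Cc x(1) act_closed by (auto simp: M_def)
  qed
  have Rself: "C \<in> R C" if "C \<in> M" for C
    unfolding R_def using that Mc act_one p0 by (intro image_eqI[of _ _ 0]) auto
  have Req: "R D = R C" if C: "C \<in> M" and D: "D \<in> R C" for C D
  proof -
    have Cc: "C \<in> cosets" using C Mc by auto
    obtain i where i: "D = (x [^] i) \<cdot> C" "i < p" using D by (auto simp: R_def)
    have "R D \<subseteq> R C" using pw[OF Cc] by (auto simp: Ralt i)
    moreover have "(x [^] j) \<cdot> C \<in> R D" for j :: nat
    proof -
      have "(x [^] (j + (p - i))) \<cdot> D = (x [^] (j + p)) \<cdot> C" using pw[OF Cc] i by simp
      also have "x [^] (j + p) = x [^] j" using xmod[of "j + p"] xmod[of j] by simp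
      finally show ?thesis unfolding Ralt by (metis rangeI)
    qed
    ultimately show ?thesis by (auto simp: Ralt[of C])
  qed
  \<comment> \<open>The orbit has length p, so the product over it is the cocycle of
    \<open>x [^] p\<close>, that is of \<open>\<one>\<close>.\<close>
  have one: "finprod GP (cocyc x) (R C) = \<one>" if C: "C \<in> M" for C
  proof -
    have Cc: "C \<in> cosets" using C Mc by auto
    have "finprod GP (cocyc x) (R C) = finprod GP (\<lambda>i. cocyc x ((x [^] i) \<cdot> C)) {..<p}"
      unfolding R_def using x Cc act_closed cocyc_in
      by (intro GP.finprod_reindex inj[OF C]) auto
    then show ?thesis using finprod_cocyc_powers[OF x(1) Cc] x cocyc_one[OF Cc] by simp
  qed
  have "M = \<Union> (R ` M)" using RM Rself by blast
  then have "finprod GP (cocyc x) M = finprod GP (cocyc x) (\<Union> (R ` M))" by simp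
  also have "\<dots> = finprod GP (finprod GP (cocyc x)) (R ` M)"
  proof (rule GP.finprod_Union_disjoint)
    show "finite (R ` M)" using finite_subset[OF Mc fin_cosets] by simp
    show "finite A \<and> (\<forall>C\<in>A. cocyc x C \<in> carrier GP)" if "A \<in> R ` M" for A
      using that RM Mc cocyc_in[OF x(1)] by (auto simp: R_def subset_iff)
    show "pairwise disjnt (R ` M)"
      unfolding pairwise_def disjnt_def using Req RM by blast
  qed
  also have "\<dots> = \<one>" using one by (auto intro: GP.finprod_one_eqI[simplified])
  finally show ?thesis by (simp add: M_def)
qed

end

text \<open>The setting of Burnside's theorem: the second premise of \<open>cent\<close> says that g
  normalises \<open>P\<close>, so \<open>P\<close> is a Sylow subgroup in the centre of its
  normaliser.\<close>

locale central_sylow = abelian_subgroup_cosets +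
  fixes p k :: nat
  assumes p: "Factorial_Ring.prime p" and cardP: "card P = p ^ k"
    and index: "\<not> p dvd order G div p ^ k"
    and cent: "\<And>g x. g \<in> carrier G \<Longrightarrow> (\<And>x. x \<in> P \<Longrightarrow> conjg G g x \<in> P) \<Longrightarrow> x \<in> P \<Longrightarrow> conjg G g x = x"
begin

text \<open>For \<open>u = rep C\<close> this is the definition. Any other element of
  \<open>C\<close> differs from \<open>rep C\<close> by a factor in \<open>P\<close>, and
  conjugation by it does nothing to the cocycle, which lies in the abelian group
  \<open>P\<close>.\<close>

lemma cocyc_fixed:
  assumes "x \<in> carrier G" "C \<in> cosets" "x \<cdot> C = C" "u \<in> C"
  shows "cocyc x C = inv u \<otimes> x \<otimes> u"
proof -
  define t where "t = rep C"
  have t: "t \<in> C" "t \<in> carrier G" "u \<in> carrier G"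
    using assms rep_in coset_sub by (auto simp: t_def)
  define h where "h = inv t \<otimes> u"
  have h: "h \<in> P" using coset_diff assms t by (auto simp: h_def)
  then have hc: "h \<in> carrier G" using Psub by auto
  have u: "u = t \<otimes> h" using t by (simp add: h_def flip: m_assoc)
  have c: "cocyc x C = inv t \<otimes> x \<otimes> t" using assms by (simp add: cocyc_def t_def)
  have cP: "cocyc x C \<in> P" using assms cocyc_in by simp
  have "inv u \<otimes> x \<otimes> u = inv h \<otimes> (cocyc x C \<otimes> h)"
    using t hc assms(1) by (simp add: u c inv_mult_group m_assoc)
  also have "\<dots> = inv h \<otimes> (h \<otimes> cocyc x C)" using Pab[OF cP h] by simp
  also have "\<dots> = cocyc x C" using hc cP Psub by (simp add: subset_iff flip: m_assoc)
  finally show ?thesis by simp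
qed

text \<open>On the cosets fixed by \<open>x\<close> the cocycle is constant along \<open>P\<close>-orbits. Its fibre over \<open>y\<close>
  therefore has order divisible by \<open>p\<close>, unless \<open>y = x\<close>, the value on the cosets fixed by \<open>P\<close>.\<close>

lemma transfer_order_p:
  assumes x: "x \<in> P" "x [^] p = \<one>"
  shows "\<exists>m. \<not> p dvd m \<and> transfer x = x [^] m"
proof -
  have xc: "x \<in> carrier G" using x Psub by auto
  define Fx where "Fx = {C \<in> cosets. x \<cdot> C = C}"
  define A where "A y = {C \<in> Fx. cocyc x C = y}" for y
  define FP where "FP = {C \<in> cosets. \<forall>g\<in>P. g \<cdot> C = C}"
  have fA: "finite (A y)" "A y \<subseteq> cosets" for y using fin_cosets by (auto simp: A_def Fx_def)
  have fP: "finite P" using Psub fin finite_subset by blast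
  \<comment> \<open>If all of \<open>P\<close> fixes the coset of u, then the inverse of u
    normalises \<open>P\<close>, and \<open>cent\<close> makes the value of the cocycle
    \<open>x\<close>.\<close>
  have FPA: "FP \<subseteq> A x"
  proof
    fix C assume C: "C \<in> FP"
    then have CF: "C \<in> Fx" using x by (auto simp: FP_def Fx_def)
    define u where "u = rep C"
    have u: "u \<in> C" "u \<in> carrier G" "C \<in> cosets" using C rep_in rep_carrier by (auto simp: u_def FP_def)
    have norm: "conjg G (inv u) g \<in> P" if "g \<in> P" for g
    proof -
      have "g \<otimes> u \<in> C" using C that act_mem[OF u(1), of g] by (auto simp: FP_def)
      then show ?thesis using coset_diff[OF u(3) u(1)] u Psub that by (auto simp: m_assoc)
    qed
    have "conjg G (inv u) x = x" using cent[of "inv u" x] norm u x by simp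
    then have "cocyc x C = x" using cocyc_fixed[OF xc, of C u] u CF by (simp add: Fx_def)
    then show "C \<in> A x" using CF by (simp add: A_def)
  qed
  have clA: "g \<cdot> C \<in> A y" if g: "g \<in> P" and C: "C \<in> A y" for g C y
  proof -
    have gc: "g \<in> carrier G" using g Psub by auto
    have Cc: "C \<in> cosets" "x \<cdot> C = C" "cocyc x C = y" using C by (auto simp: A_def Fx_def)
    have f: "x \<cdot> (g \<cdot> C) = g \<cdot> C"
      using Cc gc xc Pab[OF x(1) g] by (metis act_mult)
    define u where "u = rep C"
    have u: "u \<in> C" "u \<in> carrier G" using Cc rep_in rep_carrier by (auto simp: u_def)
    have "cocyc x (g \<cdot> C) = inv (g \<otimes> u) \<otimes> x \<otimes> (g \<otimes> u)"
      using Cc gc xc f act_closed act_mem u by (intro cocyc_fixed) auto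
    also have "\<dots> = inv u \<otimes> (inv g \<otimes> (x \<otimes> g)) \<otimes> u"
      using u gc xc by (simp add: inv_mult_group m_assoc)
    also have "inv g \<otimes> (x \<otimes> g) = x"
      using gc xc Pab[OF x(1) g] by (simp flip: m_assoc)
    also have "inv u \<otimes> x \<otimes> u = y"
      using cocyc_fixed[OF xc Cc(1,2) u(1)] Cc by simp
    finally show ?thesis using Cc gc f act_closed by (simp add: A_def Fx_def)
  qed
  have congA: "[card (A y) = card {C \<in> A y. \<forall>g\<in>P. g \<cdot> C = C}] (mod p)" for y
    by (rule subgroup_card_fixed_points_cong[OF p P cardP fA(1)])
      (use clA fA Psub in \<open>auto simp: act_one act_mult subset_iff\<close>)
  have pdvdA: "p dvd card (A y)" if "y \<noteq> x" for y
  proof -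
    have "{C \<in> A y. \<forall>g\<in>P. g \<cdot> C = C} = {}"
    proof -
      have "{C \<in> A y. \<forall>g\<in>P. g \<cdot> C = C} \<subseteq> FP" using fA(2)[of y] by (auto simp: FP_def)
      moreover have "A y \<inter> A x = {}" using that by (auto simp: A_def)
      ultimately show ?thesis using FPA by blast
    qed
    then have "[card (A y) = 0] (mod p)" using congA[of y] by (simp only: card.empty)
    then show ?thesis by (simp add: cong_0_iff)
  qed
  \<comment> \<open>In the fibre over \<open>x\<close> the cosets fixed by \<open>P\<close> are all
    of \<open>FP\<close>. Their number is congruent to the index of \<open>P\<close>, hence prime to
    p.\<close>
  have "{C \<in> A x. \<forall>g\<in>P. g \<cdot> C = C} = FP"
    using FPA fA(2)[of x] by (auto simp: FP_def)
  then have "[card (A x) = card FP] (mod p)" using congA[of x] by simp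
  moreover have "[card cosets = card FP] (mod p)"
    unfolding FP_def
    by (rule subgroup_card_fixed_points_cong[OF p P cardP fin_cosets])
      (use act_closed Psub in \<open>auto simp: act_one act_mult subset_iff\<close>)
  ultimately have "[card (A x) = card cosets] (mod p)" by (metis cong_sym cong_trans)
  moreover have "card cosets = order G div p ^ k"
  proof -
    have "card cosets * p ^ k = order G" using l_lagrange[OF fin P] cardP by (simp add: cosets_def)
    then show ?thesis using p prime_gt_0_nat by (metis nonzero_mult_div_cancel_right not_less_zero power_not_zero)
  qed
  ultimately have nd: "\<not> p dvd card (A x)" using index by (metis cong_dvd_iff)
  have "transfer x = finprod GP (cocyc x) (Fx \<union> {C \<in> cosets. x \<cdot> C \<noteq> C})"
    unfolding transfer_def by (rule arg_cong[where f = "finprod GP (cocyc x)"]) (auto simp: Fx_def)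
  also have "\<dots> = finprod GP (cocyc x) Fx \<otimes>\<^bsub>GP\<^esub> finprod GP (cocyc x) {C \<in> cosets. x \<cdot> C \<noteq> C}"
    using fin_cosets cocyc_in[OF xc] by (intro GP.finprod_Un_disjoint) (auto simp: Fx_def)
  also have "\<dots> = finprod GP (cocyc x) Fx"
    using finprod_cocyc_moved[OF xc x(2) p] GP.r_one[of "finprod GP (cocyc x) Fx"] cocyc_in[OF xc]
    by (auto simp: Fx_def Pi_def intro!: GP.finprod_closed[simplified])
  also have "Fx = (\<Union>y\<in>P. A y)" using cocyc_in[OF xc] by (auto simp: A_def Fx_def)
  also have "finprod GP (cocyc x) (\<Union>y\<in>P. A y) = finprod GP (\<lambda>y. finprod GP (cocyc x) (A y)) P"
    using fP fA cocyc_in[OF xc] by (intro GP.finprod_UN_disjoint)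
      (auto simp: A_def Fx_def pairwise_def disjnt_def)
  also have "\<dots> = finprod GP (\<lambda>y. y [^]\<^bsub>GP\<^esub> card (A y)) P"
  proof (rule GP.finprod_cong')
    show "finprod GP (cocyc x) (A y) = y [^]\<^bsub>GP\<^esub> card (A y)" if y: "y \<in> P" for y
    proof -
      have "finprod GP (cocyc x) (A y) = finprod GP (\<lambda>_. y) (A y)"
        by (rule GP.finprod_cong') (use y in \<open>auto simp: A_def\<close>)
      then show ?thesis using GP.finprod_const[of y "A y"] y by simp
    qed
  qed (use GP.nat_pow_closed in \<open>auto simp del: GP.nat_pow_closed\<close>)
  \<comment> \<open>A nonempty fibre over y makes y a conjugate of \<open>x\<close>, so
    \<open>y [^] p = \<one>\<close>; for \<open>y \<noteq> x\<close> the size of the fibre is a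
    multiple of p and the factor vanishes.\<close>
  also have "\<dots> = finprod GP (\<lambda>y. if y = x then y [^]\<^bsub>GP\<^esub> card (A y) else \<one>\<^bsub>GP\<^esub>) P"
  proof (rule GP.finprod_cong')
    show "y [^]\<^bsub>GP\<^esub> card (A y) = (if y = x then y [^]\<^bsub>GP\<^esub> card (A y) else \<one>\<^bsub>GP\<^esub>)" if y: "y \<in> P" for y
    proof (cases "y = x \<or> A y = {}")
      case False
      then obtain C where C: "C \<in> Fx" "cocyc x C = y" by (auto simp: A_def)
      define u where "u = rep C"
      have u: "u \<in> C" "u \<in> carrier G" using C rep_in rep_carrier by (auto simp: u_def Fx_def)
      have yx: "y = conjg G (inv u) x" using cocyc_fixed[OF xc _ _ u(1)] C u by (auto simp: Fx_def)
      have yp: "conjg G (inv u) x [^] (m::nat) = conjg G (inv u) (x [^] m)" for m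
      proof (induction m)
        case (Suc m)
        then show ?case using u xc conjg_hom[of "inv u" "x [^] m" x] by simp
      qed (use u in simp)
      have "y [^] p = \<one>" using yp[of p] yx x(2) u by simp
      moreover obtain m where "card (A y) = p * m" using pdvdA[of y] False by (auto elim: dvdE)
      moreover have "y \<in> carrier G" using y Psub by auto
      ultimately have "y [^] card (A y) = \<one>" using nat_pow_pow[of y p m] by simp
      then show ?thesis using False by (simp add: nat_pow_consistent[of y _ P, symmetric])
    qed auto
  qed (use GP.nat_pow_closed in \<open>auto simp: subgroup.one_closed[OF P] simp del: GP.nat_pow_closed\<close>)
  also have "\<dots> = x [^]\<^bsub>GP\<^esub> card (A x)"
    using fP x GP.nat_pow_closed by (intro GP.finprod_singleton_swap) (auto simp del: GP.nat_pow_closed)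
  also have "\<dots> = x [^] card (A x)" by (simp add: nat_pow_consistent[of x _ P])
  finally show ?thesis using nd by blast
qed

text \<open>The transfer is injective on \<open>P\<close>: otherwise its kernel would contain an
  element y of order p in \<open>P\<close>, whose transfer is a power of y with exponent prime to p.
  So it maps \<open>P\<close> onto \<open>P\<close>, and its kernel is a complement.\<close>

theorem normal_complement:
  "\<exists>N. N \<lhd> G \<and> card N * p ^ k = order G"
proof -
  interpret T: group_hom G GP transfer
    using transfer_hom by (intro group_hom.intro group_hom_axioms.intro group_axioms GP.group_axioms)
  have TP: "transfer x \<noteq> \<one>" if x: "x \<in> P" "x \<noteq> \<one>" for x
  proof
    assume T1: "transfer x = \<one>"
    have xc: "x \<in> carrier G" using x Psub by auto
    have "x [^]\<^bsub>GP\<^esub> order GP = \<one>\<^bsub>GP\<^esub>" using x GP.pow_order_eq_1 by simp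
    then have xk: "x [^] (p ^ k) = \<one>"
      using cardP by (simp add: order_def nat_pow_consistent[of x _ P, symmetric])
    define j where "j = (LEAST j. x [^] (p ^ j) = \<one>)"
    have j1: "x [^] (p ^ j) = \<one>" unfolding j_def by (rule LeastI[of _ k]) (rule xk)
    have j0: "j \<noteq> 0" using j1 x xc by (auto intro: ccontr)
    \<comment> \<open>The last nontrivial term of x, x^p, x^(p^2), ... has order p.\<close>
    define y where "y = x [^] (p ^ (j - 1))"
    have "p ^ (j - 1) * p = p ^ j" using j0 by (metis power_minus_mult neq0_conv)
    then have yp: "y [^] p = \<one>" using j1 xc by (simp add: y_def nat_pow_pow)
    have y1: "y \<noteq> \<one>"
      unfolding y_def using not_less_Least[of "j - 1" "\<lambda>j. x [^] (p ^ j) = \<one>"] j0 by (simp flip: j_def)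
    have yP: "y \<in> P"
      using GP.nat_pow_closed[of x "p ^ (j - 1)"] x by (simp add: y_def nat_pow_consistent[of x _ P, symmetric])
    have "transfer y = transfer x [^]\<^bsub>GP\<^esub> (p ^ (j - 1))"
      unfolding y_def using T.hom_nat_pow[OF xc] by simp
    then have "transfer y = \<one>" using T1 GP.nat_pow_one[of "p ^ (j - 1)"] by simp
    then obtain m where m: "\<not> p dvd m" "y [^] m = \<one>" using transfer_order_p[OF yP yp] by auto
    have "coprime m p" using p m by (metis coprime_commute prime_imp_coprime)
    moreover have yc: "y \<in> carrier G" using yP Psub by auto
    ultimately show False using yp y1 m pow_eq_id[OF yc] p ord_eq_1[OF yc]
      by (metis coprime_common_divisor_nat)
  qed
  define N where "N = kernel G GP transfer"
  have N: "N \<lhd> G" unfolding N_def by (rule T.normal_kernel)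
  have injP: "inj_on transfer P"
  proof (rule inj_onI)
    fix x y assume xy: "x \<in> P" "y \<in> P" "transfer x = transfer y"
    then have c: "x \<in> carrier G" "y \<in> carrier G" using Psub by auto
    have "transfer (x \<otimes> inv y) = transfer y \<otimes>\<^bsub>GP\<^esub> inv\<^bsub>GP\<^esub> transfer y"
      using c xy by simp
    also have "\<dots> = \<one>\<^bsub>GP\<^esub>" by (rule GP.r_inv) (rule T.hom_closed[OF c(2)])
    finally have "transfer (x \<otimes> inv y) = \<one>" by simp
    then have "x \<otimes> inv y = \<one>" using TP xy P by (metis subgroup.m_closed subgroup.m_inv_closed)
    then show "x = y" using c by (metis inv_equality inv_inv inv_closed)
  qed
  have fP: "finite P" using Psub fin finite_subset by blast
  have "transfer ` P = P"
    using card_image[OF injP] fP Psub T.hom_closed by (intro card_subset_eq) auto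
  then have surj: "transfer ` carrier G = carrier GP"
    using T.hom_closed image_mono[OF Psub, of transfer] by auto
  have "card (rcosets N) = p ^ k"
    using iso_same_card[OF T.FactGroup_iso[OF surj]] cardP by (simp add: FactGroup_def N_def)
  then have "card N * p ^ k = order G"
    using lagrange[OF normal_imp_subgroup[OF N]] by (simp add: mult.commute)
  then show ?thesis using N by blast
qed

end

section \<open>Normal Sylow subgroups\<close>

lemma (in group) nat_pow_cong:
  assumes "x \<in> carrier G" "x [^] (d::nat) = \<one>" "[a = b] (mod d)"
  shows "x [^] a = x [^] b"
proof -
  have "ord x dvd d" using assms pow_eq_id by blast
  then have "[int a = int b] (mod int (ord x))" using assms(3) cong_dvd_modulus_nat cong_int_iff by blast
  then have "x [^] int a = x [^] int b"
    using int_pow_eq[OF assms(1)] by (metis cong_iff_dvd_diff cong_sym)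
  then show ?thesis by (simp add: int_pow_int)
qed

definition good_order :: "nat \<Rightarrow> bool" where
  "good_order n \<longleftrightarrow> odd n \<and> cube_free n \<and>
     (\<forall>p q. Factorial_Ring.prime p \<longrightarrow> Factorial_Ring.prime q \<longrightarrow> p dvd n \<longrightarrow> q dvd n \<longrightarrow> \<not> q dvd p - 1)"

lemma good_order_dvd: "good_order n \<Longrightarrow> d dvd n \<Longrightarrow> good_order d"
  unfolding good_order_def cube_free_def by (meson dvd_trans)

lemma cube_free_multiplicity:
  assumes "cube_free n" "n > 0" "Factorial_Ring.prime p" "p dvd n"
  defines "k \<equiv> multiplicity p n"
  shows "0 < k" "k \<le> 2" "p ^ k dvd n" "\<not> p dvd n div p ^ k" "p ^ k * (n div p ^ k) = n"
proof -
  have np: "\<not> is_unit p" using assms(3) not_prime_unit by blast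
  show "0 < k" unfolding k_def using assms(2-4) np by (simp add: prime_multiplicity_gt_zero_iff)
  show d: "p ^ k dvd n" unfolding k_def by (rule multiplicity_dvd)
  show "k \<le> 2"
  proof (rule ccontr)
    assume "\<not> k \<le> 2"
    then have "p ^ 3 dvd p ^ k" by (intro le_imp_power_dvd) auto
    then show False using d assms(1,3) by (meson cube_free_def dvd_trans)
  qed
  show "\<not> p dvd n div p ^ k" unfolding k_def
    using multiplicity_decompose[of n p] assms(2) np by simp
  show "p ^ k * (n div p ^ k) = n" using d by simp
qed

text \<open>For a Sylow q-subgroup of \<open>M\<close> with \<open>q \<noteq> r\<close>, the fixed
  points in \<open>V\<close> form a subgroup of some order r^j containing \<open>L\<close>, so
  \<open>l \<le> j\<close>. The fixed point congruence gives that q divides r^(k-j) - 1, and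
  \<open>hq\<close> forbids this unless j = k. A known fixed set \<open>L\<close> therefore reduces
  the exponents i that have to be excluded. The prime r is left to \<open>hr\<close>.\<close>

lemma (in group) coprime_action_trivial:
  fixes r :: nat
  assumes fin: "finite (carrier G)" and r: "Factorial_Ring.prime r"
    and V: "subgroup V G" "card V = r ^ k" and M: "subgroup M G"
    and norm: "\<And>m v. m \<in> M \<Longrightarrow> v \<in> V \<Longrightarrow> conjg G m v \<in> V"
    and L: "L \<subseteq> V" "card L = r ^ l" "\<And>m v. m \<in> M \<Longrightarrow> v \<in> L \<Longrightarrow> conjg G m v = v"
    and hr: "r dvd card M \<Longrightarrow> \<exists>Q. subgroup Q G \<and> Q \<subseteq> M \<and> card Q = r ^ multiplicity r (card M) \<and>
               (\<forall>g\<in>Q. \<forall>v\<in>V. conjg G g v = v)"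
    and hq: "\<And>q i. Factorial_Ring.prime q \<Longrightarrow> q dvd card M \<Longrightarrow> q \<noteq> r \<Longrightarrow> 0 < i \<Longrightarrow> i + l \<le> k \<Longrightarrow>
               \<not> q dvd r ^ i - 1"
    and mv: "m \<in> M" "v \<in> V"
  shows "conjg G m v = v"
proof -
  have Vc: "V \<subseteq> carrier G" and Mc: "M \<subseteq> carrier G" using V M subgroup.subset by auto
  have r1: "r > 1" using r prime_gt_1_nat by auto
  have fV: "finite V" using fin Vc finite_subset by auto
  define C where "C = M \<inter> {g \<in> carrier G. \<forall>v\<in>V. conjg G g v = v}"
  have C: "subgroup C G"
    unfolding C_def by (rule subgroups_Inter_pair[OF M centralizer_subgroup[OF Vc]])
  have "C = M"
  proof (rule subgroup_eq_of_sylows[OF fin C M])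
    show "C \<subseteq> M" by (simp add: C_def)
    fix q assume q: "Factorial_Ring.prime q" "q dvd card M"
    show "\<exists>Q. subgroup Q G \<and> Q \<subseteq> C \<and> card Q = q ^ multiplicity q (card M)"
    proof (cases "q = r")
      case True
      then obtain Q where "subgroup Q G" "Q \<subseteq> M" "card Q = r ^ multiplicity r (card M)"
        "\<forall>g\<in>Q. \<forall>v\<in>V. conjg G g v = v" using hr q by auto
      then show ?thesis using True Mc by (intro exI[of _ Q]) (auto simp: C_def)
    next
      case False
      obtain Q where Q: "subgroup Q G" "Q \<subseteq> M" "card Q = q ^ multiplicity q (card M)"
        using subgroup_sylow[OF fin M q(1)] .
      have Qc: "Q \<subseteq> carrier G" using Q Mc by auto
      define F where "F = V \<inter> {v \<in> carrier G. \<forall>g\<in>Q. conjg G v g = g}"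
      have Fs: "subgroup F G"
        unfolding F_def by (rule subgroups_Inter_pair[OF V(1) centralizer_subgroup[OF Qc]])
      have Falt: "F = {v \<in> V. \<forall>g\<in>Q. conjg G g v = v}"
        using Vc Qc by (auto simp: F_def conjg_eq_iff subset_iff)
      have fF: "finite F" using fV by (simp add: F_def)
      obtain j where j: "card F = r ^ j" "j \<le> k"
        using card_subgroup_dvd[OF fin Fs V(1)] V(2) divides_primepow_nat[OF r] by (auto simp: F_def)
      have LF: "L \<subseteq> F" using L Q by (auto simp: Falt)
      have "r ^ l \<le> r ^ j" using card_mono[OF fF LF] by (simp only: L j)
      then have lj: "l \<le> j" using r1 by (rule power_le_imp_le_exp[rotated])
      have "[card V = card F] (mod q)"
        unfolding Falt
        by (rule subgroup_card_fixed_points_cong[OF q(1) Q(1,3) fV])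
          (use norm Q Vc Qc conjg_mult in \<open>auto simp: subset_iff\<close>)
      then have "[r ^ j * r ^ (k - j) = r ^ j * 1] (mod q)"
        using V j by (simp flip: power_add)
      moreover have "coprime (r ^ j) q"
        using primes_coprime[OF r q(1)] False by (metis coprime_power_left_iff)
      ultimately have "[r ^ (k - j) = 1] (mod q)" by (rule cong_mult_lcancel_nat[THEN iffD1, rotated])
      then have "q dvd r ^ (k - j) - 1"
        using r1 by (metis cong_altdef_nat one_le_power order_less_imp_le)
      then have "j = k" using hq[OF q False, of "k - j"] lj j by (cases "k = j") force+
      then have "F = V" using card_subset_eq[OF fV, of F] j V by (auto simp: F_def)
      then have "Q \<subseteq> C" using Q Mc by (auto simp: Falt C_def)
      then show ?thesis using Q by blast
    qed
  qed
  then show ?thesis using mv by (auto simp: C_def)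
qed

text \<open>If m is the index of \<open>W\<close>, then \<open>x [^] m\<close> lies in
  \<open>W\<close>. As m is prime to the order of \<open>W\<close>, which the order of x divides, x
  is a power of \<open>x [^] m\<close>.\<close>

lemma (in group) normal_hall_mem:
  assumes fin: "finite (carrier G)" and W: "W \<lhd> G"
    and co: "coprime (card W) (order G div card W)"
    and x: "x \<in> carrier G" "x [^] card W = \<one>"
  shows "x \<in> W"
proof -
  interpret W: normal W G by (rule W)
  interpret Q: group "G Mod W" by (rule W.factorgroup_is_group)
  define m where "m = card (rcosets W)"
  have cW: "card W > 0" using subgroup.finite_imp_card_positive[OF W.subgroup_axioms fin] .
  have "m * card W = order G" unfolding m_def by (rule lagrange[OF W.subgroup_axioms])
  then have "coprime (card W) m" using co cW by (metis nonzero_mult_div_cancel_right less_numeral_extra(3))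
  then obtain b where b: "[m * b = 1] (mod card W)"
    using cong_solve_coprime_nat[of m "card W"] by (auto simp: coprime_commute)
  have om: "order (G Mod W) = m" by (simp add: order_def FactGroup_def m_def)
  have "W #> x \<in> carrier (G Mod W)" using x by (auto simp: FactGroup_def RCOSETS_def)
  then have "(W #> x) [^]\<^bsub>G Mod W\<^esub> m = W" using Q.pow_order_eq_1 om by fastforce
  then have "W #> (x [^] m) = W" using W.FactGroup_pow[OF x(1), of m] by simp
  then have "x [^] m \<in> W"
    using x(1) by (metis W.subgroup_axioms nat_pow_closed rcos_self)
  then have "(x [^] m) [^] b \<in> W" using subgroup_int_pow_closed[OF W.subgroup_axioms, of _ "int b"] by (simp add: int_pow_int)
  moreover have "(x [^] m) [^] b = x"
  proof -
    have "ord x dvd card W" using x pow_eq_id by blast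
    then have "[m * b = 1] (mod ord x)" using b cong_dvd_modulus_nat by blast
    then have "x [^] (m * b) = x [^] (1::nat)"
      by (intro nat_pow_cong[OF x(1) pow_ord_eq_1[OF x(1)]])
    then show ?thesis using x by (simp add: nat_pow_pow)
  qed
  ultimately show ?thesis by simp
qed

text \<open>With p the smallest prime divisor, \<open>P\<close> lies in the centre of its
  normaliser. A prime q acting nontrivially on \<open>P\<close> would divide p - 1, which is
  excluded, or else p + 1; then q > p leaves only q = p + 1, which parity forbids.\<close>

lemma (in group) good_order_normal_complement:
  assumes fin: "finite (carrier G)" and good: "good_order (order G)" and n1: "order G \<noteq> 1"
  obtains p k P N where "Factorial_Ring.prime p" "0 < k" "k \<le> 2" "subgroup P G" "card P = p ^ k"
    "N \<lhd> G" "card N * p ^ k = order G" "\<not> p dvd card N"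
proof -
  have n0: "order G > 0" using fin by (simp add: order_gt_0_iff_finite)
  define p where "p = (LEAST p. Factorial_Ring.prime p \<and> p dvd order G)"
  have ex: "\<exists>p. Factorial_Ring.prime p \<and> p dvd order G" using n1 prime_factor_nat by blast
  have p: "Factorial_Ring.prime p" "p dvd order G" using LeastI_ex[OF ex] by (auto simp: p_def)
  have pmin: "p \<le> q" if "Factorial_Ring.prime q" "q dvd order G" for q
    unfolding p_def using that by (intro Least_le) auto
  have cf: "cube_free (order G)" using good by (simp add: good_order_def)
  define k where "k = multiplicity p (order G)"
  note k = cube_free_multiplicity[OF cf n0 p, folded k_def]
  obtain P where P: "subgroup P G" "card P = p ^ k"
    using subgroup_sylow[OF fin subgroup_self p(1)] by (metis k_def order_def)
  have Pc: "P \<subseteq> carrier G" using P subgroup.subset by auto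
  have Pab: "x \<otimes> y = y \<otimes> x" if "x \<in> P" "y \<in> P" for x y
    using prime_square_abelian[OF p(1) P k(2) that] .
  define M where "M = {g \<in> carrier G. \<forall>x\<in>P. conjg G g x \<in> P}"
  have M: "subgroup M G" unfolding M_def by (rule normalizer_subgroup[OF fin Pc])
  have Mn: "card M dvd order G" using card_subgroup_dvd[OF fin M subgroup_self] subgroup.subset[OF M] by (simp add: order_def)
  have PM: "P \<subseteq> M" using P Pc by (auto simp: M_def subgroup.m_closed subgroup.m_inv_closed)
  have Pcent: "conjg G g x = x" if "g \<in> P" "x \<in> P" for g x
    using Pab[OF that] that Pc by (subst conjg_eq_iff) auto
  have M0: "card M > 0" using subgroup.finite_imp_card_positive[OF M fin] .
  \<comment> \<open>\<open>P\<close> has the full p-power order of its normaliser \<open>M\<close>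
    and, being abelian, centralises itself, so it is the subgroup demanded for the prime p in
    \<open>coprime_action_trivial\<close>.\<close>
  have mk: "multiplicity p (card M) = k"
  proof (rule antisym)
    show "multiplicity p (card M) \<le> k"
      unfolding k_def using Mn n0 by (intro dvd_imp_multiplicity_le) auto
    have "p ^ k dvd card M" using card_subgroup_dvd[OF fin P(1) M PM] P by simp
    then show "k \<le> multiplicity p (card M)"
      using M0 p by (intro multiplicity_geI) (auto simp: prime_gt_1_nat)
  qed
  have cent: "conjg G g x = x" if g: "g \<in> carrier G" "\<And>x. x \<in> P \<Longrightarrow> conjg G g x \<in> P" and x: "x \<in> P" for g x
  proof (rule coprime_action_trivial[OF fin p(1) P M, where L = "{\<one>}" and l = 0])
    show "g \<in> M" using g by (simp add: M_def)
    show "\<exists>Q. subgroup Q G \<and> Q \<subseteq> M \<and> card Q = p ^ multiplicity p (card M) \<and> (\<forall>g\<in>Q. \<forall>v\<in>P. conjg G g v = v)"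
      using P PM Pcent mk by blast
    show "\<not> q dvd p ^ i - 1" if q: "Factorial_Ring.prime q" "q dvd card M" "q \<noteq> p" and i: "0 < i" "i + 0 \<le> k" for q i
    proof
      assume d: "q dvd p ^ i - 1"
      have qn: "q dvd order G" using q Mn dvd_trans by blast
      have odds: "odd p" "odd q" using good p qn dvd_trans by (auto simp: good_order_def)
      have qp: "q > p" using pmin[OF q(1) qn] q by simp
      have n1: "\<not> q dvd p - 1" using good p q qn by (simp add: good_order_def)
      then have "i = 2" using d i k by (cases "i = 1") auto
      then have "p ^ i - 1 = (p - 1) * (p + 1)" by (simp add: power2_eq_square algebra_simps)
      with d have "q dvd (p - 1) * (p + 1)" by (simp only:)
      then have "q dvd p + 1" using n1 q(1) prime_dvd_mult_nat by blast
      then have "q \<le> p + 1" by (auto dest: dvd_imp_le)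
      then have "q = p + 1" using qp by simp
      then show False using odds by simp
    qed
  qed (use x P M_def subgroup.one_closed[OF P(1)] subgroup.subset[OF M] in \<open>auto\<close>)
  interpret cs: central_sylow G P p k
    by (intro central_sylow.intro central_sylow_axioms.intro abelian_subgroup_cosets.intro
      abelian_subgroup_cosets_axioms.intro group_axioms fin P p(1) Pab k(4) cent)
  obtain N where N: "N \<lhd> G" "card N * p ^ k = order G" using cs.normal_complement by blast
  have "card N = order G div p ^ k" using N p by (metis nonzero_mult_div_cancel_right not_prime_0 power_not_zero)
  then show ?thesis using that[OF p(1) k(1,2) P N] k by simp
qed

text \<open>A normal Sylow subgroup of the normal complement \<open>N\<close> is characteristic in
  \<open>N\<close>, hence normal in \<open>G\<close>; it remains a Sylow subgroup since the index of
  \<open>N\<close> is a power of a different prime. If \<open>N\<close> is trivial, \<open>G\<close>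
  is itself a p-group.\<close>

theorem good_order_normal_sylow:
  fixes G :: "('a, 'b) monoid_scheme"
  assumes "group G" "finite (carrier G)" "good_order (order G)" "order G \<noteq> 1"
  obtains r k W where "Factorial_Ring.prime r" "0 < k" "k \<le> 2" "W \<lhd> G" "card W = r ^ k"
    "\<not> r dvd order G div r ^ k"
proof -
  have "\<exists>r k W. Factorial_Ring.prime r \<and> 0 < k \<and> k \<le> 2 \<and> W \<lhd> G \<and> card W = r ^ k \<and> \<not> r dvd order G div r ^ k"
    using assms
  proof (induction "order G" arbitrary: G rule: less_induct)
    case less
    interpret group G by (rule less.prems(1))
    obtain p k P N where N: "Factorial_Ring.prime p" "0 < k" "k \<le> 2" "subgroup P G" "card P = p ^ k"
      "N \<lhd> G" "card N * p ^ k = order G" "\<not> p dvd card N"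
      using good_order_normal_complement[OF less.prems(2-4)] .
    have n0: "order G > 0" using less.prems by (simp add: order_gt_0_iff_finite)
    have Ns: "subgroup N G" using N normal_imp_subgroup by blast
    have pk: "p ^ k > 1" using N(1,2) by (intro one_less_power prime_gt_1_nat)
    show ?case
    proof (cases "card N = 1")
      case True
      then have o: "order G = p ^ k" using N(7) by simp
      then have "\<not> p dvd order G div p ^ k" using pk N(1) not_prime_unit by force
      then show ?thesis using N(1-3) normal_self o by (metis order_def)
    next
      case False
      let ?N = "G\<lparr>carrier := N\<rparr>"
      have oN: "order ?N = card N" unfolding order_def by simp
      have N0: "card N > 0" using N(7) n0 by (cases "card N") auto
      have fN: "finite N" using N0 card_gt_0_iff by auto
      have "card N * 1 < card N * p ^ k" using N0 pk by (intro mult_strict_left_mono)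
      then have "card N < order G" using N(7) by simp
      moreover have "good_order (card N)" using good_order_dvd[OF less.prems(3)] N(7) by (metis dvd_triv_left)
      ultimately obtain r j W where W: "Factorial_Ring.prime r" "0 < j" "j \<le> 2" "W \<lhd> ?N"
        "card W = r ^ j" "\<not> r dvd card N div r ^ j"
        using less.hyps[of ?N] subgroup_imp_group[OF Ns] fN False oN by auto
      interpret N: group ?N by (rule subgroup_imp_group[OF Ns])
      have Wn: "subgroup W ?N" using W normal_imp_subgroup by blast
      have Ws: "subgroup W G" using incl_subgroup[OF Ns Wn] .
      have WN: "W \<subseteq> N" using subgroup.subset[OF Wn] by simp
      have rN: "r ^ j dvd card N" using card_subgroup_dvd[OF less.prems(2) Ws Ns WN] W by simp
      have "r dvd card N" using rN W(2) by (metis dvd_power dvd_trans)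
      then have rp: "r \<noteq> p" using N(8) by auto
      have co: "coprime (r ^ j) (card N div r ^ j)"
        using W by (metis coprime_power_left_iff prime_imp_coprime)
      have pw: "x [^]\<^bsub>?N\<^esub> (m::nat) = x [^]\<^bsub>G\<^esub> m" for x m by (rule nat_pow_consistent[symmetric])
      \<comment> \<open>Inside \<open>N\<close> the normal Hall subgroup \<open>W\<close> is cut out
        by the equation x^|W| = 1, which conjugation by elements of \<open>G\<close>
        preserves.\<close>
      have "conjg G g w \<in> W" if g: "g \<in> carrier G" and w: "w \<in> W" for g w
      proof -
        have wc: "w \<in> carrier G" "w \<in> N" using w WN subgroup.subset[OF Ns] by auto
        have cN: "conjg G g w \<in> N" using normal.inv_op_closed2[OF N(6) g wc(2)] .
        interpret W: group "G\<lparr>carrier := W\<rparr>" by (rule subgroup_imp_group[OF Ws])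
        have "w [^]\<^bsub>G\<lparr>carrier := W\<rparr>\<^esub> card W = \<one>\<^bsub>G\<^esub>"
          using W.pow_order_eq_1[of w] w by (simp add: order_def)
        then have w1: "w [^]\<^bsub>G\<^esub> card W = \<one>\<^bsub>G\<^esub>" by (simp add: nat_pow_consistent[of w _ W])
        have "conjg G g w [^]\<^bsub>G\<^esub> (m::nat) = conjg G g (w [^]\<^bsub>G\<^esub> m)" for m
        proof (induction m)
          case (Suc m)
          then show ?case using g wc conjg_hom[of g "w [^]\<^bsub>G\<^esub> m" w] by simp
        qed (use g in simp)
        then have "conjg G g w [^]\<^bsub>G\<^esub> card W = \<one>\<^bsub>G\<^esub>" using w1 g by simp
        then show ?thesis
          using N.normal_hall_mem[OF _ W(4), of "conjg G g w"] fN W co cN by (simp add: oN pw)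
      qed
      then have "W \<lhd> G" using Ws normal_inv_iff by blast
      moreover have "\<not> r dvd order G div r ^ j"
      proof
        assume a: "r dvd order G div r ^ j"
        have "order G div r ^ j = (card N div r ^ j) * p ^ k"
          using rN N(7) by (metis div_mult_swap mult.commute)
        then have "r dvd p ^ k" using a W by (simp add: prime_dvd_mult_iff)
        then show False using rp W(1) N(1) by (metis prime_dvd_power primes_dvd_imp_eq)
      qed
      ultimately show ?thesis using W by blast
    qed
  qed
  then show ?thesis using that by blast
qed

section \<open>Complements of abelian normal Hall subgroups\<close>

lemma (in comm_group) hom_finprod:
  assumes "group_hom G G h" "f \<in> A \<rightarrow> carrier G"
  shows "h (finprod G f A) = finprod G (\<lambda>x. h (f x)) A"
proof -
  interpret h: group_hom G G h by fact
  show ?thesis using assms(2)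
  proof (induction A rule: infinite_finite_induct)
    case (insert a A)
    then show ?case by (simp add: Pi_def)
  qed auto
qed

context abelian_subgroup_cosets
begin

text \<open>The kernel of the crossed homomorphism \<open>crossed_hom\<close> is a complement of \<open>P\<close>.\<close>

definition crossed_term where "crossed_term g C = g \<otimes> rep C \<otimes> inv (rep (g \<cdot> C))"
definition crossed_hom where "crossed_hom g = finprod GP (crossed_term g) cosets"

context
  assumes Pn: "P \<lhd> G"
begin

lemma conjg_P: "g \<in> carrier G \<Longrightarrow> v \<in> P \<Longrightarrow> conjg G g v \<in> P"
  using normal.inv_op_closed2[OF Pn] .

text \<open>Here the factor in \<open>P\<close> stands to the left of the representative. It is the
  conjugate by that representative of the factor in \<open>cocyc\<close>, hence in \<open>P\<close>
  by normality.\<close>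

lemma crossed_term_in:
  assumes "g \<in> carrier G" "C \<in> cosets" shows "crossed_term g C \<in> P"
proof -
  define y where "y = g \<otimes> rep C"
  define z where "z = rep (g \<cdot> C)"
  have yz: "y \<in> g \<cdot> C" "z \<in> g \<cdot> C" "y \<in> carrier G" "z \<in> carrier G"
    using assms act_mem rep_in rep_carrier act_closed by (auto simp: y_def z_def)
  have "conjg G z (inv z \<otimes> y) \<in> P"
    using coset_diff[OF act_closed[OF assms] yz(2,1)] conjg_P yz by simp
  moreover have "conjg G z (inv z \<otimes> y) = y \<otimes> inv z" using yz by (simp flip: m_assoc)
  ultimately show ?thesis by (simp add: crossed_term_def y_def z_def)
qed

lemma conjg_P_hom: "g \<in> carrier G \<Longrightarrow> group_hom GP GP (conjg G g)"
  using conjg_P conjg_hom Psub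
  by (intro group_hom.intro group_hom_axioms.intro GP.group_axioms homI) (auto simp: subset_iff)

lemma crossed_hom_in: "g \<in> carrier G \<Longrightarrow> crossed_hom g \<in> P"
  unfolding crossed_hom_def using GP.finprod_closed[of "crossed_term g" cosets] crossed_term_in by auto

text \<open>Each factor splits at the intermediate coset \<open>h \<cdot> C\<close>, and
  \<open>h\<close> merely permutes the cosets over which the product is taken.\<close>

lemma crossed_hom_mult:
  assumes g: "g \<in> carrier G" and h: "h \<in> carrier G"
  shows "crossed_hom (g \<otimes> h) = conjg G g (crossed_hom h) \<otimes> crossed_hom g"
proof -
  have t: "crossed_term (g \<otimes> h) C = conjg G g (crossed_term h C) \<otimes> crossed_term g (h \<cdot> C)" if C: "C \<in> cosets" for C
  proof -
    have c: "rep C \<in> carrier G" "rep (h \<cdot> C) \<in> carrier G" "rep (g \<cdot> (h \<cdot> C)) \<in> carrier G"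
      using g h C act_closed rep_carrier by auto
    define a b d where "a = rep C" and "b = rep (h \<cdot> C)" and "d = rep (g \<cdot> (h \<cdot> C))"
    have abd: "a \<in> carrier G" "b \<in> carrier G" "d \<in> carrier G" using c by (auto simp: a_def b_def d_def)
    have "inv b \<otimes> (inv g \<otimes> (g \<otimes> (b \<otimes> inv d))) = inv d" using abd g
      by (simp flip: m_assoc)
    then show ?thesis unfolding crossed_term_def act_mult[OF g h C]
      using abd g h by (simp add: m_assoc flip: a_def b_def d_def)
  qed
  have m: "conjg G g (crossed_term h C) \<in> P" "crossed_term g (h \<cdot> C) \<in> P" if "C \<in> cosets" for C
    using conjg_P crossed_term_in act_closed g h that by auto
  have "crossed_hom (g \<otimes> h)
      = finprod GP (\<lambda>C. conjg G g (crossed_term h C) \<otimes>\<^bsub>GP\<^esub> crossed_term g (h \<cdot> C)) cosets"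
    unfolding crossed_hom_def by (intro GP.finprod_cong') (auto simp: t intro: subgroup.m_closed[OF P m])
  also have "\<dots> = finprod GP (\<lambda>C. conjg G g (crossed_term h C)) cosets
      \<otimes>\<^bsub>GP\<^esub> finprod GP (\<lambda>C. crossed_term g (h \<cdot> C)) cosets"
    using conjg_P crossed_term_in act_closed g h by (intro GP.finprod_multf) auto
  also have "finprod GP (\<lambda>C. conjg G g (crossed_term h C)) cosets = conjg G g (crossed_hom h)"
    unfolding crossed_hom_def using crossed_term_in h
    by (intro GP.hom_finprod[OF conjg_P_hom[OF g], symmetric]) auto
  also have "finprod GP (\<lambda>C. crossed_term g (h \<cdot> C)) cosets
      = finprod GP (crossed_term g) ((\<lambda>C. h \<cdot> C) ` cosets)"
    using crossed_term_in act_closed act_bij[OF h] g h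
    by (intro GP.finprod_reindex[symmetric]) (auto simp: bij_betw_def)
  also have "(\<lambda>C. h \<cdot> C) ` cosets = cosets"
    using act_bij[OF h] by (simp add: bij_betw_def)
  finally show ?thesis by (simp add: crossed_hom_def)
qed

text \<open>As \<open>P\<close> is normal, v fixes every coset, and each of the factors is
  v.\<close>

lemma crossed_hom_P:
  assumes v: "v \<in> P" shows "crossed_hom v = v [^] card cosets"
proof -
  have vc: "v \<in> carrier G" using v Psub by auto
  have "crossed_term v C = v" if C: "C \<in> cosets" for C
  proof -
    define y where "y = rep C"
    have y: "y \<in> C" "y \<in> carrier G" using C rep_in rep_carrier by (auto simp: y_def)
    have "conjg G (inv y) v \<in> P" using conjg_P[of "inv y" v] y v by simp
    then have "y \<otimes> conjg G (inv y) v \<in> C"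
      using coset_eq[OF C y(1)] by (auto simp: l_coset_def)
    moreover have "y \<otimes> conjg G (inv y) v = v \<otimes> y" using y vc by (simp flip: m_assoc)
    ultimately have "v \<otimes> y \<in> C" by simp
    then have "v \<cdot> C = C"
      using coset_eq[OF C] act_closed[OF vc C] coset_eq[OF act_closed[OF vc C] act_mem[OF y(1)]] by metis
    then show ?thesis using y vc by (simp add: crossed_term_def m_assoc flip: y_def)
  qed
  then have "crossed_hom v = finprod GP (\<lambda>_. v) cosets"
    unfolding crossed_hom_def using v by (intro GP.finprod_cong') auto
  also have "\<dots> = v [^]\<^bsub>GP\<^esub> card cosets" using v by (intro GP.finprod_const) auto
  finally show ?thesis by (simp add: nat_pow_consistent[of v _ P])
qed

text \<open>On \<open>P\<close> the crossed homomorphism is raising to the power n, the index of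
  \<open>P\<close>, a bijection because n is prime to the order of \<open>P\<close>. So its kernel
  meets \<open>P\<close> trivially, and every g can be corrected by an element of \<open>P\<close>
  to lie in the kernel.\<close>

theorem normal_abelian_complement:
  assumes co: "coprime (card P) (order G div card P)"
  obtains M where "subgroup M G" "card M * card P = order G" "M \<inter> P = {\<one>}"
    "\<And>g. g \<in> carrier G \<Longrightarrow> \<exists>v\<in>P. \<exists>m\<in>M. g = v \<otimes> m"
proof -
  define n where "n = card cosets"
  have Ppos: "card P > 0" using subgroup.finite_imp_card_positive[OF P fin] .
  have "n * card P = order G" unfolding n_def cosets_def by (rule l_lagrange[OF fin P])
  then have "coprime n (card P)" using co Ppos
    by (metis coprime_commute nonzero_mult_div_cancel_right less_numeral_extra(3))
  then obtain b where b: "[n * b = 1] (mod card P)" using cong_solve_coprime_nat[of n "card P"] by auto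
  have pw1: "v [^] card P = \<one>" if "v \<in> P" for v
    using GP.pow_order_eq_1[of v] that by (simp add: order_def nat_pow_consistent[of v _ P])
  have pwin: "v [^] (m::nat) \<in> P" if "v \<in> P" for v m
    using GP.nat_pow_closed[of v m] that by (simp add: nat_pow_consistent[of v _ P])
  have pwnb: "v [^] (n * b) = v" if "v \<in> P" for v
    using nat_pow_cong[OF _ pw1[OF that] b] that Psub by auto
  define M where "M = {g \<in> carrier G. crossed_hom g = \<one>}"
  have one: "crossed_hom \<one> = \<one>"
    using crossed_hom_P[of \<one>] subgroup.one_closed[OF P] by simp
  have M: "subgroup M G"
  proof (rule subgroupI)
    show "M \<noteq> {}" using one by (auto simp: M_def)
  next
    fix g assume g: "g \<in> M"
    then have gc: "g \<in> carrier G" by (simp add: M_def)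
    have cg: "crossed_hom g = \<one>" using g by (simp add: M_def)
    have "crossed_hom (inv g) \<in> carrier G" using crossed_hom_in[of "inv g"] gc Psub by auto
    then have "crossed_hom (inv g \<otimes> g) = crossed_hom (inv g)"
      using crossed_hom_mult[of "inv g" g] gc by (simp add: cg del: l_inv)
    then show "inv g \<in> M" using gc one by (simp add: M_def)
  next
    fix g h assume "g \<in> M" "h \<in> M"
    then show "g \<otimes> h \<in> M" using crossed_hom_mult[of g h] by (auto simp: M_def)
  qed (auto simp: M_def)
  have int: "M \<inter> P = {\<one>}"
  proof -
    have "v = \<one>" if "v \<in> M" "v \<in> P" for v
    proof -
      have "v [^] n = \<one>" using that crossed_hom_P by (simp add: M_def n_def)
      then have "v [^] (n * b) = \<one>" using that Psub nat_pow_pow[of v n b] by auto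
      then show ?thesis using pwnb that by simp
    qed
    then show ?thesis using subgroup.one_closed[OF P] subgroup.one_closed[OF M] by blast
  qed
  have dec: "\<exists>v\<in>P. \<exists>m\<in>M. g = v \<otimes> m" if g: "g \<in> carrier G" for g
  proof -
    define d where "d = crossed_hom g"
    have d: "d \<in> P" "d \<in> carrier G" using crossed_hom_in g Psub by (auto simp: d_def)
    \<comment> \<open>\<open>b\<close> inverts n modulo the order of \<open>P\<close>, so
      \<open>v [^] n\<close> is the inverse of \<open>d\<close> and cancels the value of
      \<open>crossed_hom\<close> at g.\<close>
    define v where "v = inv (d [^] b)"
    have v: "v \<in> P" "v \<in> carrier G" using d pwin[OF d(1)] P Psub by (auto simp: v_def subgroup.m_inv_closed)
    have "v [^] n = inv (d [^] (n * b))"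
      unfolding v_def using d by (simp add: nat_pow_inv nat_pow_pow mult.commute)
    then have vn: "v [^] n = inv d" using pwnb d by simp
    have "crossed_hom (v \<otimes> g) = conjg G v d \<otimes> v [^] n"
      using crossed_hom_mult[OF v(2) g] crossed_hom_P[OF v(1)] by (simp add: d_def n_def)
    also have "conjg G v d = d" using Pab[OF v(1) d(1)] v d by (simp add: m_assoc)
    finally have "v \<otimes> g \<in> M" using vn d v g by (simp add: M_def)
    moreover have "g = inv v \<otimes> (v \<otimes> g)" using v g by (simp flip: m_assoc)
    ultimately show ?thesis using v P by (meson subgroup.m_inv_closed)
  qed
  have inj: "inj_on (\<lambda>(v, m). v \<otimes> m) (P \<times> M)"
    using int by (intro inj_on_mult_subgroups[OF P M]) blast
  have img: "(\<lambda>(v, m). v \<otimes> m) ` (P \<times> M) = carrier G"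
  proof
    show "(\<lambda>(v, m). v \<otimes> m) ` (P \<times> M) \<subseteq> carrier G" using Psub by (auto simp: M_def)
    show "carrier G \<subseteq> (\<lambda>(v, m). v \<otimes> m) ` (P \<times> M)"
    proof
      fix g assume "g \<in> carrier G"
      then obtain v m where "v \<in> P" "m \<in> M" "g = v \<otimes> m" using dec by blast
      then show "g \<in> (\<lambda>(v, m). v \<otimes> m) ` (P \<times> M)" by (intro image_eqI[of _ _ "(v, m)"]) auto
    qed
  qed
  have "card (P \<times> M) = order G" using card_image[OF inj] unfolding img order_def by simp
  then have "card M * card P = order G" by (simp add: card_cartesian_product mult.commute)
  then show ?thesis using that[OF M _ int dec] by blast
qed

end
end

section \<open>Coprime actions on groups of order \<open>r\<^sup>2\<close>\<close>

locale plane_action = group G for G (structure) +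
  fixes V M :: "'a set" and r :: nat
  assumes fin: "finite (carrier G)"
    and r: "Factorial_Ring.prime r"
    and V: "subgroup V G" "card V = r ^ 2"
    and M: "subgroup M G"
    and norm: "\<And>m v. m \<in> M \<Longrightarrow> v \<in> V \<Longrightarrow> conjg G m v \<in> V"
    and goodM: "good_order (card M)"
    and rM: "\<not> r dvd card M" "\<And>q. Factorial_Ring.prime q \<Longrightarrow> q dvd card M \<Longrightarrow> \<not> q dvd r - 1"
begin

text \<open>An opaque copy of conjugation, so that the simplifier works with the laws of the action
  and not with products in G.\<close>

definition act where "act m x = conjg G m x"

lemma Vc: "x \<in> V \<Longrightarrow> x \<in> carrier G" using V subgroup.subset by auto
lemma Mc: "x \<in> M \<Longrightarrow> x \<in> carrier G" using M subgroup.subset by auto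
lemma r1: "r > 1" using r prime_gt_1_nat by auto
lemma finV: "finite V" using V r1 by (metis card.infinite power_eq_0_iff not_one_less_zero)
lemma Vab: "x \<in> V \<Longrightarrow> y \<in> V \<Longrightarrow> x \<otimes> y = y \<otimes> x"
  using prime_square_abelian[OF r V] by simp

lemmas Vcl = subgroup.m_closed[OF V(1)] subgroup.m_inv_closed[OF V(1)] subgroup.one_closed[OF V(1)]
  subgroup_int_pow_closed[OF V(1)]
lemmas Mcl = subgroup.m_closed[OF M] subgroup.m_inv_closed[OF M] subgroup.one_closed[OF M]

lemma act_closed: "m \<in> M \<Longrightarrow> x \<in> V \<Longrightarrow> act m x \<in> V" by (simp add: act_def norm)
lemma act_mult: "m \<in> M \<Longrightarrow> m' \<in> M \<Longrightarrow> x \<in> V \<Longrightarrow> act (m \<otimes> m') x = act m (act m' x)"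
  unfolding act_def by (intro conjg_mult Mc Vc)
lemma act_one: "x \<in> V \<Longrightarrow> act \<one> x = x" by (simp add: act_def Vc)
lemma act_hom: "m \<in> M \<Longrightarrow> x \<in> V \<Longrightarrow> y \<in> V \<Longrightarrow> act m (x \<otimes> y) = act m x \<otimes> act m y"
  unfolding act_def by (intro conjg_hom Mc Vc)
lemma act_inv_act: "m \<in> M \<Longrightarrow> x \<in> V \<Longrightarrow> act (inv m) (act m x) = x"
  using act_mult[of "inv m" m x] by (simp add: Mcl Mc act_one)
lemma act_act_inv: "m \<in> M \<Longrightarrow> x \<in> V \<Longrightarrow> act m (act (inv m) x) = x"
  using act_mult[of m "inv m" x] by (simp add: Mcl Mc act_one)
lemma act_group_hom: "m \<in> M \<Longrightarrow> group_hom (G\<lparr>carrier := V\<rparr>) (G\<lparr>carrier := V\<rparr>) (act m)"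
  using act_closed act_hom subgroup_imp_group[OF V(1)]
  by (intro group_hom.intro group_hom_axioms.intro homI) auto
lemma act_int_pow:
  assumes "m \<in> M" "x \<in> V" shows "act m (x [^] (i::int)) = act m x [^] i"
proof -
  interpret h: group_hom "G\<lparr>carrier := V\<rparr>" "G\<lparr>carrier := V\<rparr>" "act m" by (rule act_group_hom[OF assms(1)])
  show ?thesis using h.hom_int_pow[of x i] assms act_closed
    by (simp flip: int_pow_consistent[OF V(1)])
qed
lemma act_m_one: "m \<in> M \<Longrightarrow> act m \<one> = \<one>" by (simp add: act_def Mc)
lemma act_m_inv: "m \<in> M \<Longrightarrow> x \<in> V \<Longrightarrow> act m (inv x) = inv (act m x)"
  using act_int_pow[of m x "-1"] by (simp add: int_pow_neg Vc act_closed)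

definition trivial where "trivial m \<longleftrightarrow> (\<forall>x\<in>V. act m x = x)"

text \<open>Let \<open>N\<close> be the stabiliser of \<open>L\<close> in \<open>M\<close>. A prime
  dividing its order can act nontrivially on \<open>L\<close>, or on \<open>V\<close> once
  \<open>L\<close> is fixed, only by dividing r - 1, which \<open>rM\<close> excludes. So
  \<open>coprime_action_trivial\<close> applies first to \<open>L\<close>, then to \<open>V\<close>
  with \<open>L\<close> as the known fixed points.\<close>

lemma stabilized_line_trivial:
  assumes m: "m \<in> M" and L: "subgroup L G" "L \<subseteq> V" "card L = r" "\<And>x. x \<in> L \<Longrightarrow> act m x \<in> L"
  shows "trivial m"
proof -
  define N where "N = M \<inter> {g \<in> carrier G. \<forall>x\<in>L. conjg G g x \<in> L}"
  have N: "subgroup N G"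
    unfolding N_def by (rule subgroups_Inter_pair[OF M normalizer_subgroup[OF fin]]) (use L Vc in auto)
  have NM: "N \<subseteq> M" by (auto simp: N_def)
  have mN: "m \<in> N" using m L Mc by (auto simp: N_def act_def)
  have dN: "q dvd card M" if "q dvd card N" for q
    using card_subgroup_dvd[OF fin N M NM] that dvd_trans by blast
  have triv: "conjg G g x = x" if g: "g \<in> N" and x: "x \<in> L" for g x
  proof (rule coprime_action_trivial[OF fin r L(1), where L = "{\<one>}" and l = 0 and k = 1])
    show "\<not> q dvd r ^ i - 1" if "Factorial_Ring.prime q" "q dvd card N" "0 < i" "i + 0 \<le> 1" for q i
      using that rM(2)[of q] dN by (cases "i = 1") auto
  qed (use N g x L rM dN subgroup.one_closed[OF L(1)] subgroup.subset[OF N] in \<open>auto simp: N_def\<close>)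
  have "conjg G m x = x" if x: "x \<in> V" for x
  proof (rule coprime_action_trivial[OF fin r V, where L = L and l = 1])
    show "\<not> q dvd r ^ i - 1" if "Factorial_Ring.prime q" "q dvd card N" "0 < i" "i + 1 \<le> 2" for q i
      using that rM(2)[of q] dN by (cases "i = 1") auto
  qed (use N mN x L rM dN triv NM norm in auto)
  then show ?thesis by (simp add: trivial_def act_def)
qed

context
  fixes y assumes y: "y \<in> M" "\<not> trivial y"
begin

text \<open>Otherwise the elements of \<open>V\<close> with \<open>v [^] r = \<one>\<close> form a
  subgroup of order r. Every automorphism preserves it, so y would stabilise a line.\<close>

lemma exponent: "x \<in> V \<Longrightarrow> x [^] r = \<one>"
proof (rule ccontr)
  assume x: "x \<in> V" "x [^] r \<noteq> \<one>"
  define L where "L = {v \<in> V. v [^] r = \<one>}"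
  have L: "subgroup L G"
  proof (rule subgroupI)
    show "L \<subseteq> carrier G" "L \<noteq> {}" using Vc Vcl(3) by (auto simp: L_def)
    show "inv v \<in> L" if "v \<in> L" for v using that Vcl Vc by (auto simp: L_def nat_pow_inv)
    show "v \<otimes> w \<in> L" if "v \<in> L" "w \<in> L" for v w
      using that Vcl(1) Vc pow_mult_distrib[OF Vab[of v w], of r] by (auto simp: L_def)
  qed
  have LV: "L \<subset> V" using x by (auto simp: L_def)
  have "card L dvd r ^ 2" using card_subgroup_dvd[OF fin L V(1)] LV V by auto
  then obtain i where i: "i \<le> 2" "card L = r ^ i" using divides_primepow_nat[OF r] by blast
  have "card L < card V" using LV finV psubset_card_mono by blast
  then have "i \<noteq> 2" using i V by auto
  have x1: "x [^] r \<in> V" using Vcl(4)[OF x(1), of "int r"] by (simp add: int_pow_int)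
  interpret VG: group "G\<lparr>carrier := V\<rparr>" by (rule subgroup_imp_group[OF V(1)])
  have "x [^]\<^bsub>G\<lparr>carrier := V\<rparr>\<^esub> (r ^ 2) = \<one>"
    using VG.pow_order_eq_1[of x] x V by (simp add: order_def)
  then have "x [^] (r ^ 2) = \<one>" by (simp add: nat_pow_consistent[of x _ V])
  then have "x [^] r \<in> L" using x1 x Vc by (auto simp: L_def nat_pow_pow power2_eq_square)
  moreover have "\<one> \<in> L" using subgroup.one_closed[OF L] .
  ultimately have "card L \<noteq> 1" using x by (auto simp: card_1_singleton_iff)
  then have "i \<noteq> 0" using i by auto
  then have "card L = r" using i \<open>i \<noteq> 2\<close> by (cases "i = 1") auto
  moreover have "act y v \<in> L" if "v \<in> L" for v
    using that act_int_pow[OF y(1), of v "int r"] act_closed y act_m_one by (auto simp: L_def int_pow_int)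
  ultimately show False using stabilized_line_trivial[OF y(1) L] LV y(2) by blast
qed

lemma pow_cong: "x \<in> V \<Longrightarrow> [i = j] (mod int r) \<Longrightarrow> x [^] i = x [^] j"
proof -
  assume x: "x \<in> V" and ij: "[i = j] (mod int r)"
  have "ord x dvd r" using exponent[OF x] pow_eq_id Vc[OF x] by blast
  then have "int (ord x) dvd j - i" using ij by (metis cong_iff_dvd_diff cong_sym dvd_trans int_dvd_int_iff)
  then show ?thesis using int_pow_eq[OF Vc[OF x]] by simp
qed

lemma ord_V: assumes x: "x \<in> V" "x \<noteq> \<one>" shows "ord x = r"
proof -
  have "ord x dvd r" using exponent[OF x(1)] pow_eq_id Vc[OF x(1)] by blast
  moreover have "ord x \<noteq> 1" using x ord_eq_1[OF Vc[OF x(1)]] by simp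
  ultimately show ?thesis using r prime_nat_iff by blast
qed

lemma fixes_line_trivial:
  assumes m: "m \<in> M" and x: "x \<in> V" "x \<noteq> \<one>" and f: "act m x = x [^] (i::int)"
  shows "trivial m"
proof (rule stabilized_line_trivial[OF m, of "generate G {x}"])
  have g: "generate G {x} = {x [^] (k :: int) | k. k \<in> UNIV}" by (rule generate_pow[OF Vc[OF x(1)]])
  show "subgroup (generate G {x}) G" using generate_is_subgroup[of "{x}"] Vc[OF x(1)] by simp
  show "generate G {x} \<subseteq> V" using g x Vcl by auto
  show "card (generate G {x}) = r" using generate_pow_card[OF Vc[OF x(1)]] ord_V[OF x] by simp
  fix z assume "z \<in> generate G {x}"
  then obtain k :: int where "z = x [^] k" using g by auto
  then have "act m z = x [^] (i * k)" using act_int_pow[OF m x(1)] f Vc[OF x(1)] by (simp add: int_pow_pow)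
  then show "act m z \<in> generate G {x}" using g by auto
qed

definition v0 where "v0 = (SOME x. x \<in> V \<and> x \<noteq> \<one>)"
text \<open>Coordinates on \<open>V\<close> as a plane over F_r. The image of \<open>v0\<close>
  under y completes \<open>v0\<close> to a basis because y stabilises no line. Exponents are
  integers, read modulo r, so that matrix entries can be negative.\<close>

definition E where "E i j = v0 [^] (i::int) \<otimes> (act y v0) [^] (j::int)"

lemma v0: "v0 \<in> V" "v0 \<noteq> \<one>"
proof -
  have "card V > 1" using V(2) r1 one_less_power[of r 2] by simp
  then have "\<not> V \<subseteq> {\<one>}" using card_mono[of "{\<one>}" V] by auto
  then have "\<exists>x. x \<in> V \<and> x \<noteq> \<one>" by blast
  then show "v0 \<in> V" "v0 \<noteq> \<one>" unfolding v0_def by (metis (mono_tags, lifting) someI_ex)+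
qed

lemma w0: "act y v0 \<in> V" using act_closed y v0 by blast

lemma E_V: "E i j \<in> V" unfolding E_def by (intro Vcl v0 w0)

lemma E_mult: "E i j \<otimes> E k l = E (i + k) (j + l)"
proof -
  define a b c d where "a = v0 [^] i" and "b = act y v0 [^] j" and "c = v0 [^] k" and "d = act y v0 [^] l"
  have abcd: "a \<in> V" "b \<in> V" "c \<in> V" "d \<in> V" unfolding a_def b_def c_def d_def by (intro Vcl v0 w0)+
  then have C: "a \<in> carrier G" "b \<in> carrier G" "c \<in> carrier G" "d \<in> carrier G" using Vc by auto
  have "a \<otimes> b \<otimes> (c \<otimes> d) = a \<otimes> (b \<otimes> c) \<otimes> d" using C by (simp add: m_assoc)
  also have "\<dots> = (a \<otimes> c) \<otimes> (b \<otimes> d)" using C Vab[OF abcd(2,3)] by (simp add: m_assoc)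
  finally show ?thesis
    unfolding E_def a_def b_def c_def d_def using Vc v0 w0 by (simp add: int_pow_mult)
qed

lemma E_pow: "E i j [^] (k::int) = E (i * k) (j * k)"
proof -
  have "E i j [^] k = (v0 [^] i) [^] k \<otimes> (act y v0 [^] j) [^] k"
    unfolding E_def by (intro int_pow_mult_distrib Vab Vc Vcl v0 w0)
  then show ?thesis using Vc v0 w0 by (simp add: E_def int_pow_pow)
qed

lemma E_inv: "inv (E i j) = E (- i) (- j)"
  using E_pow[of i j "-1"] by (simp add: int_pow_neg Vc E_V)

lemma E_10: "E 1 0 = v0" and E_01: "E 0 1 = act y v0" and E_00: "E 0 0 = \<one>"
  using Vc v0 w0 by (auto simp: E_def)

lemma E_cong: "[i = k] (mod int r) \<Longrightarrow> [j = l] (mod int r) \<Longrightarrow> E i j = E k l"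
  unfolding E_def using pow_cong v0 w0 by metis

text \<open>With j invertible modulo r the relation would make \<open>act y v0\<close> a power of
  \<open>v0\<close>, and y would stabilise the line of \<open>v0\<close>.\<close>

lemma E_eq_one:
  assumes "E i j = \<one>" shows "int r dvd i \<and> int r dvd j"
proof -
  have j: "int r dvd j"
  proof (rule ccontr)
    assume "\<not> int r dvd j"
    then have "coprime j (int r)" using r by (metis coprime_commute prime_imp_coprime prime_nat_int_transfer)
    then obtain k where k: "[j * k = 1] (mod int r)" using cong_solve_coprime_int by blast
    have "E (i * k) 1 = E (i * k) (j * k)" by (intro E_cong cong_refl cong_sym[OF k])
    also have "\<dots> = \<one>" using assms E_pow[of i j k] by simp
    finally have e: "v0 [^] (i * k) \<otimes> act y v0 = \<one>" using w0 Vc by (simp add: E_def)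
    have "act y v0 = inv (v0 [^] (i * k))"
      using e Vc w0 v0 by (metis inv_closed inv_equality inv_inv int_pow_closed)
    then have "act y v0 = v0 [^] (- (i * k))" using v0 Vc by (simp add: int_pow_neg)
    then show False using fixes_line_trivial[OF y(1) v0] y(2) by blast
  qed
  then have "E i j = E i 0" by (intro E_cong) (auto simp: cong_0_iff)
  then have "v0 [^] i = \<one>" using assms v0 Vc by (simp add: E_def)
  then have "int r dvd i" using int_pow_eq_id[OF Vc[OF v0(1)]] ord_V[OF v0] by simp
  then show ?thesis using j by simp
qed

lemma E_eq_iff: "E i j = E k l \<longleftrightarrow> [i = k] (mod int r) \<and> [j = l] (mod int r)"
proof
  assume "E i j = E k l"
  then have "E i j \<otimes> inv (E k l) = \<one>" using E_V Vc by simp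
  then have "E (i - k) (j - l) = \<one>" by (simp add: E_inv E_mult)
  then show "[i = k] (mod int r) \<and> [j = l] (mod int r)" using E_eq_one by (simp add: cong_iff_dvd_diff)
qed (use E_cong in blast)

lemma E_surj:
  assumes "x \<in> V" obtains i j where "x = E i j"
proof -
  let ?B = "{0..<int r} \<times> {0..<int r}"
  have "inj_on (\<lambda>(i, j). E i j) ?B"
    by (auto intro!: inj_onI simp: E_eq_iff cong_def)
  then have "card ((\<lambda>(i, j). E i j) ` ?B) = r * r" by (simp add: card_image)
  then have "(\<lambda>(i, j). E i j) ` ?B = V"
    using V E_V by (intro card_subset_eq finV) (auto simp: power2_eq_square)
  then show ?thesis using assms that by (metis (no_types, lifting) imageE case_prod_unfold)
qed

text \<open>(a, b) and (c, d) are the columns of the matrix of m in the basis \<open>v0\<close>,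
  \<open>act y v0\<close>.\<close>

lemma act_E: "m \<in> M \<Longrightarrow> act m v0 = E a b \<Longrightarrow> act m (act y v0) = E c d \<Longrightarrow>
   act m (E i j) = E (a * i + c * j) (b * i + d * j)"
  unfolding E_def[of i j] by (simp add: act_hom act_int_pow v0 w0 Vcl E_pow E_mult)

text \<open>The determinant has order dividing both \<open>card M\<close> and \<open>r - 1\<close>.\<close>

lemma det_one:
  assumes m: "m \<in> M" and 1: "act m v0 = E a b" "act m (act y v0) = E c d"
  shows "[a * d - b * c = 1] (mod int r)"
proof -
  define D where "D = a * d - b * c"
  have ex: "\<exists>a' b' c' d'. act (m [^] n) v0 = E a' b' \<and> act (m [^] n) (act y v0) = E c' d' \<and>
      [a' * d' - b' * c' = D ^ n] (mod int r)" for n :: nat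
  proof (induction n)
    case 0
    show ?case
      by (intro exI[of _ 1] exI[of _ 0]) (use v0 w0 in \<open>auto simp: act_one E_10 E_01\<close>)
  next
    case (Suc n)
    then obtain a' b' c' d' where IH: "act (m [^] n) v0 = E a' b'" "act (m [^] n) (act y v0) = E c' d'"
      "[a' * d' - b' * c' = D ^ n] (mod int r)" by blast
    have mn: "m [^] n \<in> M" using subgroup_int_pow_closed[OF M m, of "int n"] by (simp add: int_pow_int)
    have s: "m [^] Suc n = m \<otimes> m [^] n" using nat_pow_Suc2[OF Mc[OF m]] .
    have "act (m [^] Suc n) v0 = E (a * a' + c * b') (b * a' + d * b')"
      unfolding s act_mult[OF m mn v0(1)] IH by (rule act_E[OF m 1])
    moreover have "act (m [^] Suc n) (act y v0) = E (a * c' + c * d') (b * c' + d * d')"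
      unfolding s act_mult[OF m mn w0] IH by (rule act_E[OF m 1])
    moreover have "(a * a' + c * b') * (b * c' + d * d') - (b * a' + d * b') * (a * c' + c * d')
      = D * (a' * d' - b' * c')" by (simp add: D_def algebra_simps)
    moreover have "[D * (a' * d' - b' * c') = D ^ Suc n] (mod int r)"
      using IH(3) cong_scalar_left by auto
    ultimately show ?case by metis
  qed
  obtain a' b' c' d' where n: "act (m [^] card M) v0 = E a' b'" "act (m [^] card M) (act y v0) = E c' d'"
      "[a' * d' - b' * c' = D ^ card M] (mod int r)" using ex by blast
  interpret MG: group "G\<lparr>carrier := M\<rparr>" by (rule subgroup_imp_group[OF M])
  have "m [^]\<^bsub>G\<lparr>carrier := M\<rparr>\<^esub> card M = \<one>"
    using MG.pow_order_eq_1[of m] m by (simp add: order_def)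
  then have "m [^] card M = \<one>" by (simp add: nat_pow_consistent[of m _ M])
  then have "E a' b' = E 1 0" "E c' d' = E 0 1" using n v0 w0 by (simp_all add: act_one E_10 E_01)
  then have "[a' = 1] (mod int r)" "[b' = 0] (mod int r)" "[c' = 0] (mod int r)" "[d' = 1] (mod int r)"
    by (simp_all add: E_eq_iff)
  then have "[a' * d' - b' * c' = 1 * 1 - 0 * 0] (mod int r)" by (intro cong_diff cong_mult)
  then have D1: "[D ^ card M = 1] (mod int r)" using n(3) by (metis cong_sym cong_trans mult_1 mult_zero_left diff_zero)
  have M0: "card M > 0" using subgroup.finite_imp_card_positive[OF M fin] .
  have "\<not> int r dvd D"
  proof
    assume "int r dvd D"
    then have "int r dvd D ^ card M" using M0 dvd_power_same dvd_trans by (metis dvd_power gr0_implies_Suc)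
    then have "[0 = 1] (mod int r)" using D1 by (metis cong_0_iff cong_sym cong_trans)
    then show False using r1 by (simp add: cong_def)
  qed
  then have fermat: "[D ^ (r - 1) = 1] (mod int r)"
  proof -
    define u where "u = nat (D mod int r)"
    have u: "int u = D mod int r" using r1 by (simp add: u_def)
    then have Du: "[D = int u] (mod int r)" by (simp add: cong_def)
    have "\<not> r dvd u" using \<open>\<not> int r dvd D\<close> cong_dvd_iff[OF Du] by (metis cong_dvd_iff cong_sym Du cong_0_iff int_dvd_int_iff u dvd_mod_iff dvd_refl)
    then have "[u ^ (r - 1) = 1] (mod r)" using fermat_theorem r by blast
    then have "[int u ^ (r - 1) = 1] (mod int r)" by (metis cong_int_iff of_nat_1 of_nat_power)
    then show ?thesis using cong_pow[OF Du, of "r - 1"] cong_trans by blast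
  qed
  have "coprime (card M) (r - 1)"
  proof (rule ccontr)
    assume "\<not> coprime (card M) (r - 1)"
    then have "gcd (card M) (r - 1) \<noteq> 1" using coprime_iff_gcd_eq_1 by blast
    then obtain q where "Factorial_Ring.prime q" "q dvd gcd (card M) (r - 1)" using prime_factor_nat by blast
    then have "Factorial_Ring.prime q" "q dvd card M" "q dvd r - 1" by auto
    then show False using rM by blast
  qed
  then obtain k where k: "[card M * k = 1] (mod (r - 1))" using cong_solve_coprime_nat[of "card M" "r - 1"] by auto
  show ?thesis
  \<comment> \<open>\<open>k\<close> can vanish only for r - 1 = 1, and then Fermat's congruence
    already reads D = 1.\<close>
  proof (cases "k = 0")
    case True
    then have "r - 1 = 1" using k by (auto simp: cong_def split: if_splits)
    then show ?thesis using fermat by (simp add: D_def)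
  next
    case False
    then have "card M * k \<ge> 1" using M0 by simp
    then obtain l where l: "card M * k = 1 + l * (r - 1)" using k
      by (metis cong_le_nat cong_sym mult.commute add.commute)
    have "[(D ^ card M) ^ k = 1 ^ k] (mod int r)" using D1 by (rule cong_pow)
    then have "[D * (D ^ (r - 1)) ^ l = 1] (mod int r)"
      by (metis l power_mult power_add power_one power_one_right mult.commute)
    moreover have "[D * (D ^ (r - 1)) ^ l = D * 1 ^ l] (mod int r)"
      using fermat by (intro cong_mult cong_pow) auto
    ultimately show ?thesis unfolding D_def by (metis cong_sym cong_trans mult.right_neutral power_one)
  qed
qed

text \<open>In this basis the matrix of y is a companion matrix: \<open>v0\<close> goes to the
  second basis vector, and determinant 1 fixes the entry -1. The remaining entry t is the
  trace.\<close>

lemma act_y_E: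
  obtains t where "act y (act y v0) = E (-1) t" "\<And>i j. act y (E i j) = E (- j) (i + t * j)"
proof -
  obtain c t where ct: "act y (act y v0) = E c t" by (rule E_surj[OF act_closed[OF y(1) w0]])
  have v: "act y v0 = E 0 1" by (simp add: E_01)
  have "[0 * t - 1 * c = 1] (mod int r)" by (rule det_one[OF y(1) v ct])
  then have "[- (0 * t - 1 * c) = - 1] (mod int r)" by (simp only: cong_minus_minus_iff)
  then have "E c t = E (-1) t" by (intro E_cong) auto
  then have e: "act y (act y v0) = E (-1) t" using ct by simp
  show ?thesis
    using act_E[OF y(1) v e] by (intro that[OF e]) simp
qed

text \<open>Cayley-Hamilton for a matrix of determinant 1.\<close>

lemma act_add_inverse: "\<exists>t. \<forall>x\<in>V. act y x \<otimes> act (inv y) x = x [^] (t::int)"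
proof -
  obtain t where t: "\<And>i j. act y (E i j) = E (- j) (i + t * j)" using act_y_E by blast
  have "act y x \<otimes> act (inv y) x = x [^] t" if x: "x \<in> V" for x
  proof -
    have iy: "inv y \<in> M" using Mcl y by blast
    obtain i j where ij: "act (inv y) x = E i j" by (rule E_surj[OF act_closed[OF iy x]])
    have xE: "x = E (- j) (i + t * j)" using act_act_inv[OF y(1) x] ij t by simp
    then have "act y x = E (- (i + t * j)) (- j + t * (i + t * j))" using t by simp
    then show ?thesis unfolding ij by (simp add: xE E_mult E_pow algebra_simps)
  qed
  then show ?thesis by blast
qed

text \<open>A map commuting with y is determined by the image \<open>E a b\<close> of
  \<open>v0\<close>: applying y to it gives the second column, so the map is a + b y. The congruence
  says that its determinant is 1.\<close>

lemma commuting_E: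
  assumes h: "h \<in> M" "\<And>x. x \<in> V \<Longrightarrow> act h (act y x) = act y (act h x)"
    and t: "act y (act y v0) = E (-1) t" "\<And>i j. act y (E i j) = E (- j) (i + t * j)"
  shows "\<exists>a b. (\<forall>i j. act h (E i j) = E (a * i - b * j) (b * i + (a + t * b) * j)) \<and>
    [a * (a + t * b) + b * b = 1] (mod int r)"
proof -
  obtain a b where ab: "act h v0 = E a b" by (rule E_surj[OF act_closed[OF h(1) v0(1)]])
  have hw: "act h (act y v0) = E (- b) (a + t * b)" using h(2)[OF v0(1)] ab t by simp
  show ?thesis
    using act_E[OF h(1) ab hw] det_one[OF h(1) ab hw] by (intro exI[of _ a] exI[of _ b]) simp
qed

lemma commuting_polynomial:
  assumes h: "h \<in> M" "\<And>x. x \<in> V \<Longrightarrow> act h (act y x) = act y (act h x)"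
  shows "\<exists>a b. \<forall>x\<in>V. act h x = x [^] (a::int) \<otimes> act y x [^] (b::int)"
proof -
  obtain t where t: "act y (act y v0) = E (-1) t" "\<And>i j. act y (E i j) = E (- j) (i + t * j)" by (rule act_y_E) (rule that)
  obtain a b where ab: "\<And>i j. act h (E i j) = E (a * i - b * j) (b * i + (a + t * b) * j)"
      "[a * (a + t * b) + b * b = 1] (mod int r)"
    using commuting_E[OF h t] by blast
  have "act h x = x [^] a \<otimes> act y x [^] b" if "x \<in> V" for x
  proof -
    obtain i j where x: "x = E i j" by (rule E_surj[OF \<open>x \<in> V\<close>])
    show ?thesis unfolding x ab(1) t(2) E_pow E_mult by (simp add: algebra_simps)
  qed
  then show ?thesis by blast
qed

text \<open>The map is injective, because two elements with equal values differ by a fixed point of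
  y, which would span a stabilised line; hence it is onto. This is what puts \<open>V\<close> inside
  the derived group.\<close>

lemma commutator_surj:
  assumes "x \<in> V" shows "\<exists>z\<in>V. x = act y z \<otimes> inv z"
proof -
  define f where "f z = act y z \<otimes> inv z" for z
  have fV: "f ` V \<subseteq> V" using act_closed y Vcl by (auto simp: f_def)
  have "inj_on f V"
  proof (rule inj_onI, rule ccontr)
    fix u z assume uz: "u \<in> V" "z \<in> V" "f u = f z" "u \<noteq> z"
    define d where "d = u \<otimes> inv z"
    have d: "d \<in> V" using uz Vcl by (simp add: d_def)
    have d1: "d \<noteq> \<one>" using uz Vc by (metis d_def inv_closed inv_equality inv_inv)
    have C: "u \<in> carrier G" "z \<in> carrier G" "act y u \<in> carrier G" "act y z \<in> carrier G"
      using uz act_closed y Vc by auto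
    have "act y u = f u \<otimes> u" using C by (simp add: f_def m_assoc)
    also have "\<dots> = f z \<otimes> u" using uz(3) by simp
    also have "\<dots> = act y z \<otimes> (inv z \<otimes> u)" using C by (simp add: f_def m_assoc)
    also have "inv z \<otimes> u = d" using Vab[of "inv z" u] uz Vcl by (simp add: d_def)
    finally have "inv (act y z) \<otimes> act y u = d" using C d Vc by (simp flip: m_assoc)
    moreover have "act y d = act y u \<otimes> inv (act y z)"
      using uz Vcl y by (simp add: d_def act_hom act_m_inv)
    ultimately have "act y d = d" using Vab[of "inv (act y z)" "act y u"] uz act_closed y Vcl by simp
    then have "act y d = d [^] (1::int)" using d Vc by (simp add: int_pow_1)
    then show False using fixes_line_trivial[OF y(1) d d1] y by blast
  qed
  then have "f ` V = V" using fV finV by (intro card_subset_eq) (auto simp: card_image)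
  then show ?thesis using assms by (auto simp: f_def)
qed

text \<open>In the basis \<open>v0\<close>, \<open>y v0\<close>, the map \<open>\<sigma>\<close> fixes \<open>v0\<close> and sends \<open>y v0\<close> to \<open>y\<^sup>-\<^sup>1 v0\<close>.\<close>

lemma inverting_automorphism:
  assumes comm: "\<And>h x. h \<in> M \<Longrightarrow> x \<in> V \<Longrightarrow> act h (act y x) = act y (act h x)"
  shows "\<exists>\<sigma>. (\<forall>x\<in>V. \<sigma> x \<in> V \<and> \<sigma> (\<sigma> x) = x) \<and> (\<forall>x\<in>V. \<forall>z\<in>V. \<sigma> (x \<otimes> z) = \<sigma> x \<otimes> \<sigma> z) \<and>
    (\<forall>h\<in>M. \<forall>x\<in>V. \<sigma> (act h x) = act (inv h) (\<sigma> x))"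
proof -
  obtain t where t: "act y (act y v0) = E (-1) t" "\<And>i j. act y (E i j) = E (- j) (i + t * j)" by (rule act_y_E) (rule that)
  \<comment> \<open>\<open>\<sigma>\<close> is defined through chosen coordinates; \<open>sE\<close>
    shows that their ambiguity modulo r is harmless.\<close>
  define co where "co x = (SOME ij. x = E (fst ij) (snd ij))" for x
  define \<sigma> where "\<sigma> x = E (fst (co x) + t * snd (co x)) (- snd (co x))" for x
  have sE: "\<sigma> (E i j) = E (i + t * j) (- j)" for i j
  proof -
    have "E i j = E (fst (co (E i j))) (snd (co (E i j)))"
      unfolding co_def by (rule someI[of _ "(i, j)"]) simp
    then have c: "[i = fst (co (E i j))] (mod int r)" "[j = snd (co (E i j))] (mod int r)" by (simp_all add: E_eq_iff)
    show ?thesis unfolding \<sigma>_def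
      by (rule E_cong[OF cong_sym[OF cong_add[OF c(1) cong_mult[OF cong_refl c(2)]]]
            cong_sym[OF cong_minus_minus_iff[THEN iffD2, OF c(2)]]])
  qed
  show ?thesis
  proof (intro exI[of _ \<sigma>] conjI ballI)
    fix x assume "x \<in> V"
    then obtain i j where x: "x = E i j" by (rule E_surj)
    show "\<sigma> x \<in> V" "\<sigma> (\<sigma> x) = x" by (simp_all add: x sE E_V)
  next
    fix x z assume xz: "x \<in> V" "z \<in> V"
    obtain i j where i: "x = E i j" by (rule E_surj[OF xz(1)])
    obtain k l where "z = E k l" by (rule E_surj[OF xz(2)])
    note x = i this
    show "\<sigma> (x \<otimes> z) = \<sigma> x \<otimes> \<sigma> z" by (simp add: x sE E_mult algebra_simps)
  next
    fix h x assume h: "h \<in> M" and xV: "x \<in> V"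
    obtain i j where x: "x = E i j" by (rule E_surj[OF xV])
    obtain a b where ab: "\<And>i j. act h (E i j) = E (a * i - b * j) (b * i + (a + t * b) * j)"
      "[a * (a + t * b) + b * b = 1] (mod int r)"
      using commuting_E[OF h comm[OF h] t] by blast
    define N where "N = a * (a + t * b) + b * b"
    \<comment> \<open>The matrix identity h \<sigma> h = det(h) \<sigma>, where \<open>N\<close> is
      the determinant of h and congruent to 1.\<close>
    have "act h (\<sigma> (act h x)) = E (N * (i + t * j)) (N * (- j))"
      unfolding x ab(1) sE by (rule arg_cong2[of _ _ _ _ E]) (simp_all add: N_def algebra_simps)
    also have "\<dots> = E (1 * (i + t * j)) (1 * (- j))"
      using ab(2) by (intro E_cong cong_mult cong_refl) (simp_all add: N_def)
    finally have "act h (\<sigma> (act h x)) = \<sigma> x" by (simp add: x sE)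
    moreover have "\<sigma> (act h x) \<in> V" by (simp add: x ab(1) sE E_V)
    ultimately show "\<sigma> (act h x) = act (inv h) (\<sigma> x)" using act_inv_act[OF h] by metis
  qed
qed

end

end

lemma (in group) coprime_subgroups_product:
  assumes fin: "finite (carrier G)" and A: "subgroup A G" and B: "subgroup B G"
    and co: "coprime (card A) (card B)" and o: "card A * card B = order G" and g: "g \<in> carrier G"
  shows "\<exists>a\<in>A. \<exists>b\<in>B. g = a \<otimes> b"
proof -
  have I: "subgroup (A \<inter> B) G" by (rule subgroups_Inter_pair[OF A B])
  have "card (A \<inter> B) dvd card A" "card (A \<inter> B) dvd card B"
    using card_subgroup_dvd[OF fin I A] card_subgroup_dvd[OF fin I B] by auto
  then have "card (A \<inter> B) = 1" using co coprime_common_divisor_nat by blast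
  then have "A \<inter> B = {\<one>}" using subgroup.one_closed[OF I] by (metis card_1_singletonE singletonD)
  note inj = inj_on_mult_subgroups[OF A B this]
  have "(\<lambda>(a, b). a \<otimes> b) ` (A \<times> B) = carrier G"
  proof (rule card_subset_eq[OF fin])
    show "(\<lambda>(a, b). a \<otimes> b) ` (A \<times> B) \<subseteq> carrier G" using subgroup.subset[OF A] subgroup.subset[OF B] by auto
    show "card ((\<lambda>(a, b). a \<otimes> b) ` (A \<times> B)) = card (carrier G)"
      using o by (simp add: card_image[OF inj] card_cartesian_product order_def)
  qed
  then have "g \<in> (\<lambda>(a, b). a \<otimes> b) ` (A \<times> B)" using g by simp
  then show ?thesis by auto
qed

text \<open>Induction along a normal \<open>p\<close>-complement \<open>N\<close> of \<open>M\<close>. If \<open>y \<in> N\<close> acts nontrivially and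
  \<open>y'\<close> is a conjugate of \<open>y\<close>, then \<open>y\<close> and \<open>y'\<close> commute on \<open>V\<close> and have the same trace, so
  \<open>y' = y\<close> or \<open>y' = y\<^sup>-\<^sup>1\<close> on \<open>V\<close>. Squares of elements of \<open>M\<close> thus commute with \<open>y\<close>, and
  hence all elements do, since \<open>M\<close> has odd order. They are then polynomials in \<open>y\<close>.\<close>

lemma (in group) plane_action_abelian:
  assumes "plane_action G V M r" "h \<in> M" "h' \<in> M" "x \<in> V"
  shows "conjg G (h \<otimes> h') x = conjg G (h' \<otimes> h) x"
  using assms
proof (induction "card M" arbitrary: M h h' x rule: less_induct)
  case less
  interpret plane_action G V M r by (rule less.prems(1))
  interpret MG: group "G\<lparr>carrier := M\<rparr>" by (rule subgroup_imp_group[OF M])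
  have MMc: "M \<subseteq> carrier G" using Mc by auto
  have fM: "finite M" using MMc fin finite_subset by blast
  have oM: "order (G\<lparr>carrier := M\<rparr>) = card M" unfolding order_def by simp
  have M0: "card M > 0" using subgroup.finite_imp_card_positive[OF M fin] .
  show ?case
  proof (cases "card M = 1")
    case True
    then have "h = h'" using less.prems(2,3) by (auto simp: card_1_singleton_iff)
    then show ?thesis by simp
  next
    case False
    have fMG: "finite (carrier (G\<lparr>carrier := M\<rparr>))" using fM by simp
    obtain p k P N where N: "Factorial_Ring.prime p" "0 < k" "k \<le> 2" "subgroup P (G\<lparr>carrier := M\<rparr>)" "card P = p ^ k"
      "N \<lhd> G\<lparr>carrier := M\<rparr>" "card N * p ^ k = card M" "\<not> p dvd card N"
      using MG.good_order_normal_complement[OF fMG] goodM False unfolding oM by blast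
    have Ps: "subgroup P G" using incl_subgroup[OF M N(4)] .
    have NsM: "subgroup N (G\<lparr>carrier := M\<rparr>)" using N(6) normal_imp_subgroup by blast
    have Ns: "subgroup N G" using incl_subgroup[OF M NsM] .
    have PM: "P \<subseteq> M" and NM: "N \<subseteq> M" using subgroup.subset[OF N(4)] subgroup.subset[OF NsM] by auto
    have Nn: "g \<otimes> y \<otimes> inv g \<in> N" if "g \<in> M" "y \<in> N" for g y
      using normal.inv_op_closed2[OF N(6), of g y] that m_inv_consistent[OF M] by simp
    have dec: "\<exists>n\<in>N. \<exists>u\<in>P. g = n \<otimes> u" if g: "g \<in> M" for g
    proof -
      have "coprime (card N) (card P)" unfolding N(5)
        using N(1,8) by (metis coprime_commute coprime_power_right_iff prime_imp_coprime)
      moreover have "card N * card P = order (G\<lparr>carrier := M\<rparr>)" using N(5,7) oM by simp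
      ultimately show ?thesis
        using MG.coprime_subgroups_product[OF fMG NsM N(4), of g] g by auto
    qed
    show ?thesis
    proof (cases "\<forall>n\<in>N. trivial n")
      \<comment> \<open>Now \<open>M\<close> acts through \<open>P\<close>, which is abelian of
        order p or p^2.\<close>
      case True
      obtain n u where nu: "n \<in> N" "u \<in> P" "h = n \<otimes> u" using dec less.prems(2) by blast
      obtain n' u' where nu': "n' \<in> N" "u' \<in> P" "h' = n' \<otimes> u'" using dec less.prems(3) by blast
      have m: "n \<in> M" "u \<in> M" "n' \<in> M" "u' \<in> M" using nu nu' NM PM by auto
      have 1: "act h z = act u z" "act h' z = act u' z" if "z \<in> V" for z
        using True nu nu' m that act_closed by (auto simp: act_mult trivial_def)
      have "act (h \<otimes> h') x = act (u \<otimes> u') x"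
        using m less.prems(2-4) 1 act_closed by (simp add: act_mult)
      also have "u \<otimes> u' = u' \<otimes> u" using prime_square_abelian[OF N(1) Ps N(5,3) nu(2) nu'(2)] .
      also have "act (u' \<otimes> u) x = act (h' \<otimes> h) x"
        using m less.prems(2-4) 1 act_closed by (simp add: act_mult)
      finally show ?thesis by (simp add: act_def)
    next
      case False
      then obtain y where yN: "y \<in> N" and y: "y \<in> M" "\<not> trivial y" using NM by auto
      have "p ^ k > 1" using N(1,2) by (intro one_less_power prime_gt_1_nat)
      moreover have N0: "card N > 0" using N(7) M0 by (cases "card N") auto
      ultimately have "card N * 1 < card N * p ^ k" by (intro mult_strict_left_mono)
      then have "card N < card M" using N(7) by simp
      moreover have dN: "card N dvd card M" using N(7) by (metis dvd_triv_left)
      have "plane_action G V N r"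
      proof (intro plane_action.intro plane_action_axioms.intro group_axioms fin r V Ns)
        show "good_order (card N)" using good_order_dvd[OF goodM dN] .
        show "\<not> r dvd card N" using rM(1) dN dvd_trans by blast
        show "\<not> q dvd r - 1" if "Factorial_Ring.prime q" "q dvd card N" for q
          using that rM(2) dN dvd_trans by blast
        show "conjg G m v \<in> V" if "m \<in> N" "v \<in> V" for m v using that NM norm by auto
      qed
      ultimately have comN: "act n (act n' z) = act n' (act n z)" if "n \<in> N" "n' \<in> N" "z \<in> V" for n n' z
        using less.hyps[of N n n' z] that NM by (simp add: act_def[symmetric] act_mult subset_iff)
      obtain t where t: "act y z \<otimes> act (inv y) z = z [^] (t::int)" if "z \<in> V" for z
        using act_add_inverse[OF y] by blast
      have comm_y: "act g (act y z) = act y (act g z)" if g: "g \<in> M" and zV: "z \<in> V" for g z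
      proof -
        have ig: "inv g \<in> M" and iy: "inv y \<in> M" using Mcl g y by auto
        define y' where "y' = g \<otimes> y \<otimes> inv g"
        have y'N: "y' \<in> N" using Nn[OF g yN] by (simp add: y'_def)
        then have y'M: "y' \<in> M" and iy': "inv y' \<in> M" using NM Mcl by auto
        have ay': "act y' u = act g (act y (act (inv g) u))" if "u \<in> V" for u
          unfolding y'_def using g y ig that act_closed by (simp add: act_mult Mcl)
        have gy: "act g (act y u) = act y' (act g u)" if "u \<in> V" for u
          using ay'[OF act_closed[OF g that]] act_inv_act[OF g that] by simp
        have "inv y' = g \<otimes> inv y \<otimes> inv g"
          using Mc[OF g] Mc[OF y(1)] by (simp add: y'_def inv_mult_group m_assoc)
        then have aiy': "act (inv y') u = act g (act (inv y) (act (inv g) u))" if "u \<in> V" for u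
          using g iy ig that act_closed by (simp add: act_mult Mcl)
        have t': "act y' u \<otimes> act (inv y') u = u [^] t" if u: "u \<in> V" for u
        proof -
          have w: "act (inv g) u \<in> V" using act_closed[OF ig u] .
          have "act y' u \<otimes> act (inv y') u
            = act g (act y (act (inv g) u) \<otimes> act (inv y) (act (inv g) u))"
            using ay'[OF u] aiy'[OF u] act_hom[OF g] act_closed[OF y(1) w] act_closed[OF iy w] by simp
          also have "\<dots> = act g (act (inv g) u) [^] t" using t[OF w] act_int_pow[OF g w] by simp
          finally show ?thesis using act_act_inv[OF g u] by simp
        qed
        have "(\<forall>u\<in>V. act y' u = act y u) \<or> (\<forall>u\<in>V. act y' u = act (inv y) u)"
        proof (rule disjCI)
          assume "\<not> (\<forall>u\<in>V. act y' u = act (inv y) u)"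
          then obtain u1 where u1: "u1 \<in> V" "act y' u1 \<noteq> act (inv y) u1" by blast
          \<comment> \<open>Written additively, equal traces give y u - y' u = y'^-1 u - y^-1 u.
            Since y and y' commute on \<open>V\<close>, \<open>f\<close> maps the left side to the
            right side, so it fixes this element. If \<open>f\<close> is nontrivial it has no fixed
            line, and the element is zero.\<close>
          define f where "f = inv y' \<otimes> inv y"
          have fM: "f \<in> M" using iy iy' Mcl by (simp add: f_def)
          have af: "act f u = act (inv y') (act (inv y) u)" if "u \<in> V" for u
            unfolding f_def by (rule act_mult[OF iy' iy that])
          have ntf: "\<not> trivial f"
          proof
            assume "trivial f"
            then have "act (inv y') (act (inv y) u1) = u1" using af u1 by (simp add: trivial_def)
            then have "act y' u1 = act (inv y) u1"
              using act_act_inv[OF y'M act_closed[OF iy u1(1)]] by simp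
            then show False using u1 by simp
          qed
          show "\<forall>u\<in>V. act y' u = act y u"
          proof (rule ccontr)
            assume "\<not> (\<forall>u\<in>V. act y' u = act y u)"
            then obtain u where u: "u \<in> V" "act y' u \<noteq> act y u" by blast
            define a b c d where "a = act y u" and "b = act y' u" and "c = act (inv y) u" and "d = act (inv y') u"
            have V4: "a \<in> V" "b \<in> V" "c \<in> V" "d \<in> V"
              using act_closed u y iy y'M iy' by (auto simp: a_def b_def c_def d_def)
            then have C4: "a \<in> carrier G" "b \<in> carrier G" "c \<in> carrier G" "d \<in> carrier G" using Vc by auto
            have "a \<otimes> c = b \<otimes> d" using t[OF u(1)] t'[OF u(1)] by (simp add: a_def b_def c_def d_def)
            then have "a = b \<otimes> d \<otimes> inv c" using C4 inv_solve_right[of a "b \<otimes> d" c] by simp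
            then have "inv b \<otimes> a = d \<otimes> inv c" using C4 by (simp flip: m_assoc)
            then have z2: "a \<otimes> inv b = d \<otimes> inv c"
              using Vab[OF V4(1) Vcl(2)[OF V4(2)]] by simp
            define z where "z = a \<otimes> inv b"
            have zV': "z \<in> V" using V4 Vcl by (simp add: z_def)
            have z1: "z \<noteq> \<one>"
            proof
              assume "z = \<one>"
              then have "a = b" using C4 by (metis z_def inv_equality inv_inv inv_closed)
              then show False using u by (simp add: a_def b_def)
            qed
            have "inv y \<in> N" "inv y' \<in> N" using subgroup.m_inv_closed[OF Ns] yN y'N by auto
            then have fa: "act f a = d" and fb: "act f b = c"
              unfolding af[OF V4(1)] af[OF V4(2)]
              using act_inv_act[OF y(1) u(1)] act_inv_act[OF y'M u(1)] comN V4
              by (simp_all add: a_def b_def c_def d_def) (metis comN V4(2) b_def)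
            have "act f z = d \<otimes> inv c"
              using act_hom[OF fM V4(1) Vcl(2)[OF V4(2)]] act_m_inv[OF fM V4(2)] fa fb by (simp add: z_def)
            then have "act f z = z [^] (1::int)" using z2 C4 by (simp add: z_def int_pow_1)
            then show False using fixes_line_trivial[OF y fM zV' z1] ntf by blast
          qed
        qed
        then have g2: "act (g \<otimes> g) (act y u) = act y (act (g \<otimes> g) u)" if u: "u \<in> V" for u
        proof
          assume "\<forall>u\<in>V. act y' u = act y u"
          then show ?thesis using gy u act_closed[OF g] act_closed[OF y(1)] by (simp add: act_mult[OF g g])
        next
          assume e: "\<forall>u\<in>V. act y' u = act (inv y) u"
          have "act g (act (inv y) v) = act y (act g v)" if v: "v \<in> V" for v
          proof -
            have "act (inv y) (act g (act (inv y) v)) = act y' (act g (act (inv y) v))"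
              using e act_closed g iy v by simp
            also have "\<dots> = act g v" using gy[OF act_closed[OF iy v]] act_act_inv[OF y(1) v] by simp
            finally show ?thesis using act_act_inv[OF y(1) act_closed[OF g act_closed[OF iy v]]] by simp
          qed
          then show ?thesis using gy e u act_closed[OF g] act_closed[OF y(1)] by (simp add: act_mult[OF g g])
        qed
        have pw: "act ((g \<otimes> g) [^] (i::nat)) (act y z) = act y (act ((g \<otimes> g) [^] i) z)" for i
        proof (induction i)
          case 0
          then show ?case using act_one zV act_closed[OF y(1) zV] by simp
        next
          case (Suc i)
          have ggM: "g \<otimes> g \<in> M" using Mcl g by simp
          have piM: "(g \<otimes> g) [^] i \<in> M"
            using subgroup_int_pow_closed[OF M ggM, of "int i"] by (simp add: int_pow_int)
          show ?case unfolding nat_pow_Suc2[OF Mc[OF ggM]]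
            using act_mult[OF ggM piM] zV act_closed[OF y(1) zV] Suc g2[OF act_closed[OF piM zV]] by simp
        qed
        \<comment> \<open>\<open>i\<close> is the inverse of 2 modulo the order of \<open>M\<close>,
          so g is a power of its square.\<close>
        have "odd (card M)" using goodM by (simp add: good_order_def)
        then have "even (card M + 1)" by simp
        then obtain i where i: "card M + 1 = 2 * i" by (elim evenE)
        have "g [^]\<^bsub>G\<lparr>carrier := M\<rparr>\<^esub> card M = \<one>" using MG.pow_order_eq_1[of g] g oM by simp
        then have "g [^] card M = \<one>" by (simp add: nat_pow_consistent[of g _ M])
        then have "g [^] (2 * i) = g" using Mc[OF g] by (simp flip: i)
        moreover have "g [^] (2::nat) = g \<otimes> g" using Mc[OF g] by (simp add: numeral_2_eq_2)
        ultimately have "(g \<otimes> g) [^] i = g" using nat_pow_pow[OF Mc[OF g], of 2 i] by simp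
        then show ?thesis using pw[of i] by simp
      qed
      obtain a b where ab: "act h z = z [^] (a::int) \<otimes> act y z [^] (b::int)" if "z \<in> V" for z
        using commuting_polynomial[OF y less.prems(2) comm_y[OF less.prems(2)]] by blast
      note x = \<open>x \<in> V\<close>
      have h'x: "act h' x \<in> V" using act_closed less.prems(3) x by blast
      have yx: "act y x \<in> V" using act_closed y x by blast
      have "act h (act h' x) = act h' x [^] a \<otimes> act h' (act y x) [^] b"
        using ab[OF h'x] comm_y[OF less.prems(3) x] by simp
      also have "\<dots> = act h' (x [^] a \<otimes> act y x [^] b)"
        using act_hom[OF less.prems(3) Vcl(4)[OF x] Vcl(4)[OF yx]] act_int_pow[OF less.prems(3)] x yx by simp
      finally have "act h (act h' x) = act h' (act h x)" using ab[OF x] by simp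
      then show ?thesis
        using act_mult[OF less.prems(2,3) x] act_mult[OF less.prems(3,2) x] by (simp add: act_def)
    qed
  qed
qed

lemma (in group) derived_acts_trivially:
  assumes V: "V \<subseteq> carrier G" and M: "M \<subseteq> carrier G"
    and comm: "\<And>h h' x. h \<in> M \<Longrightarrow> h' \<in> M \<Longrightarrow> x \<in> V \<Longrightarrow> conjg G (h \<otimes> h') x = conjg G (h' \<otimes> h) x"
    and Minv: "\<And>h. h \<in> M \<Longrightarrow> inv h \<in> M"
    and g: "g \<in> derived G M" and x: "x \<in> V"
  shows "conjg G g x = x"
proof -
  define C where "C = {g \<in> carrier G. \<forall>x\<in>V. conjg G g x = x}"
  have C: "subgroup C G" unfolding C_def by (rule centralizer_subgroup[OF V])
  have "derived_set G M \<subseteq> C"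
  proof clarify
    fix h1 h2 assume h: "h1 \<in> M" "h2 \<in> M"
    then have hc: "h1 \<in> carrier G" "h2 \<in> carrier G" using M by auto
    have "conjg G (h1 \<otimes> h2 \<otimes> inv h1 \<otimes> inv h2) v = v" if v: "v \<in> V" for v
    proof -
      have vc: "v \<in> carrier G" using v V by auto
      have "conjg G (h1 \<otimes> h2 \<otimes> inv h1 \<otimes> inv h2) v = conjg G (h1 \<otimes> h2) (conjg G (inv h1 \<otimes> inv h2) v)"
        using hc vc by (subst conjg_mult[symmetric]) (auto simp: m_assoc)
      also have "conjg G (inv h1 \<otimes> inv h2) v = conjg G (inv h2 \<otimes> inv h1) v"
        using comm Minv h v by simp
      also have "conjg G (h1 \<otimes> h2) (conjg G (inv h2 \<otimes> inv h1) v) = conjg G (h1 \<otimes> h2 \<otimes> (inv h2 \<otimes> inv h1)) v"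
        using hc vc by (subst conjg_mult[symmetric]) auto
      also have "h1 \<otimes> h2 \<otimes> (inv h2 \<otimes> inv h1) = \<one>"
        using hc by (simp flip: inv_mult_group)
      finally show ?thesis using vc by simp
    qed
    then show "h1 \<otimes> h2 \<otimes> inv h1 \<otimes> inv h2 \<in> C" using hc by (auto simp: C_def)
  qed
  then have "derived G M \<subseteq> C" unfolding derived_def by (rule generate_subgroup_incl[OF _ C])
  then show ?thesis using g x by (auto simp: C_def)
qed

section \<open>Inverting automorphisms\<close>

text \<open>The map sought sends \<open>v \<otimes> m\<close> to
  \<open>\<sigma> v \<otimes> \<mu> m\<close>. It is multiplicative if \<sigma> carries the action
  of m to that of \<open>\<mu> m\<close>, and g times its image is \<open>v \<otimes> conjg G m
  (\<sigma> v) \<otimes> (m \<otimes> \<mu> m)\<close>; these are the two conditions imposed on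
  \<sigma>. If \<open>M\<close> acts trivially, \<sigma> is inversion. Otherwise \<open>V\<close>
  lies in the derived group and the second condition is automatic.\<close>

lemma (in group) inverting_automorphism_step:
  fixes r k :: nat
  assumes fin: "finite (carrier G)"
    and V: "Factorial_Ring.prime r" "0 < k" "k \<le> 2" "V \<lhd> G" "card V = r ^ k"
    and M: "subgroup M G" "M \<inter> V = {\<one>}"
    and dec: "\<And>g. g \<in> carrier G \<Longrightarrow> \<exists>v\<in>V. \<exists>m\<in>M. g = v \<otimes> m"
    and Mgood: "good_order (card M)" and rM: "\<not> r dvd card M"
    and qM: "\<And>q. Factorial_Ring.prime q \<Longrightarrow> q dvd card M \<Longrightarrow> \<not> q dvd r - 1"
    and \<mu>: "\<And>m. m \<in> M \<Longrightarrow> \<mu> m \<in> M" "\<And>m. m \<in> M \<Longrightarrow> \<mu> (\<mu> m) = m"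
      "\<And>m. m \<in> M \<Longrightarrow> m \<otimes> \<mu> m \<in> derived G M"
      "\<And>m m'. m \<in> M \<Longrightarrow> m' \<in> M \<Longrightarrow> \<mu> (m \<otimes> m') = \<mu> m \<otimes> \<mu> m'"
  shows "\<exists>\<tau>. (\<forall>g\<in>carrier G. \<tau> g \<in> carrier G \<and> \<tau> (\<tau> g) = g \<and> g \<otimes> \<tau> g \<in> derived G (carrier G)) \<and>
    (\<forall>g\<in>carrier G. \<forall>h\<in>carrier G. \<tau> (g \<otimes> h) = \<tau> g \<otimes> \<tau> h)"
proof -
  let ?D = "derived G (carrier G)"
  have D: "subgroup ?D G" by (rule derived_is_subgroup) simp
  note Dcl = subgroup.m_closed[OF D] subgroup.m_inv_closed[OF D] subgroup.one_closed[OF D]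
  have Vs: "subgroup V G" using V normal_imp_subgroup by blast
  have Vsub: "V \<subseteq> carrier G" using subgroup.subset[OF Vs] .
  note Vcl = subgroup.m_closed[OF Vs] subgroup.m_inv_closed[OF Vs] subgroup.one_closed[OF Vs]
  have Vab: "x \<otimes> z = z \<otimes> x" if "x \<in> V" "z \<in> V" for x z
    using prime_square_abelian[OF V(1) Vs V(5,3) that] .
  have norm: "conjg G g x \<in> V" if "g \<in> carrier G" "x \<in> V" for g x
    using normal.inv_op_closed2[OF V(4) that] .
  have Msub: "M \<subseteq> carrier G" using subgroup.subset[OF M(1)] .
  note Mcl = subgroup.m_closed[OF M(1)] subgroup.m_inv_closed[OF M(1)] subgroup.one_closed[OF M(1)]
  have "\<exists>\<sigma>. (\<forall>x\<in>V. \<sigma> x \<in> V \<and> \<sigma> (\<sigma> x) = x) \<and> (\<forall>x\<in>V. \<forall>z\<in>V. \<sigma> (x \<otimes> z) = \<sigma> x \<otimes> \<sigma> z) \<and>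
    (\<forall>m\<in>M. \<forall>x\<in>V. \<sigma> (conjg G m x) = conjg G (\<mu> m) (\<sigma> x) \<and> x \<otimes> conjg G m (\<sigma> x) \<in> ?D)"
  proof (cases "\<forall>m\<in>M. \<forall>x\<in>V. conjg G m x = x")
    case True
    show ?thesis
    proof (intro exI[of _ "m_inv G"] conjI ballI)
      fix x z assume x: "x \<in> V" and z: "z \<in> V"
      show "inv (x \<otimes> z) = inv x \<otimes> inv z"
        using Vab[OF x z] inv_mult_group[of z x] x z Vsub by (simp add: subset_iff)
    next
      fix m x assume m: "m \<in> M" and x: "x \<in> V"
      show "inv conjg G m x = conjg G (\<mu> m) (inv x)"
        using True m x Vcl \<mu>(1) by metis
      show "x \<otimes> conjg G m (inv x) \<in> ?D"
        using True m Vcl(2)[OF x] Dcl(3) x Vsub by (auto simp: subset_iff)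
    qed (use Vcl Vsub in auto)
  next
    case False
    then obtain y x1 where y: "y \<in> M" "x1 \<in> V" "conjg G y x1 \<noteq> x1" by blast
    have normM: "conjg G m v \<in> V" if "m \<in> M" "v \<in> V" for m v using norm Msub that by auto
    have "k = 2"
    proof (rule ccontr)
      assume "k \<noteq> 2"
      then have k: "k = 1" using V(2,3) by simp
      have "conjg G y x1 = x1"
      proof (rule coprime_action_trivial[OF fin V(1) Vs V(5) M(1) normM, where L = "{\<one>}" and l = 0])
        show "\<not> q dvd r ^ i - 1" if "Factorial_Ring.prime q" "q dvd card M" "0 < i" "i + 0 \<le> k" for q i
          using that qM k by (cases "i = 1") auto
      qed (use y Vcl rM Msub in auto)
      then show False using y by simp
    qed
    interpret pa: plane_action G V M r
      by (intro plane_action.intro plane_action_axioms.intro group_axioms fin V(1) Vs M(1) normM Mgood rM qM)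
        (use V(5) \<open>k = 2\<close> in simp)
    have nt: "\<not> pa.trivial y" using y by (auto simp: pa.trivial_def pa.act_def)
    have comm: "conjg G (h \<otimes> h') x = conjg G (h' \<otimes> h) x" if "h \<in> M" "h' \<in> M" "x \<in> V" for h h' x
      using plane_action_abelian[OF pa.plane_action_axioms that] .
    then have acomm: "pa.act h (pa.act y x) = pa.act y (pa.act h x)" if "h \<in> M" "x \<in> V" for h x
      using pa.act_mult[OF that(1) y(1) that(2)] pa.act_mult[OF y(1) that] that y(1) by (simp add: pa.act_def)
    obtain \<sigma> where \<sigma>: "\<And>x. x \<in> V \<Longrightarrow> \<sigma> x \<in> V" "\<And>x. x \<in> V \<Longrightarrow> \<sigma> (\<sigma> x) = x"
      "\<And>x z. x \<in> V \<Longrightarrow> z \<in> V \<Longrightarrow> \<sigma> (x \<otimes> z) = \<sigma> x \<otimes> \<sigma> z"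
      "\<And>h x. h \<in> M \<Longrightarrow> x \<in> V \<Longrightarrow> \<sigma> (pa.act h x) = pa.act (inv h) (\<sigma> x)"
      using pa.inverting_automorphism[OF y(1) nt acomm] by blast
    have VD: "x \<in> ?D" if x: "x \<in> V" for x
    proof -
      obtain z where z: "z \<in> V" "x = pa.act y z \<otimes> inv z"
        using pa.commutator_surj[OF y(1) nt x] by blast
      have "y \<in> carrier G" "z \<in> carrier G" using y(1) z(1) Msub Vsub by auto
      then have "x \<in> derived_set G (carrier G)"
        unfolding z(2) pa.act_def by (intro UN_I[of y] UN_I[of z]) simp_all
      then show ?thesis unfolding derived_def by (rule generate.incl)
    qed
    have dt: "conjg G g x = x" if "g \<in> derived G M" "x \<in> V" for g x
      using derived_acts_trivially[OF Vsub Msub comm Mcl(2) that] by blast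
    \<comment> \<open>\<open>m \<otimes> \<mu> m\<close> lies in the derived group of
      \<open>M\<close>, which acts trivially, so \<open>\<mu> m\<close> acts as the inverse of
      m.\<close>
    have \<mu>inv: "conjg G (\<mu> m) x = conjg G (inv m) x" if m: "m \<in> M" and x: "x \<in> V" for m x
    proof -
      have c: "m \<in> carrier G" "\<mu> m \<in> carrier G" "x \<in> carrier G" using m x \<mu>(1) Msub Vsub by auto
      have "conjg G (inv m) x = conjg G (inv m) (conjg G (m \<otimes> \<mu> m) x)"
        using dt[OF \<mu>(3)[OF m] x] by simp
      also have "\<dots> = conjg G (inv m \<otimes> (m \<otimes> \<mu> m)) x"
        using c by (intro conjg_mult[symmetric]) auto
      also have "inv m \<otimes> (m \<otimes> \<mu> m) = \<mu> m" using c by (simp flip: m_assoc)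
      finally show ?thesis by simp
    qed
    show ?thesis
    proof (intro exI[of _ \<sigma>] conjI ballI)
      fix m x assume m: "m \<in> M" and x: "x \<in> V"
      show "\<sigma> (conjg G m x) = conjg G (\<mu> m) (\<sigma> x)"
        using \<sigma>(4)[OF m x] \<mu>inv[OF m \<sigma>(1)[OF x]] by (simp add: pa.act_def)
      show "x \<otimes> conjg G m (\<sigma> x) \<in> ?D"
        using Dcl(1) VD x normM m \<sigma>(1) by simp
    qed (use \<sigma> in auto)
  qed
  then obtain \<sigma> where \<sigma>: "\<And>x. x \<in> V \<Longrightarrow> \<sigma> x \<in> V" "\<And>x. x \<in> V \<Longrightarrow> \<sigma> (\<sigma> x) = x"
    "\<And>x z. x \<in> V \<Longrightarrow> z \<in> V \<Longrightarrow> \<sigma> (x \<otimes> z) = \<sigma> x \<otimes> \<sigma> z"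
    "\<And>m x. m \<in> M \<Longrightarrow> x \<in> V \<Longrightarrow> \<sigma> (conjg G m x) = conjg G (\<mu> m) (\<sigma> x)"
    "\<And>m x. m \<in> M \<Longrightarrow> x \<in> V \<Longrightarrow> x \<otimes> conjg G m (\<sigma> x) \<in> ?D" by blast
  have inj: "v = v' \<and> m = m'"
    if "v \<otimes> m = v' \<otimes> m'" "v \<in> V" "v' \<in> V" "m \<in> M" "m' \<in> M" for v v' m m'
    using inj_on_mult_subgroups[OF Vs M(1)] M(2) that unfolding inj_on_def by (force simp: Int_commute)
  define \<tau> where "\<tau> g = (THE u. \<exists>v\<in>V. \<exists>m\<in>M. g = v \<otimes> m \<and> u = \<sigma> v \<otimes> \<mu> m)" for g
  have \<tau>: "\<tau> (v \<otimes> m) = \<sigma> v \<otimes> \<mu> m" if "v \<in> V" "m \<in> M" for v m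
    unfolding \<tau>_def using that inj by (intro the_equality) blast+
  have in_c: "v \<in> carrier G" "m \<in> carrier G" "\<sigma> v \<in> carrier G" "\<mu> m \<in> carrier G" if "v \<in> V" "m \<in> M" for v m
    using that Vsub Msub \<sigma>(1) \<mu>(1) by auto
  show ?thesis
  proof (intro exI[of _ \<tau>] conjI ballI)
    fix g assume "g \<in> carrier G"
    then obtain v m where vm: "v \<in> V" "m \<in> M" and g: "g = v \<otimes> m" using dec by blast
    note c = in_c[OF vm]
    show "\<tau> g \<in> carrier G" "\<tau> (\<tau> g) = g" using vm c \<sigma> \<mu> by (auto simp: g \<tau>)
    have "m \<otimes> \<mu> m \<in> ?D" using \<mu>(3)[OF vm(2)] mono_derived[OF Msub] by blast
    moreover have "g \<otimes> \<tau> g = v \<otimes> conjg G m (\<sigma> v) \<otimes> (m \<otimes> \<mu> m)"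
      using c vm by (simp add: g \<tau> m_assoc inv_solve_left)
    ultimately show "g \<otimes> \<tau> g \<in> ?D" using Dcl(1) \<sigma>(5)[OF vm(2,1)] by simp
  next
    fix g h assume "g \<in> carrier G" "h \<in> carrier G"
    then obtain v m v' m' where vm: "v \<in> V" "m \<in> M" "v' \<in> V" "m' \<in> M"
      and g: "g = v \<otimes> m" and h: "h = v' \<otimes> m'" using dec by metis
    note c = in_c[OF vm(1,2)] in_c[OF vm(3,4)]
    have cm: "conjg G m v' \<in> V" using norm c(2) vm(3) by blast
    have "g \<otimes> h = (v \<otimes> conjg G m v') \<otimes> (m \<otimes> m')"
      using c by (simp add: g h m_assoc inv_solve_left)
    then have "\<tau> (g \<otimes> h) = \<sigma> (v \<otimes> conjg G m v') \<otimes> \<mu> (m \<otimes> m')"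
      using \<tau> Vcl(1)[OF vm(1) cm] Mcl(1)[OF vm(2,4)] by simp
    also have "\<dots> = \<sigma> v \<otimes> conjg G (\<mu> m) (\<sigma> v') \<otimes> (\<mu> m \<otimes> \<mu> m')"
      using \<sigma>(3)[OF vm(1) cm] \<sigma>(4)[OF vm(2,3)] \<mu>(4)[OF vm(2,4)] by simp
    also have "\<dots> = \<tau> g \<otimes> \<tau> h"
    proof -
      have "inv \<mu> m \<otimes> (\<mu> m \<otimes> \<mu> m') = \<mu> m'" using c by (simp flip: m_assoc)
      then show ?thesis using c vm by (simp add: g h \<tau> m_assoc)
    qed
    finally show "\<tau> (g \<otimes> h) = \<tau> g \<otimes> \<tau> h" .
  qed
qed

theorem good_order_inverting_automorphism:
  fixes G :: "('a, 'b) monoid_scheme"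
  assumes "group G" "finite (carrier G)" "good_order (order G)"
  shows "\<exists>\<tau>. (\<forall>g\<in>carrier G. \<tau> g \<in> carrier G \<and> \<tau> (\<tau> g) = g \<and> g \<otimes>\<^bsub>G\<^esub> \<tau> g \<in> derived G (carrier G)) \<and>
    (\<forall>g\<in>carrier G. \<forall>h\<in>carrier G. \<tau> (g \<otimes>\<^bsub>G\<^esub> h) = \<tau> g \<otimes>\<^bsub>G\<^esub> \<tau> h)"
  using assms
proof (induction "order G" arbitrary: G rule: less_induct)
  case less
  interpret group G by (rule less.prems(1))
  note fin = less.prems(2)
  show ?case
  proof (cases "order G = 1")
    case True
    then have "carrier G = {\<one>\<^bsub>G\<^esub>}" using order_one_triv_iff by blast
    then show ?thesis
      using subgroup.one_closed[OF derived_is_subgroup[OF subset_refl]] by (intro exI[of _ id]) simp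
  next
    case False
    obtain r k V where V: "Factorial_Ring.prime r" "0 < k" "k \<le> 2" "V \<lhd> G" "card V = r ^ k"
      "\<not> r dvd order G div r ^ k"
      using good_order_normal_sylow[OF less.prems False] .
    have Vs: "subgroup V G" using V normal_imp_subgroup by blast
    have Vab: "x \<otimes>\<^bsub>G\<^esub> z = z \<otimes>\<^bsub>G\<^esub> x" if "x \<in> V" "z \<in> V" for x z
      using prime_square_abelian[OF V(1) Vs V(5,3) that] .
    interpret cs: abelian_subgroup_cosets G V
      by (intro abelian_subgroup_cosets.intro abelian_subgroup_cosets_axioms.intro group_axioms fin Vs Vab)
    have "coprime (card V) (order G div card V)"
      unfolding V(5) using V(1,6) by (metis coprime_power_left_iff prime_imp_coprime)
    then obtain M where M: "subgroup M G" "card M * card V = order G" "M \<inter> V = {\<one>\<^bsub>G\<^esub>}"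
      and dec: "\<And>g. g \<in> carrier G \<Longrightarrow> \<exists>v\<in>V. \<exists>m\<in>M. g = v \<otimes>\<^bsub>G\<^esub> m"
      using cs.normal_abelian_complement[OF V(4)] by metis
    have Msub: "M \<subseteq> carrier G" using subgroup.subset[OF M(1)] .
    have pk: "r ^ k > 1" using V(1,2) by (intro one_less_power prime_gt_1_nat)
    have M0: "card M > 0" using subgroup.finite_imp_card_positive[OF M(1) fin] .
    then have "card M * 1 < card M * r ^ k" using pk by (intro mult_strict_left_mono)
    then have Mlt: "card M < order G" using M(2) V(5) by (metis mult_1_right)
    have Mgood: "good_order (card M)" using good_order_dvd[OF less.prems(3)] M(2) by (metis dvd_triv_left)
    have "card M = order G div r ^ k" using M(2) V(5) pk by (metis nonzero_mult_div_cancel_right less_numeral_extra(3) less_trans zero_less_one)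
    then have rM: "\<not> r dvd card M" using V(6) by simp
    have rn: "r dvd order G" using M(2) V(2,5) by (metis dvd_mult dvd_power)
    have qM: "\<not> q dvd r - 1" if "Factorial_Ring.prime q" "q dvd card M" for q
    proof -
      have "q dvd order G" using that M(2) by (metis dvd_mult2)
      then show ?thesis using less.prems(3) V(1) that rn by (auto simp: good_order_def)
    qed
    have "finite M" using Msub fin finite_subset by blast
    then have "\<exists>\<mu>. (\<forall>m\<in>M. \<mu> m \<in> M \<and> \<mu> (\<mu> m) = m \<and> m \<otimes>\<^bsub>G\<^esub> \<mu> m \<in> derived G M) \<and>
      (\<forall>m\<in>M. \<forall>m'\<in>M. \<mu> (m \<otimes>\<^bsub>G\<^esub> m') = \<mu> m \<otimes>\<^bsub>G\<^esub> \<mu> m')"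
      using less.hyps[of "G\<lparr>carrier := M\<rparr>"] subgroup_imp_group[OF M(1)] Mlt Mgood
        derived_consistent[OF subset_refl M(1)] by (simp add: order_def)
    then show ?thesis
      using inverting_automorphism_step[OF fin V(1-5) M(1,3) dec Mgood rM qM] by blast
  qed
qed

section \<open>Construction of integrals\<close>

definition involution_ext :: "('a, 'b) monoid_scheme \<Rightarrow> ('a \<Rightarrow> 'a) \<Rightarrow> ('a \<times> bool) monoid" where
  "involution_ext G \<tau> = \<lparr>carrier = carrier G \<times> UNIV,
     monoid.mult = (\<lambda>(g, s) (h, t). (g \<otimes>\<^bsub>G\<^esub> (if s then \<tau> h else h), s \<noteq> t)), monoid.one = (\<one>\<^bsub>G\<^esub>, False)\<rparr>"

definition xor_group :: "bool monoid" where
  "xor_group = \<lparr>carrier = UNIV, monoid.mult = (\<noteq>), monoid.one = False\<rparr>"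

lemma comm_group_xor_group: "comm_group xor_group"
proof (rule comm_groupI)
  fix x assume "x \<in> carrier xor_group"
  show "\<exists>y\<in>carrier xor_group. y \<otimes>\<^bsub>xor_group\<^esub> x = \<one>\<^bsub>xor_group\<^esub>"
    by (rule bexI[of _ x]) (auto simp: xor_group_def)
qed (auto simp: xor_group_def)

lemma (in group_hom) derived_in_kernel:
  assumes "comm_group H" shows "derived G (carrier G) \<subseteq> kernel G H h"
proof -
  interpret H: comm_group H by fact
  have "h ` derived G (carrier G) = derived H (h ` carrier G)" using derived_img by simp
  also have "\<dots> = {\<one>\<^bsub>H\<^esub>}" by (rule H.derived_eq_singleton) auto
  finally show ?thesis using G.derived_in_carrier[of "carrier G"] by (auto simp: kernel_def)
qed

locale involution = group G for G (structure) +
  fixes \<tau> :: "'a \<Rightarrow> 'a"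
  assumes \<tau>_closed: "\<And>g. g \<in> carrier G \<Longrightarrow> \<tau> g \<in> carrier G"
    and \<tau>_\<tau>: "\<And>g. g \<in> carrier G \<Longrightarrow> \<tau> (\<tau> g) = g"
    and \<tau>_mult: "\<And>g h. g \<in> carrier G \<Longrightarrow> h \<in> carrier G \<Longrightarrow> \<tau> (g \<otimes> h) = \<tau> g \<otimes> \<tau> h"
begin

abbreviation "H \<equiv> involution_ext G \<tau>"

lemma \<tau>_one: "\<tau> \<one> = \<one>"
  using \<tau>_mult[of \<one> \<one>] \<tau>_closed[of \<one>] by (metis one_closed r_one l_cancel_one')

lemma \<tau>_inv: "g \<in> carrier G \<Longrightarrow> \<tau> (inv g) = inv (\<tau> g)"
  using \<tau>_mult[of "inv g" g] \<tau>_closed[of g] \<tau>_closed[of "inv g"] \<tau>_one by (metis inv_closed inv_equality l_inv)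

lemma H_simps: "carrier H = carrier G \<times> UNIV" "\<one>\<^bsub>H\<^esub> = (\<one>, False)"
  "(g, s) \<otimes>\<^bsub>H\<^esub> (h, t) = (g \<otimes> (if s then \<tau> h else h), s \<noteq> t)"
  by (simp_all add: involution_ext_def)

sublocale H: group H
proof (rule groupI)
  fix x y z assume "x \<in> carrier H" "y \<in> carrier H" "z \<in> carrier H"
  then show "x \<otimes>\<^bsub>H\<^esub> y \<otimes>\<^bsub>H\<^esub> z = x \<otimes>\<^bsub>H\<^esub> (y \<otimes>\<^bsub>H\<^esub> z)"
    by (cases x; cases y; cases z) (auto simp: H_simps \<tau>_closed \<tau>_\<tau> \<tau>_mult m_assoc)
next
  fix x assume "x \<in> carrier H"
  then obtain g s where x: "x = (g, s)" "g \<in> carrier G" by (cases x) (auto simp: H_simps)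
  show "\<exists>y\<in>carrier H. y \<otimes>\<^bsub>H\<^esub> x = \<one>\<^bsub>H\<^esub>"
    using x by (intro bexI[of _ "(if s then \<tau> (inv g) else inv g, s)"])
      (auto simp: H_simps \<tau>_closed \<tau>_inv)
qed (auto simp: H_simps \<tau>_closed)

lemma H_inv: "g \<in> carrier G \<Longrightarrow> inv\<^bsub>H\<^esub> (g, s) = (if s then \<tau> (inv g) else inv g, s)"
  by (rule H.inv_equality) (auto simp: H_simps \<tau>_closed \<tau>_inv)

lemma derived_H_snd: "x \<in> derived H (carrier H) \<Longrightarrow> \<not> snd x"
proof -
  interpret X: comm_group xor_group by (rule comm_group_xor_group)
  interpret h: group_hom H xor_group snd
    by (intro group_hom.intro group_hom_axioms.intro H.group_axioms X.group_axioms homI)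
      (auto simp: H_simps xor_group_def)
  show "x \<in> derived H (carrier H) \<Longrightarrow> \<not> snd x"
    using h.derived_in_kernel[OF comm_group_xor_group] by (auto simp: kernel_def xor_group_def)
qed

lemma derived_H_fst: "x \<in> derived H (carrier H) \<Longrightarrow> fst x \<in> carrier G"
  using H.derived_in_carrier[of "carrier H"] by (auto simp: H_simps)

lemma commutator_H:
  assumes g: "g \<in> carrier G"
  shows "(g \<otimes> inv (\<tau> g), False) \<in> derived H (carrier H)"
proof -
  have "(g, False) \<otimes>\<^bsub>H\<^esub> (\<one>, True) \<otimes>\<^bsub>H\<^esub> inv\<^bsub>H\<^esub> (g, False) \<otimes>\<^bsub>H\<^esub> inv\<^bsub>H\<^esub> (\<one>, True) \<in> derived H (carrier H)"
    unfolding derived_def using g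
    by (intro generate.incl UN_I[of "(g, False)"] UN_I[of "(\<one>, True)"] singletonI) (simp_all add: H_simps(1))
  then show ?thesis using g by (simp add: H_inv H_simps \<tau>_inv \<tau>_one \<tau>_closed)
qed

text \<open>Modulo the derived group of G, \<open>\<tau> g\<close> is the inverse of g, so the
  commutator \<open>g \<otimes> inv (\<tau> g)\<close> of \<open>commutator_H\<close> becomes the
  square of g. In odd order every element is a square.\<close>

theorem integral_odd:
  assumes odd: "finite (carrier G)" "odd (order G)"
    and inv: "\<And>g. g \<in> carrier G \<Longrightarrow> g \<otimes> \<tau> g \<in> derived G (carrier G)"
  shows "integral_of H G"
proof -
  define D where "D = derived H (carrier H)"
  have Ds: "subgroup D H" unfolding D_def by (rule H.derived_is_subgroup) simp
  have Dn: "D \<lhd> H" unfolding D_def by (rule H.derived_self_is_normal)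
  have inc: "(\<lambda>g. (g, False)) \<in> hom G H" by (intro homI) (auto simp: H_simps)
  have i: "group_hom G H (\<lambda>g. (g, False))"
    by (intro group_hom.intro group_hom_axioms.intro group_axioms H.group_axioms inc)
  have GD: "(d, False) \<in> D" if "d \<in> derived G (carrier G)" for d
  proof -
    have "(d, False) \<in> derived H ((\<lambda>g. (g, False)) ` carrier G)" using group_hom.derived_img[OF i, of "carrier G"] that by auto
    then show ?thesis using H.mono_derived[of "(\<lambda>g. (g, False)) ` carrier G" "carrier H"] by (auto simp: D_def H_simps)
  qed
  have sq: "(g \<otimes> g, False) \<in> D" if g: "g \<in> carrier G" for g
  proof -
    have c: "\<tau> g \<in> carrier G" using \<tau>_closed g by simp
    \<comment> \<open>Conjugating the inverse of \<open>g \<otimes> \<tau> g\<close> by g and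
      inverting gives \<open>g \<otimes> g \<otimes> \<tau> g \<otimes> inv g\<close>, which the
      commutator \<open>g \<otimes> inv (\<tau> g)\<close> completes to the exact square.\<close>
    have "(g, False) \<otimes>\<^bsub>H\<^esub> (inv (\<tau> g) \<otimes> inv g, False) \<otimes>\<^bsub>H\<^esub> inv\<^bsub>H\<^esub> (g, False) \<in> D"
    proof (rule normal.inv_op_closed2[OF Dn])
      have "inv (g \<otimes> \<tau> g) \<in> derived G (carrier G)"
        using inv[OF g] subgroup.m_inv_closed[OF derived_is_subgroup[of "carrier G"]] by simp
      then show "(inv (\<tau> g) \<otimes> inv g, False) \<in> D" using GD inv_mult_group[OF g c] by simp
    qed (use g in \<open>simp add: H_simps\<close>)
    then have "inv\<^bsub>H\<^esub> ((g, False) \<otimes>\<^bsub>H\<^esub> (inv (\<tau> g) \<otimes> inv g, False) \<otimes>\<^bsub>H\<^esub> inv\<^bsub>H\<^esub> (g, False)) \<in> D"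
      using subgroup.m_inv_closed[OF Ds] by blast
    then have "inv\<^bsub>H\<^esub> ((g, False) \<otimes>\<^bsub>H\<^esub> (inv (\<tau> g) \<otimes> inv g, False) \<otimes>\<^bsub>H\<^esub> inv\<^bsub>H\<^esub> (g, False))
        \<otimes>\<^bsub>H\<^esub> (g \<otimes> inv (\<tau> g), False) \<in> D"
      using subgroup.m_closed[OF Ds] commutator_H[OF g] by (simp add: D_def)
    then have "(g \<otimes> g \<otimes> \<tau> g \<otimes> inv g \<otimes> (g \<otimes> inv (\<tau> g)), False) \<in> D"
      using g c by (simp add: H_inv H_simps inv_mult_group m_assoc)
    moreover have "g \<otimes> g \<otimes> \<tau> g \<otimes> inv g \<otimes> (g \<otimes> inv (\<tau> g)) = g \<otimes> g"
    proof -
      have "inv g \<otimes> (g \<otimes> inv (\<tau> g)) = inv (\<tau> g)" using g c by (simp flip: m_assoc)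
      then show ?thesis using g c by (simp add: m_assoc)
    qed
    ultimately show ?thesis by simp
  qed
  have GsubD: "(g, False) \<in> D" if g: "g \<in> carrier G" for g
  proof -
    have "even (order G + 1)" using odd by simp
    then obtain i where i: "order G + 1 = 2 * i" by (elim evenE)
    \<comment> \<open>The square root of g: 2i is one more than the order of G.\<close>
    define h where "h = g [^] i"
    have h: "h \<in> carrier G" using g by (simp add: h_def)
    have "h \<otimes> h = g [^] (2 * i)" using g by (simp add: h_def nat_pow_mult mult_2)
    also have "\<dots> = g [^] (order G + 1)" by (simp only: i)
    also have "\<dots> = g" using g pow_order_eq_1 by simp
    finally show ?thesis using sq[OF h] by simp
  qed
  have "D = (\<lambda>g. (g, False)) ` carrier G"
  proof
    show "D \<subseteq> (\<lambda>g. (g, False)) ` carrier G"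
    proof
      fix x assume "x \<in> D"
      then have "fst x \<in> carrier G" "\<not> snd x" using derived_H_snd derived_H_fst by (auto simp: D_def)
      then show "x \<in> (\<lambda>g. (g, False)) ` carrier G" by (cases x) auto
    qed
  qed (use GsubD in auto)
  then have "fst \<in> iso (H\<lparr>carrier := D\<rparr>) G"
    by (intro isoI homI) (auto simp: H_simps bij_betw_def inj_on_def image_image)
  then have "H\<lparr>carrier := D\<rparr> \<cong> G" by (rule is_isoI)
  then show ?thesis using H.group_axioms by (simp add: integral_of_def D_def)
qed

end

text \<open>The commutator of (g, 1) with the swap is (g, g^-1). Conversely, multiplying the two
  components is a homomorphism from the extension to the abelian group G, so it kills the derived
  group, which is therefore the antidiagonal.\<close>

theorem (in comm_group) integral_comm:
  "integral_of (involution_ext (G \<times>\<times> G) prod.swap) G"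
proof -
  interpret GG: group "G \<times>\<times> G" by (rule DirProd_group[OF group_axioms group_axioms])
  interpret S: involution "G \<times>\<times> G" prod.swap
    by unfold_locales (auto simp: DirProd_def)
  define D where "D = derived S.H (carrier S.H)"
  interpret h: group_hom S.H G "\<lambda>x. fst (fst x) \<otimes> snd (fst x)"
    by (intro group_hom.intro group_hom_axioms.intro S.H.group_axioms group_axioms homI)
      (auto simp: S.H_simps m_ac)
  have "x \<in> (\<lambda>g. ((g, inv g), False)) ` carrier G" if x: "x \<in> D" for x
  proof -
    obtain a b s where x': "x = ((a, b), s)" by (metis surj_pair)
    have "\<not> s" "a \<in> carrier G" "b \<in> carrier G"
      using S.derived_H_snd[of x] S.derived_H_fst[of x] x by (auto simp: D_def x' DirProd_def)
    moreover have "a \<otimes> b = \<one>"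
      using h.derived_in_kernel[OF comm_group_axioms] x by (auto simp: D_def x' kernel_def)
    ultimately have "inv a = b" "\<not> s" "a \<in> carrier G" using m_comm[of a b] by (auto intro: inv_equality)
    then show ?thesis using x' by auto
  qed
  moreover have "((g, inv g), False) \<in> D" if g: "g \<in> carrier G" for g
  proof -
    have "inv\<^bsub>G \<times>\<times> G\<^esub> (\<one>, g) = (\<one>, inv g)" using g by (simp add: inv_DirProd group_axioms)
    then have "((g, \<one>) \<otimes>\<^bsub>G \<times>\<times> G\<^esub> (\<one>, inv g), False) \<in> D"
      using S.commutator_H[of "(g, \<one>)"] g by (simp add: D_def)
    then show ?thesis using g by simp
  qed
  ultimately have "D = (\<lambda>g. ((g, inv g), False)) ` carrier G" by blast
  then have "(\<lambda>x. fst (fst x)) \<in> iso (S.H\<lparr>carrier := D\<rparr>) G"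
    by (intro isoI homI) (auto simp: S.H_simps bij_betw_def inj_on_def image_image)
  then have "S.H\<lparr>carrier := D\<rparr> \<cong> G" by (rule is_isoI)
  then show ?thesis using S.H.group_axioms by (simp add: integral_of_def D_def)
qed

theorem integrable_of_arithmetic:
  fixes G :: "('a, 'c) monoid_scheme"
  assumes G: "group G" and n: "order G > 0" and cf: "cube_free (order G)"
    and pq: "\<And>p q. Factorial_Ring.prime p \<Longrightarrow> Factorial_Ring.prime q \<Longrightarrow> p dvd order G \<Longrightarrow> q dvd order G \<Longrightarrow> \<not> q dvd p - 1"
  shows "integrable_group TYPE('b::infinite) G"
proof -
  interpret group G by fact
  have fin: "finite (carrier G)" using n by (simp add: order_gt_0_iff_finite)
  show ?thesis
  proof (cases "odd (order G)")
    case True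
    then have good: "good_order (order G)" using cf pq by (auto simp: good_order_def)
    obtain \<tau> where \<tau>: "\<And>g. g \<in> carrier G \<Longrightarrow> \<tau> g \<in> carrier G" "\<And>g. g \<in> carrier G \<Longrightarrow> \<tau> (\<tau> g) = g"
      "\<And>g. g \<in> carrier G \<Longrightarrow> g \<otimes>\<^bsub>G\<^esub> \<tau> g \<in> derived G (carrier G)"
      "\<And>g h. g \<in> carrier G \<Longrightarrow> h \<in> carrier G \<Longrightarrow> \<tau> (g \<otimes>\<^bsub>G\<^esub> h) = \<tau> g \<otimes>\<^bsub>G\<^esub> \<tau> h"
      using good_order_inverting_automorphism[OF G fin good] by blast
    interpret involution G \<tau> by unfold_locales (use \<tau> in auto)
    show ?thesis by (rule integrable_group_universe[OF integral_odd[OF fin True \<tau>(3)] fin])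
  next
    case False
    define k where "k = multiplicity 2 (order G)"
    note k = cube_free_multiplicity[OF cf n two_is_prime_nat, folded k_def]
    \<comment> \<open>An odd prime divisor p would violate the hypothesis together with 2, which
      divides p - 1.\<close>
    have "order G div 2 ^ k = 1"
    proof (rule ccontr)
      assume "order G div 2 ^ k \<noteq> 1"
      then obtain p where p: "Factorial_Ring.prime p" "p dvd order G div 2 ^ k" using prime_factor_nat by blast
      have "p dvd order G" using p k(5) False by (metis dvd_mult)
      moreover have "odd p" using p k(4) False dvd_trans by blast
      ultimately show False using pq[OF p(1) two_is_prime_nat] False by simp
    qed
    then have o: "card (carrier G) = 2 ^ k" using k(5) False by (simp add: order_def)
    have "k \<le> 2" using k(2) False by simp
    then have "comm_group G"
      using prime_square_abelian[OF two_is_prime_nat subgroup_self o] by (intro group_comm_groupI) auto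
    then show ?thesis using comm_group.integral_comm fin by (intro integrable_group_universe) auto
  qed
qed

section \<open>Obstructions to integrability\<close>

text \<open>The automorphisms in \<open>A\<close> are those induced by conjugation in an integral.\<close>

lemma (in group) integrable_automorphisms:
  assumes "integrable_group TYPE('h) G"
  shows "\<exists>A. (\<forall>\<alpha>\<in>A. \<alpha> \<in> iso G G) \<and>
     (\<forall>\<alpha>\<in>A. \<forall>\<beta>\<in>A. \<exists>g\<in>carrier G. \<forall>x\<in>carrier G. \<alpha> (\<beta> x) = g \<otimes> \<beta> (\<alpha> x) \<otimes> inv g) \<and>
     (\<forall>x\<in>carrier G. (\<forall>\<alpha>\<in>A. \<forall>\<beta>\<in>A. \<alpha> (\<beta> x) = \<beta> (\<alpha> x)) \<longrightarrow> (\<forall>g\<in>carrier G. g \<otimes> x = x \<otimes> g))"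
proof -
  obtain H :: "'h monoid" where H: "integral_of H G" using assms by (auto simp: integrable_group_def)
  interpret H: group H using H by (simp add: integral_of_def)
  define D where "D = derived H (carrier H)"
  have Dn: "D \<lhd> H" unfolding D_def by (rule H.derived_self_is_normal)
  have Ds: "subgroup D H" using Dn normal_imp_subgroup by blast
  have DH: "D \<subseteq> carrier H" using subgroup.subset[OF Ds] .
  interpret D: group "H\<lparr>carrier := D\<rparr>" by (rule H.subgroup_imp_group[OF Ds])
  obtain \<phi> where \<phi>: "\<phi> \<in> iso (H\<lparr>carrier := D\<rparr>) G"
    using H by (auto simp: integral_of_def D_def is_iso_def)
  have bij: "bij_betw \<phi> D (carrier G)" and hom: "\<phi> \<in> hom (H\<lparr>carrier := D\<rparr>) G"
    using \<phi> by (auto simp: iso_def)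
  interpret \<phi>: group_hom "H\<lparr>carrier := D\<rparr>" G \<phi>
    by (intro group_hom.intro group_hom_axioms.intro D.group_axioms group_axioms hom)
  define \<psi> where "\<psi> = inv_into D \<phi>"
  have \<psi>: "\<psi> x \<in> D" "\<phi> (\<psi> x) = x" if "x \<in> carrier G" for x
    using bij that by (auto simp: \<psi>_def bij_betw_def inv_into_into f_inv_into_f)
  have \<psi>\<phi>: "\<psi> (\<phi> d) = d" if "d \<in> D" for d
    using bij that by (auto simp: \<psi>_def bij_betw_def)
  have mult: "\<phi> (d \<otimes>\<^bsub>H\<^esub> e) = \<phi> d \<otimes> \<phi> e" if "d \<in> D" "e \<in> D" for d e
    using hom that by (simp add: hom_def)
  have \<phi>inv: "\<phi> (inv\<^bsub>H\<^esub> d) = inv \<phi> d" if "d \<in> D" for d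
    using \<phi>.hom_inv[of d] that by (simp add: H.m_inv_consistent[OF Ds])
  have \<phi>c: "\<phi> d \<in> carrier G" if "d \<in> D" for d using \<phi>.hom_closed that by simp
  define c where "c h d = h \<otimes>\<^bsub>H\<^esub> d \<otimes>\<^bsub>H\<^esub> inv\<^bsub>H\<^esub> h" for h d
  have cD: "c h d \<in> D" if "h \<in> carrier H" "d \<in> D" for h d
    unfolding c_def by (rule normal.inv_op_closed2[OF Dn that])
  have cc: "c h (c k d) = c (h \<otimes>\<^bsub>H\<^esub> k) d" if "h \<in> carrier H" "k \<in> carrier H" "d \<in> D" for h k d
    using that DH by (simp add: c_def H.inv_mult_group H.m_assoc subset_iff)
  have c1: "c \<one>\<^bsub>H\<^esub> d = d" if "d \<in> D" for d using that DH by (auto simp: c_def)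
  have cm: "c h (d \<otimes>\<^bsub>H\<^esub> e) = c h d \<otimes>\<^bsub>H\<^esub> c h e" if "h \<in> carrier H" "d \<in> D" "e \<in> D" for h d e
  proof -
    have "d \<in> carrier H" "e \<in> carrier H" using that DH by auto
    then show ?thesis using that(1) by (simp add: c_def H.m_assoc H.inv_solve_left)
  qed
  define \<Theta> where "\<Theta> h x = \<phi> (c h (\<psi> x))" for h x
  have \<Theta>c: "\<Theta> h x \<in> carrier G" if "h \<in> carrier H" "x \<in> carrier G" for h x
    using that \<psi> cD \<phi>c by (simp add: \<Theta>_def)
  have \<psi>\<Theta>: "\<psi> (\<Theta> h x) = c h (\<psi> x)" if "h \<in> carrier H" "x \<in> carrier G" for h x
    using that \<psi> cD \<psi>\<phi> by (simp add: \<Theta>_def)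
  have \<Theta>\<Theta>: "\<Theta> h (\<Theta> k x) = \<Theta> (h \<otimes>\<^bsub>H\<^esub> k) x" if "h \<in> carrier H" "k \<in> carrier H" "x \<in> carrier G" for h k x
    using that \<psi>\<Theta>[OF that(2,3)] cc \<psi> by (simp add: \<Theta>_def[of h] \<Theta>_def[of "h \<otimes>\<^bsub>H\<^esub> k"])
  have \<Theta>1: "\<Theta> \<one>\<^bsub>H\<^esub> x = x" if "x \<in> carrier G" for x using c1 \<psi> that by (simp add: \<Theta>_def)
  have \<psi>mult: "\<psi> (x \<otimes> y) = \<psi> x \<otimes>\<^bsub>H\<^esub> \<psi> y" if "x \<in> carrier G" "y \<in> carrier G" for x y
  proof -
    have "\<phi> (\<psi> x \<otimes>\<^bsub>H\<^esub> \<psi> y) = x \<otimes> y" using mult \<psi> that by simp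
    then show ?thesis using \<psi>\<phi> subgroup.m_closed[OF Ds] \<psi> that by metis
  qed
  have iso: "\<Theta> h \<in> iso G G" if h: "h \<in> carrier H" for h
  proof (rule isoI)
    show "\<Theta> h \<in> hom G G"
      using h \<Theta>c \<psi> cD mult by (intro homI) (auto simp: \<Theta>_def \<psi>mult cm)
    show "bij_betw (\<Theta> h) (carrier G) (carrier G)"
      by (rule bij_betw_byWitness[where f' = "\<Theta> (inv\<^bsub>H\<^esub> h)"]) (use h \<Theta>c \<Theta>\<Theta> \<Theta>1 in auto)
  qed
  have inner: "\<exists>g\<in>carrier G. \<forall>x\<in>carrier G. \<Theta> h (\<Theta> k x) = g \<otimes> \<Theta> k (\<Theta> h x) \<otimes> inv g"
    if h: "h \<in> carrier H" and k: "k \<in> carrier H" for h k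
  proof -
    \<comment> \<open>\<open>h\<close> times \<open>k\<close> is \<open>u\<close> times the product
      in the other order, and conjugation by \<open>u\<close>, an element of the derived group,
      becomes an inner automorphism of G.\<close>
    define u where "u = h \<otimes>\<^bsub>H\<^esub> k \<otimes>\<^bsub>H\<^esub> inv\<^bsub>H\<^esub> h \<otimes>\<^bsub>H\<^esub> inv\<^bsub>H\<^esub> k"
    have u: "u \<in> D" unfolding D_def derived_def u_def using h k by (intro generate.incl) blast
    have uH: "u \<in> carrier H" using u DH by auto
    have e: "h \<otimes>\<^bsub>H\<^esub> k = u \<otimes>\<^bsub>H\<^esub> (k \<otimes>\<^bsub>H\<^esub> h)"
    proof -
      have "inv\<^bsub>H\<^esub> h \<otimes>\<^bsub>H\<^esub> (inv\<^bsub>H\<^esub> k \<otimes>\<^bsub>H\<^esub> (k \<otimes>\<^bsub>H\<^esub> h)) = \<one>\<^bsub>H\<^esub>"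
        using h k by (simp flip: H.m_assoc)
      then show ?thesis using h k by (simp add: u_def H.m_assoc)
    qed
    have "\<Theta> h (\<Theta> k x) = \<phi> u \<otimes> \<Theta> k (\<Theta> h x) \<otimes> inv \<phi> u" if x: "x \<in> carrier G" for x
    proof -
      define d where "d = c (k \<otimes>\<^bsub>H\<^esub> h) (\<psi> x)"
      have d: "d \<in> D" using h k x \<psi> cD by (simp add: d_def)
      have "\<Theta> h (\<Theta> k x) = \<phi> (c (u \<otimes>\<^bsub>H\<^esub> (k \<otimes>\<^bsub>H\<^esub> h)) (\<psi> x))"
        using \<Theta>\<Theta>[OF h k x] e by (simp add: \<Theta>_def)
      also have "\<dots> = \<phi> (c u d)" using cc[OF uH, of "k \<otimes>\<^bsub>H\<^esub> h" "\<psi> x"] h k \<psi> x by (simp add: d_def)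
      also have "\<dots> = \<phi> u \<otimes> \<phi> d \<otimes> inv \<phi> u"
        using u d subgroup.m_closed[OF Ds] subgroup.m_inv_closed[OF Ds] by (simp add: c_def mult \<phi>inv)
      also have "\<phi> d = \<Theta> k (\<Theta> h x)" using \<Theta>\<Theta>[OF k h x] by (simp add: \<Theta>_def d_def)
      finally show ?thesis .
    qed
    then show ?thesis using \<phi>c[OF u] by blast
  qed
  have central: "g \<otimes> x = x \<otimes> g"
    if x: "x \<in> carrier G" and comm: "\<And>h k. h \<in> carrier H \<Longrightarrow> k \<in> carrier H \<Longrightarrow> \<Theta> h (\<Theta> k x) = \<Theta> k (\<Theta> h x)"
      and g: "g \<in> carrier G" for x g
  proof -
    define d where "d = \<psi> x"
    have d: "d \<in> D" "d \<in> carrier H" using \<psi> x DH by (auto simp: d_def)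
    have cdc: "c (h \<otimes>\<^bsub>H\<^esub> k) d = c (k \<otimes>\<^bsub>H\<^esub> h) d" if "h \<in> carrier H" "k \<in> carrier H" for h k
      using comm[OF that] \<Theta>\<Theta> that x \<psi>\<Theta>[of "h \<otimes>\<^bsub>H\<^esub> k" x] \<psi>\<Theta>[of "k \<otimes>\<^bsub>H\<^esub> h" x] by (simp add: d_def)
    define C where "C = {h \<in> carrier H. h \<otimes>\<^bsub>H\<^esub> d = d \<otimes>\<^bsub>H\<^esub> h}"
    have Cs: "subgroup C H"
    proof (rule H.subgroupI)
      show "C \<noteq> {}" using d by (auto simp: C_def intro!: exI[of _ "\<one>\<^bsub>H\<^esub>"])
    next
      fix a assume "a \<in> C"
      then have a: "a \<in> carrier H" "a \<otimes>\<^bsub>H\<^esub> d = d \<otimes>\<^bsub>H\<^esub> a" by (auto simp: C_def)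
      then have "d = inv\<^bsub>H\<^esub> a \<otimes>\<^bsub>H\<^esub> (d \<otimes>\<^bsub>H\<^esub> a)" using d(2) by (metis H.inv_solve_left H.m_closed)
      then have "d \<otimes>\<^bsub>H\<^esub> inv\<^bsub>H\<^esub> a = inv\<^bsub>H\<^esub> a \<otimes>\<^bsub>H\<^esub> d" using a(1) d(2)
        by (metis H.inv_closed H.inv_solve_right H.m_assoc H.m_closed)
      then show "inv\<^bsub>H\<^esub> a \<in> C" using a by (simp add: C_def)
    next
      fix a b assume "a \<in> C" "b \<in> C"
      then show "a \<otimes>\<^bsub>H\<^esub> b \<in> C" using d(2) by (auto simp: C_def H.m_assoc) (metis H.m_assoc)
    qed (auto simp: C_def)
    have "derived_set H (carrier H) \<subseteq> C"
    proof clarify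
      fix h k assume hk: "h \<in> carrier H" "k \<in> carrier H"
      have "c (h \<otimes>\<^bsub>H\<^esub> k \<otimes>\<^bsub>H\<^esub> inv\<^bsub>H\<^esub> h \<otimes>\<^bsub>H\<^esub> inv\<^bsub>H\<^esub> k) d = c (h \<otimes>\<^bsub>H\<^esub> k) (c (inv\<^bsub>H\<^esub> h \<otimes>\<^bsub>H\<^esub> inv\<^bsub>H\<^esub> k) d)"
        using hk d cc[of "h \<otimes>\<^bsub>H\<^esub> k" "inv\<^bsub>H\<^esub> h \<otimes>\<^bsub>H\<^esub> inv\<^bsub>H\<^esub> k" d] by (simp add: H.m_assoc)
      also have "c (inv\<^bsub>H\<^esub> h \<otimes>\<^bsub>H\<^esub> inv\<^bsub>H\<^esub> k) d = c (inv\<^bsub>H\<^esub> k \<otimes>\<^bsub>H\<^esub> inv\<^bsub>H\<^esub> h) d" using cdc hk by simp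
      also have "c (h \<otimes>\<^bsub>H\<^esub> k) (c (inv\<^bsub>H\<^esub> k \<otimes>\<^bsub>H\<^esub> inv\<^bsub>H\<^esub> h) d) = d"
        using hk d cc[of "h \<otimes>\<^bsub>H\<^esub> k" "inv\<^bsub>H\<^esub> k \<otimes>\<^bsub>H\<^esub> inv\<^bsub>H\<^esub> h" d] c1 by (simp flip: H.inv_mult_group)
      finally show "h \<otimes>\<^bsub>H\<^esub> k \<otimes>\<^bsub>H\<^esub> inv\<^bsub>H\<^esub> h \<otimes>\<^bsub>H\<^esub> inv\<^bsub>H\<^esub> k \<in> C"
        using hk d unfolding C_def c_def by (simp add: H.inv_solve_right')
    qed
    then have "D \<subseteq> C" unfolding D_def derived_def by (rule H.generate_subgroup_incl[OF _ Cs])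
    then have "\<psi> g \<otimes>\<^bsub>H\<^esub> d = d \<otimes>\<^bsub>H\<^esub> \<psi> g" using \<psi> g by (auto simp: C_def)
    then show ?thesis using mult[of "\<psi> g" d] mult[of d "\<psi> g"] \<psi> g x d by (simp add: d_def)
  qed
  show ?thesis
  proof (intro exI[of _ "\<Theta> ` carrier H"] conjI ballI impI)
    show "\<alpha> \<in> iso G G" if "\<alpha> \<in> \<Theta> ` carrier H" for \<alpha> using iso that by auto
    show "\<exists>g\<in>carrier G. \<forall>x\<in>carrier G. \<alpha> (\<beta> x) = g \<otimes> \<beta> (\<alpha> x) \<otimes> inv g"
      if "\<alpha> \<in> \<Theta> ` carrier H" "\<beta> \<in> \<Theta> ` carrier H" for \<alpha> \<beta> using inner that by auto
    show "g \<otimes> x = x \<otimes> g"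
      if "x \<in> carrier G" "\<forall>\<alpha>\<in>\<Theta> ` carrier H. \<forall>\<beta>\<in>\<Theta> ` carrier H. \<alpha> (\<beta> x) = \<beta> (\<alpha> x)" "g \<in> carrier G" for x g
      using central[OF that(1) _ that(3)] that(2) by blast
  qed
qed

text \<open>Automorphisms that send a to its i-th and j-th power commute at a, as both composites
  give the power i j.\<close>

lemma (in group) integrable_imp_central:
  assumes "integrable_group TYPE('h) G" and a: "a \<in> carrier G"
    and char: "\<And>\<alpha>. \<alpha> \<in> iso G G \<Longrightarrow> \<exists>k::nat. \<alpha> a = a [^] k" and g: "g \<in> carrier G"
  shows "g \<otimes> a = a \<otimes> g"
proof -
  obtain A where A: "\<forall>\<alpha>\<in>A. \<alpha> \<in> iso G G"
    "\<forall>x\<in>carrier G. (\<forall>\<alpha>\<in>A. \<forall>\<beta>\<in>A. \<alpha> (\<beta> x) = \<beta> (\<alpha> x)) \<longrightarrow> (\<forall>g\<in>carrier G. g \<otimes> x = x \<otimes> g)"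
    using integrable_automorphisms[OF assms(1)] by blast
  have "\<alpha> (\<beta> a) = \<beta> (\<alpha> a)" if \<alpha>\<beta>: "\<alpha> \<in> A" "\<beta> \<in> A" for \<alpha> \<beta>
  proof -
    have hom: "group_hom G G \<gamma>" if "\<gamma> \<in> A" for \<gamma>
      using A(1) that by (intro group_hom.intro group_hom_axioms.intro group_axioms) (auto simp: iso_def)
    obtain i j :: nat where ij: "\<alpha> a = a [^] i" "\<beta> a = a [^] j" using char A \<alpha>\<beta> by metis
    then have "\<alpha> (\<beta> a) = a [^] (i * j)" "\<beta> (\<alpha> a) = a [^] (j * i)"
      using group_hom.hom_nat_pow[OF hom[OF \<alpha>\<beta>(1)] a, of j] group_hom.hom_nat_pow[OF hom[OF \<alpha>\<beta>(2)] a, of i] a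
      by (simp_all add: nat_pow_pow)
    then show ?thesis by (simp add: mult.commute)
  qed
  then show ?thesis using A(2) a g by blast
qed

section \<open>Metacyclic groups\<close>

text \<open>\<open>E i j\<close> stands for \<open>a\<^sup>i b\<^sup>j\<close> in the group with generators \<open>a\<close>, \<open>b\<close> of orders \<open>N\<close>, \<open>q\<close> and the relation
  \<open>b a b\<^sup>-\<^sup>1 = a\<^sup>r\<close>.\<close>

locale metacyclic =
  fixes N q r :: nat
  assumes N: "N > 0" and q: "q > 0" and rq: "[r ^ q = 1] (mod N)"
begin

definition Mc :: "(nat \<times> nat) monoid" where
  "Mc = \<lparr>carrier = {0..<N} \<times> {0..<q},
     monoid.mult = (\<lambda>(x, y) (x', y'). ((x + r ^ y * x') mod N, (y + y') mod q)), monoid.one = (0, 0)\<rparr>"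

definition E where "E i j = (i mod N, j mod q)"

lemma E_eq_iff: "E i j = E k l \<longleftrightarrow> [i = k] (mod N) \<and> [j = l] (mod q)"
  by (simp add: E_def cong_def)

lemma r_pow_cong: "[j = l] (mod q) \<Longrightarrow> [r ^ j = r ^ l] (mod N)"
proof -
  have "[r ^ j = r ^ (j mod q)] (mod N)" for j
  proof -
    have "[(r ^ q) ^ (j div q) * r ^ (j mod q) = 1 ^ (j div q) * r ^ (j mod q)] (mod N)"
      using rq by (intro cong_mult cong_pow) auto
    moreover have "(r ^ q) ^ (j div q) * r ^ (j mod q) = r ^ j"
      by (simp flip: power_mult power_add)
    ultimately show ?thesis by simp
  qed
  then show "[j = l] (mod q) \<Longrightarrow> [r ^ j = r ^ l] (mod N)" unfolding cong_def by metis
qed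

lemma carrier_Mc: "carrier Mc = range (\<lambda>(i, j). E i j)"
proof -
  have "(x, y) \<in> range (\<lambda>(i, j). E i j)" if "x < N" "y < q" for x y
    using that by (intro image_eqI[of _ _ "(x, y)"]) (auto simp: E_def)
  then show ?thesis using N q by (auto simp: Mc_def E_def)
qed

lemma E_carrier [simp]: "E i j \<in> carrier Mc" by (auto simp: carrier_Mc)

lemma carrier_E: "x \<in> carrier Mc \<Longrightarrow> \<exists>i j. x = E i j" by (auto simp: carrier_Mc)

lemma E_mult: "E i j \<otimes>\<^bsub>Mc\<^esub> E k l = E (i + r ^ j * k) (j + l)"
proof -
  have "[i mod N + r ^ (j mod q) * (k mod N) = i + r ^ j * k] (mod N)"
    by (intro cong_add cong_mult r_pow_cong) (auto simp: cong_def)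
  then show ?thesis by (simp add: E_def Mc_def cong_def mod_add_eq)
qed

lemma E_one: "\<one>\<^bsub>Mc\<^esub> = E 0 0" by (simp add: E_def Mc_def)

lemma order_Mc: "order Mc = N * q" by (simp add: order_def Mc_def)

sublocale Mc: group Mc
proof (rule groupI)
  fix x y z assume "x \<in> carrier Mc" "y \<in> carrier Mc" "z \<in> carrier Mc"
  then obtain i j k l m n where "x = E i j" "y = E k l" "z = E m n" using carrier_E by metis
  then show "x \<otimes>\<^bsub>Mc\<^esub> y \<otimes>\<^bsub>Mc\<^esub> z = x \<otimes>\<^bsub>Mc\<^esub> (y \<otimes>\<^bsub>Mc\<^esub> z)"
    by (simp add: E_mult algebra_simps power_add)
next
  fix x assume "x \<in> carrier Mc"
  then obtain i j where x: "x = E i j" using carrier_E by blast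
  \<comment> \<open>Multiplication by q - 1 and by N - 1 is negation modulo q and N on the
    naturals.\<close>
  define v where "v = (q - 1) * j"
  define u where "u = (N - 1) * (r ^ v * i)"
  have "[u + r ^ v * i = 0] (mod N)"
    using N by (simp add: u_def cong_0_iff flip: add_mult_distrib) (metis Suc_pred dvd_triv_left mult_Suc add.commute)
  moreover have "[v + j = 0] (mod q)"
    using q by (simp add: v_def cong_0_iff) (metis Suc_pred dvd_triv_left mult_Suc add.commute)
  ultimately have "E u v \<otimes>\<^bsub>Mc\<^esub> x = \<one>\<^bsub>Mc\<^esub>" by (simp add: x E_mult E_one E_eq_iff)
  then show "\<exists>y\<in>carrier Mc. y \<otimes>\<^bsub>Mc\<^esub> x = \<one>\<^bsub>Mc\<^esub>" by (intro bexI[of _ "E u v"]) auto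
next
  fix x assume "x \<in> carrier Mc"
  then obtain i j where "x = E i j" using carrier_E by blast
  then show "\<one>\<^bsub>Mc\<^esub> \<otimes>\<^bsub>Mc\<^esub> x = x" by (simp add: E_one E_mult)
next
  fix x y assume "x \<in> carrier Mc" "y \<in> carrier Mc"
  then obtain i j k l where "x = E i j" "y = E k l" using carrier_E by metis
  then show "x \<otimes>\<^bsub>Mc\<^esub> y \<in> carrier Mc" by (simp add: E_mult)
qed (simp add: E_one)

lemma E0_pow: "E i 0 [^]\<^bsub>Mc\<^esub> (m::nat) = E (i * m) 0"
  by (induction m) (auto simp: E_one E_mult algebra_simps)

lemma snd_pow: "\<exists>k. E i j [^]\<^bsub>Mc\<^esub> (m::nat) = E k (j * m)"
proof (induction m)
  case (Suc m)
  then obtain k where "E i j [^]\<^bsub>Mc\<^esub> m = E k (j * m)" by blast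
  then show ?case by (intro exI[of _ "k + r ^ (j * m) * i"]) (simp add: E_mult algebra_simps)
qed (auto simp: E_one)

lemma iso_pow: "\<alpha> \<in> iso Mc Mc \<Longrightarrow> x \<in> carrier Mc \<Longrightarrow> \<alpha> (x [^]\<^bsub>Mc\<^esub> (m::nat)) = \<alpha> x [^]\<^bsub>Mc\<^esub> m"
  by (intro group_hom.hom_nat_pow group_hom.intro group_hom_axioms.intro Mc.group_axioms) (auto simp: iso_def)

lemma iso_mult: "\<alpha> \<in> iso Mc Mc \<Longrightarrow> x \<in> carrier Mc \<Longrightarrow> y \<in> carrier Mc \<Longrightarrow> \<alpha> (x \<otimes>\<^bsub>Mc\<^esub> y) = \<alpha> x \<otimes>\<^bsub>Mc\<^esub> \<alpha> y"
  by (auto simp: iso_def hom_def)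

lemma iso_carrier: "\<alpha> \<in> iso Mc Mc \<Longrightarrow> x \<in> carrier Mc \<Longrightarrow> \<alpha> x \<in> carrier Mc"
  by (auto simp: iso_def hom_def)

lemma iso_eq_one_iff: "\<alpha> \<in> iso Mc Mc \<Longrightarrow> x \<in> carrier Mc \<Longrightarrow> \<alpha> x = \<one>\<^bsub>Mc\<^esub> \<longleftrightarrow> x = \<one>\<^bsub>Mc\<^esub>"
proof -
  assume \<alpha>: "\<alpha> \<in> iso Mc Mc" and x: "x \<in> carrier Mc"
  interpret group_hom Mc Mc \<alpha>
    using \<alpha> by (intro group_hom.intro group_hom_axioms.intro Mc.group_axioms) (auto simp: iso_def)
  have "inj_on \<alpha> (carrier Mc)" using \<alpha> by (simp add: iso_def bij_betw_def)
  then show ?thesis using x hom_one inj_onD Mc.one_closed by metis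
qed

text \<open>As p does not divide q, all elements of order p are powers of a, so they generate one
  cyclic subgroup, spanned by \<open>E s 0\<close>. Automorphisms map this element to its powers,
  yet it is not central because r is not 1 modulo p.\<close>

lemma nonintegrable_prime:
  assumes p: "Factorial_Ring.prime p" "p dvd N" "coprime p q" and rp: "\<not> [r = 1] (mod p)"
  shows "\<not> integrable_group TYPE('b) Mc"
proof
  assume int: "integrable_group TYPE('b) Mc"
  define s where "s = N div p"
  have Ns: "N = p * s" using p by (simp add: s_def)
  have s0: "s > 0" using N Ns by (cases s) auto
  have p0: "p > 0" using p prime_gt_0_nat by blast
  have "\<exists>k::nat. \<alpha> (E s 0) = E s 0 [^]\<^bsub>Mc\<^esub> k" if \<alpha>: "\<alpha> \<in> iso Mc Mc" for \<alpha>
  proof -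
    obtain i j where ij: "\<alpha> (E s 0) = E i j" using iso_carrier[OF \<alpha>] carrier_E by (metis E_carrier)
    have "E s 0 [^]\<^bsub>Mc\<^esub> p = \<one>\<^bsub>Mc\<^esub>" unfolding E0_pow E_one E_eq_iff by (simp add: Ns cong_0_iff)
    then have p1: "E i j [^]\<^bsub>Mc\<^esub> p = \<one>\<^bsub>Mc\<^esub>"
      using iso_pow[OF \<alpha>, of "E s 0" p] iso_eq_one_iff[OF \<alpha>, of "E s 0 [^]\<^bsub>Mc\<^esub> p"] ij by simp
    then have "[j * p = 0] (mod q)" using snd_pow[of i j p] by (auto simp: E_one E_eq_iff cong_sym_eq)
    then have "q dvd j" using p(3) by (simp add: cong_0_iff coprime_commute coprime_dvd_mult_left_iff)
    then have ij0: "E i j = E i 0" by (simp add: E_eq_iff cong_0_iff)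
    then have "[i * p = 0] (mod N)" using p1 unfolding ij0 E0_pow E_one E_eq_iff by simp
    then have "s dvd i" using p0 unfolding Ns by (simp add: cong_0_iff mult.commute)
    then show ?thesis using ij ij0 by (auto simp: E0_pow)
  qed
  then have "E 0 1 \<otimes>\<^bsub>Mc\<^esub> E s 0 = E s 0 \<otimes>\<^bsub>Mc\<^esub> E 0 1"
    by (intro group.integrable_imp_central[OF Mc.group_axioms int]) auto
  then have "[r * s = 1 * s] (mod N)" by (simp add: E_mult E_eq_iff)
  then have "[r * s = 1 * s] (mod p * s)" by (simp only: Ns)
  then have "[r = 1] (mod p)" using s0 by (simp add: cong_def flip: mult_mod_left)
  then show False using rp by blast
qed

text \<open>The elements outside the rotations are involutions, whereas \<open>E 1 0\<close> has
  order N, at least 4, so automorphisms map it to rotations.\<close>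

lemma nonintegrable_dihedral:
  assumes q2: "q = 2" and r: "r = N - 1" and N4: "N \<ge> 4"
  shows "\<not> integrable_group TYPE('b) Mc"
proof
  assume int: "integrable_group TYPE('b) Mc"
  have "\<exists>k::nat. \<alpha> (E 1 0) = E 1 0 [^]\<^bsub>Mc\<^esub> k" if \<alpha>: "\<alpha> \<in> iso Mc Mc" for \<alpha>
  proof -
    obtain i j where ij: "\<alpha> (E 1 0) = E i j" using iso_carrier[OF \<alpha>] carrier_E by (metis E_carrier)
    have "even j"
    proof (rule ccontr)
      assume "odd j"
      then have "E i j = E i 1" unfolding E_eq_iff by (simp add: q2 cong_def odd_iff_mod_2_eq_one)
      then have "E i j [^]\<^bsub>Mc\<^esub> (2::nat) = E (i + r * i) 2" by (simp add: numeral_2_eq_2 E_mult)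
      also have "i + r * i = N * i" using N4 unfolding r by (cases N) auto
      also have "E (N * i) 2 = \<one>\<^bsub>Mc\<^esub>" unfolding E_one E_eq_iff by (simp add: q2 cong_0_iff)
      finally have "E 1 0 [^]\<^bsub>Mc\<^esub> (2::nat) = \<one>\<^bsub>Mc\<^esub>"
        using iso_pow[OF \<alpha>, of "E 1 0" 2] iso_eq_one_iff[OF \<alpha>, of "E 1 0 [^]\<^bsub>Mc\<^esub> (2::nat)"] ij by simp
      then have "N dvd 2" by (simp add: E0_pow E_one E_eq_iff cong_0_iff)
      then show False using N4 by (auto dest: dvd_imp_le)
    qed
    then have "E i j = E i 0" unfolding E_eq_iff by (simp add: q2 cong_0_iff)
    then show ?thesis using ij by (auto simp: E0_pow)
  qed
  then have "E 0 1 \<otimes>\<^bsub>Mc\<^esub> E 1 0 = E 1 0 \<otimes>\<^bsub>Mc\<^esub> E 0 1"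
    by (intro group.integrable_imp_central[OF Mc.group_axioms int]) auto
  then have "[r = 1] (mod N)" by (simp add: E_mult E_eq_iff)
  then show False using N4 unfolding r by (simp add: cong_def)
qed

end

section \<open>Groups of order divisible by the cube of an odd prime\<close>

lemma double_sum_lessThan: "2 * (\<Sum>k<m. k) + m = m * (m::nat)"
  by (induction m) (auto simp: algebra_simps)

text \<open>2 is invertible modulo p, and twice the sum is a polynomial in its bound.\<close>

lemma odd_prime_sum_lessThan_cong:
  assumes p: "Factorial_Ring.prime (p::nat)" "odd p" and "[m = n] (mod p)"
  shows "[(\<Sum>k<m. k) = (\<Sum>k<n. k)] (mod p)"
proof -
  have "[2 * (\<Sum>k<m. k) + m = 2 * (\<Sum>k<n. k) + n] (mod p)"
    unfolding double_sum_lessThan using assms(3) by (intro cong_mult)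
  then have "[2 * (\<Sum>k<m. k) + n = 2 * (\<Sum>k<n. k) + n] (mod p)"
    using assms(3) by (meson cong_add cong_refl cong_sym cong_trans)
  then have "[2 * (\<Sum>k<m. k) = 2 * (\<Sum>k<n. k)] (mod p)" using cong_add_rcancel_nat by blast
  moreover have "coprime 2 p" using p(2) by simp
  ultimately show ?thesis using cong_mult_lcancel_nat by blast
qed

text \<open>p s divides s^2, so only the linear part of the binomial expansion survives.\<close>

lemma power_one_add_cong:
  fixes p s :: nat
  assumes "p dvd s"
  shows "[(1 + s) ^ j = 1 + j * s] (mod p * s)"
proof (induction j)
  case (Suc j)
  have "[(1 + s) ^ Suc j = (1 + s) * (1 + j * s)] (mod p * s)"
    using Suc by (simp only: power_Suc cong_scalar_left)
  also have "(1 + s) * (1 + j * s) = (1 + Suc j * s) + j * (s * s)" by (simp add: algebra_simps)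
  also have "[\<dots> = (1 + Suc j * s) + 0] (mod p * s)"
    using assms by (intro cong_add cong_refl) (auto simp: cong_0_iff)
  finally show ?case by simp
qed simp

text \<open>The commutator of b and a is \<open>E s 0\<close>; it has order p, and it is central
  since N divides s^2. All computations below are those of class 2, with corrections that are
  multiples of s.\<close>

locale modular = metacyclic N p r for N p r +
  fixes s :: nat
  assumes p: "Factorial_Ring.prime p" "odd p" and Ns: "N = p * s" and ps: "p dvd s" and rs: "r = 1 + s"
begin

text \<open>The binomial coefficient m(m-1)/2, which counts the commutators collected in an m-th
  power, written without division.\<close>

definition T where "T m = (\<Sum>k<m. k)" for m :: nat

lemma pred_p: "(p - 1) * x + x = p * x"
  using q by (cases p) auto

lemma s0: "s > 0" using N Ns by (cases s) auto

lemma ss: "[x * (s * s) = 0] (mod N)"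
  using ps by (auto simp: Ns cong_0_iff)

lemma s_cong: "[a = b] (mod p) \<Longrightarrow> [a * s = b * s] (mod N)"
  unfolding Ns using s0 by (simp add: cong_def mult_mod_left[symmetric])

lemma s_cong_iff: "[a * s = b * s] (mod N) \<longleftrightarrow> [a = b] (mod p)"
  unfolding Ns using s0 by (simp add: cong_def mult_mod_left[symmetric])

lemma r_pow: "[r ^ j = 1 + j * s] (mod N)"
  unfolding rs Ns by (rule power_one_add_cong[OF ps])

lemma E_mult': "E i j \<otimes>\<^bsub>Mc\<^esub> E k l = E (i + k + j * k * s) (j + l)"
proof -
  have "[i + r ^ j * k = i + (1 + j * s) * k] (mod N)" by (intro cong_add cong_mult r_pow cong_refl)
  then show ?thesis unfolding E_mult E_eq_iff by (simp add: algebra_simps)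
qed

lemma E_pow: "E i j [^]\<^bsub>Mc\<^esub> (m::nat) = E (i * m + i * j * T m * s) (j * m)"
proof (induction m)
  case (Suc m)
  have "E i j [^]\<^bsub>Mc\<^esub> Suc m = E (i * m + i * j * T m * s + i + j * m * i * s) (j * m + j)"
    by (simp add: Suc E_mult')
  then show ?case by (simp add: T_def algebra_simps)
qed (simp add: E_one T_def)

lemma T_cong: "[m = n] (mod p) \<Longrightarrow> [T m = T n] (mod p)"
  unfolding T_def by (rule odd_prime_sum_lessThan_cong[OF p])

text \<open>For odd p, \<open>T m\<close> is divisible by p along with m, so the commutator
  correction vanishes.\<close>

lemma E_pow_dvd: assumes "p dvd m" shows "E i j [^]\<^bsub>Mc\<^esub> (m::nat) = E (i * m) 0"
proof -
  have "[T m = T 0] (mod p)" using assms by (intro T_cong) (simp add: cong_0_iff)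
  then have "[i * j * T m * s = i * j * 0 * s] (mod N)" by (intro s_cong cong_mult cong_refl) (simp add: T_def)
  then have "[i * m + i * j * T m * s = i * m + 0] (mod N)" by (intro cong_add cong_refl) simp
  then show ?thesis using assms unfolding E_pow E_eq_iff by (simp add: cong_0_iff)
qed

lemma E_s_cong: "[a = b] (mod p) \<Longrightarrow> E (c + a * s) d = E (c + b * s) d"
  unfolding E_eq_iff by (intro conjI cong_add cong_refl s_cong)

text \<open>The image of b again has order p, which makes its a-exponent a multiple of s. Applying
  \<alpha> to the relation \<open>b a = a\<^sup>s a b\<close> and comparing exponents gives l i = i
  modulo p, where l is the b-exponent of that image; i is invertible because \<open>E s 0\<close> is
  not mapped to the identity, so l = 1.\<close>

lemma iso_form:
  assumes \<alpha>: "\<alpha> \<in> iso Mc Mc"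
  shows "\<exists>i j k. \<alpha> (E 1 0) = E i j \<and> \<alpha> (E 0 1) = E (k * s) 1 \<and> \<alpha> (E s 0) = E (i * s) 0 \<and> \<not> p dvd i"
proof -
  obtain i j where ij: "\<alpha> (E 1 0) = E i j" using iso_carrier[OF \<alpha>] carrier_E by (metis E_carrier)
  obtain k0 l where kl: "\<alpha> (E 0 1) = E k0 l" using iso_carrier[OF \<alpha>] carrier_E by (metis E_carrier)
  have "E 0 1 [^]\<^bsub>Mc\<^esub> p = \<one>\<^bsub>Mc\<^esub>" by (simp add: E_pow_dvd E_one)
  then have "E k0 l [^]\<^bsub>Mc\<^esub> p = \<one>\<^bsub>Mc\<^esub>"
    using iso_pow[OF \<alpha>, of "E 0 1" p] iso_eq_one_iff[OF \<alpha>, of "E 0 1 [^]\<^bsub>Mc\<^esub> p"] kl by simp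
  then have "[k0 * p = 0] (mod N)" by (simp add: E_pow_dvd E_one E_eq_iff)
  then have "s dvd k0" using p(1) by (simp add: cong_0_iff Ns mult.commute prime_gt_0_nat)
  then obtain k where k: "k0 = k * s" by (metis dvdE mult.commute)
  have z: "E 1 0 [^]\<^bsub>Mc\<^esub> s = E s 0" by (simp add: E_pow_dvd[OF ps])
  have \<alpha>z: "\<alpha> (E s 0) = E (i * s) 0"
    using iso_pow[OF \<alpha>, of "E 1 0" s] ij by (simp add: z E_pow_dvd[OF ps])
  have "E s 0 \<noteq> \<one>\<^bsub>Mc\<^esub>" using s_cong_iff[of 1 0] p(1) by (auto simp: E_one E_eq_iff cong_0_iff)
  then have "E (i * s) 0 \<noteq> \<one>\<^bsub>Mc\<^esub>" using \<alpha>z iso_eq_one_iff[OF \<alpha>, of "E s 0"] by simp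
  then have pi: "\<not> p dvd i" using s_cong_iff[of i 0] by (auto simp: E_one E_eq_iff cong_0_iff)
  have "E 0 1 \<otimes>\<^bsub>Mc\<^esub> E 1 0 = E s 0 \<otimes>\<^bsub>Mc\<^esub> (E 1 0 \<otimes>\<^bsub>Mc\<^esub> E 0 1)"
    by (simp add: E_mult' algebra_simps)
  then have "E k0 l \<otimes>\<^bsub>Mc\<^esub> E i j = E (i * s) 0 \<otimes>\<^bsub>Mc\<^esub> (E i j \<otimes>\<^bsub>Mc\<^esub> E k0 l)"
    using iso_mult[OF \<alpha>] ij kl \<alpha>z by (metis E_carrier Mc.m_closed)
  then have "E (k0 + i + l * i * s) (l + j) = E (k0 + i + i * s + j * k * (s * s)) (l + j)"
    by (simp add: E_mult' k algebra_simps)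
  then have "[k0 + i + l * i * s = k0 + i + i * s + j * k * (s * s)] (mod N)" by (simp add: E_eq_iff)
  moreover have "[k0 + i + i * s + j * k * (s * s) = k0 + i + i * s + 0] (mod N)" by (intro cong_add cong_refl ss)
  ultimately have "[k0 + i + l * i * s = k0 + i + i * s] (mod N)" using cong_trans by fastforce
  then have "[l * i * s = i * s] (mod N)" using cong_add_lcancel_nat by blast
  then have "[l * i = 1 * i] (mod p)" by (simp add: s_cong_iff)
  moreover have "coprime i p" using p(1) pi by (metis coprime_commute prime_imp_coprime)
  ultimately have "[l = 1] (mod p)" using cong_mult_rcancel_nat by blast
  then have "E k0 l = E (k * s) 1" by (simp add: E_eq_iff k)
  then show ?thesis using ij kl \<alpha>z pi by metis
qed

lemma b_pow: "E (k * s) 1 [^]\<^bsub>Mc\<^esub> (m::nat) = E (k * m * s) m"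
proof -
  have "[k * s * m + k * s * 1 * T m * s = k * m * s + 0] (mod N)"
    using ss[of "k * T m"] by (intro cong_add) (auto simp: algebra_simps)
  then show ?thesis unfolding E_pow E_eq_iff by simp
qed

lemma E_decomp: "E x y = E 1 0 [^]\<^bsub>Mc\<^esub> x \<otimes>\<^bsub>Mc\<^esub> E 0 1 [^]\<^bsub>Mc\<^esub> y"
  by (simp add: E_pow E_mult')

lemma iso_E:
  assumes "\<alpha> \<in> iso Mc Mc"
  shows "\<alpha> (E x y) = \<alpha> (E 1 0) [^]\<^bsub>Mc\<^esub> x \<otimes>\<^bsub>Mc\<^esub> \<alpha> (E 0 1) [^]\<^bsub>Mc\<^esub> y"
  using E_decomp[of x y] iso_mult[OF assms] iso_pow[OF assms] by simp

lemma snd_conj: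
  assumes "E x y = g \<otimes>\<^bsub>Mc\<^esub> E x' y' \<otimes>\<^bsub>Mc\<^esub> inv\<^bsub>Mc\<^esub> g" "g \<in> carrier Mc"
  shows "[y = y'] (mod p)"
proof -
  obtain i j where g: "g = E i j" using assms(2) carrier_E by blast
  have "E x y \<otimes>\<^bsub>Mc\<^esub> g = g \<otimes>\<^bsub>Mc\<^esub> E x' y'" using assms by (simp add: Mc.m_assoc)
  then have "[j + y = j + y'] (mod p)" by (simp add: g E_mult' E_eq_iff add.commute)
  then show ?thesis using cong_add_lcancel_nat by blast
qed

text \<open>The hypothesis says that \<open>E 1 l\<close> is an eigenvector with eigenvalue i modulo
  the powers of \<open>E s 0\<close>. The exponent \<open>m = i + w * s\<close> absorbs the
  remaining power of \<open>E s 0\<close>; since p divides s, changing i to m affects neither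
  \<open>T\<close> nor the b-exponent modulo p.\<close>

lemma diagonal_powers:
  assumes \<beta>: "\<beta> \<in> iso Mc Mc" "\<beta> (E 1 0) = E i j" "[j + l = i * l] (mod p)"
  shows "\<exists>m::nat. \<beta> (E 1 l) = E 1 l [^]\<^bsub>Mc\<^esub> m"
proof -
  obtain k where k: "\<beta> (E 0 1) = E (k * s) 1" using iso_form[OF \<beta>(1)] by blast
  have "\<beta> (E 1 l) = E i j \<otimes>\<^bsub>Mc\<^esub> E (k * l * s) l"
    using iso_E[OF \<beta>(1), of 1 l] k \<beta>(2) by (simp add: b_pow del: One_nat_def)
  also have "\<dots> = E (i + k * l * s + j * (k * l) * (s * s)) (j + l)" by (simp add: E_mult' algebra_simps)
  also have "\<dots> = E (i + k * l * s) (i * l)"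
    unfolding E_eq_iff
  proof
    have "[i + k * l * s + j * (k * l) * (s * s) = i + k * l * s + 0] (mod N)" by (intro cong_add cong_refl ss)
    then show "[i + k * l * s + j * (k * l) * (s * s) = i + k * l * s] (mod N)" by simp
  qed (rule \<beta>(3))
  finally have \<beta>l: "\<beta> (E 1 l) = E (i + k * l * s) (i * l)" .
  \<comment> \<open>(p - 1) stands for -1 modulo p: \<open>w\<close> is
    \<open>k * l - l * T i\<close>.\<close>
  define w where "w = k * l + (p - 1) * (l * T i)"
  define m where "m = i + w * s"
  have "[i + w * s = i + 0] (mod p)" using ps by (intro cong_add cong_refl) (simp add: cong_0_iff)
  then have m: "[m = i] (mod p)" by (simp add: m_def)
  have "[w + l * T m = w + l * T i] (mod p)" by (intro cong_add cong_mult cong_refl T_cong m)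
  also have "w + l * T i = k * l + p * (l * T i)"
    using pred_p[of "l * T i"] by (simp add: w_def)
  also have "[\<dots> = k * l + 0] (mod p)" by (intro cong_add cong_refl) (simp add: cong_0_iff)
  finally have w: "[w + l * T m = k * l] (mod p)" by simp
  have "E 1 l [^]\<^bsub>Mc\<^esub> m = E (i + (w + l * T m) * s) (l * m)"
    unfolding E_pow by (simp add: m_def algebra_simps)
  also have "\<dots> = E (i + k * l * s) (l * m)" by (rule E_s_cong[OF w])
  also have "\<dots> = E (i + k * l * s) (i * l)"
    unfolding E_eq_iff using cong_scalar_left[OF m, of l] by (simp add: mult.commute)
  finally show ?thesis using \<beta>l by metis
qed

theorem nonintegrable: "\<not> integrable_group TYPE('b) Mc"
proof
  assume int: "integrable_group TYPE('b) Mc"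
  from group.integrable_automorphisms[OF Mc.group_axioms int] obtain A where A: "\<forall>\<alpha>\<in>A. \<alpha> \<in> iso Mc Mc"
    and inner: "\<forall>\<alpha>\<in>A. \<forall>\<beta>\<in>A. \<exists>g\<in>carrier Mc. \<forall>x\<in>carrier Mc. \<alpha> (\<beta> x) = g \<otimes>\<^bsub>Mc\<^esub> \<beta> (\<alpha> x) \<otimes>\<^bsub>Mc\<^esub> inv\<^bsub>Mc\<^esub> g"
    and central: "\<forall>x\<in>carrier Mc. (\<forall>\<alpha>\<in>A. \<forall>\<beta>\<in>A. \<alpha> (\<beta> x) = \<beta> (\<alpha> x)) \<longrightarrow> (\<forall>g\<in>carrier Mc. g \<otimes>\<^bsub>Mc\<^esub> x = x \<otimes>\<^bsub>Mc\<^esub> g)"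
    by (elim exE conjE)
  have p1: "p > 1" using p(1) prime_gt_1_nat by blast
  have ns: "\<not> [1 + s = 1] (mod N)" using s_cong_iff[of 1 0] p1 cong_add_lcancel_nat[of 1 s 0 N]
    by (auto simp: cong_def)
  show False
  \<comment> \<open>Modulo the centre, \<alpha> has eigenvalue 1 on b and a second eigenvalue i,
    which \<open>iso_form\<close> reads off from the image of \<open>E s 0\<close>. Either i = 1
    throughout, or some \<alpha> is diagonalisable.\<close>
  proof (cases "\<forall>\<alpha>\<in>A. \<alpha> (E s 0) = E s 0")
    case True
    \<comment> \<open>All of \<open>A\<close> moves \<open>b\<close> by central factors fixed by \<open>A\<close>, hence commutes at \<open>b\<close>.\<close>
    have form: "\<exists>k. \<alpha> (E 0 1) = E (k * s) 1 \<and> (\<forall>x. \<alpha> (E (x * s) 1) = E ((x + k) * s) 1)" if \<alpha>: "\<alpha> \<in> A" for \<alpha>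
    proof -
      have iso: "\<alpha> \<in> iso Mc Mc" using A \<alpha> by blast
      obtain k where k: "\<alpha> (E 0 1) = E (k * s) 1" using iso_form[OF iso] by blast
      have z: "\<alpha> (E s 0) = E s 0" using True \<alpha> by blast
      have "\<alpha> (E (x * s) 1) = E ((x + k) * s) 1" for x
      proof -
        have "E (x * s) 1 = E s 0 [^]\<^bsub>Mc\<^esub> x \<otimes>\<^bsub>Mc\<^esub> E 0 1" by (simp add: E_pow E_mult' mult.commute)
        then have "\<alpha> (E (x * s) 1) = E s 0 [^]\<^bsub>Mc\<^esub> x \<otimes>\<^bsub>Mc\<^esub> E (k * s) 1"
          using iso_mult[OF iso] iso_pow[OF iso] z k by simp
        then show ?thesis by (simp add: E_pow E_mult' algebra_simps)
      qed
      then show ?thesis using k by blast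
    qed
    have "\<alpha> (\<beta> (E 0 1)) = \<beta> (\<alpha> (E 0 1))" if \<alpha>: "\<alpha> \<in> A" and \<beta>: "\<beta> \<in> A" for \<alpha> \<beta>
    proof -
      obtain k where k: "\<alpha> (E 0 1) = E (k * s) 1" "\<And>x. \<alpha> (E (x * s) 1) = E ((x + k) * s) 1" using form[OF \<alpha>] by blast
      obtain k' where k': "\<beta> (E 0 1) = E (k' * s) 1" "\<And>x. \<beta> (E (x * s) 1) = E ((x + k') * s) 1" using form[OF \<beta>] by blast
      show ?thesis unfolding k k' by (simp only: add.commute)
    qed
    then have "E 1 0 \<otimes>\<^bsub>Mc\<^esub> E 0 1 = E 0 1 \<otimes>\<^bsub>Mc\<^esub> E 1 0" using central by simp
    then show False using ns by (simp add: E_mult' E_eq_iff cong_sym_eq)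
  next
    case False
    then obtain \<alpha> where \<alpha>: "\<alpha> \<in> A" "\<alpha> (E s 0) \<noteq> E s 0" by blast
    then have iso: "\<alpha> \<in> iso Mc Mc" using A by blast
    \<comment> \<open>\<open>A\<close> acts by commuting maps on \<open>G/Z(G)\<close>, so it preserves the eigenline of \<open>\<alpha>\<close> with eigenvalue
      \<open>i \<noteq> 1\<close>, which is spanned by \<open>E 1 l\<close>.\<close>
    obtain i j k where f: "\<alpha> (E 1 0) = E i j" "\<alpha> (E 0 1) = E (k * s) 1" "\<alpha> (E s 0) = E (i * s) 0"
      using iso_form[OF iso] by blast
    have i1: "\<not> [i = 1] (mod p)" using \<alpha>(2) f(3) s_cong[of i 1] by (auto simp: E_eq_iff)
    \<comment> \<open>\<open>i + (p - 1)\<close> represents i - 1. Its inverse \<open>u\<close>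
      gives l = j/(i - 1), the solution of j + l = i l.\<close>
    have "\<not> p dvd i + (p - 1)"
    proof
      assume "p dvd i + (p - 1)"
      then have "[i + (p - 1) = 1 + (p - 1)] (mod p)" using p1 by (simp add: cong_def)
      then show False using i1 cong_add_rcancel_nat by blast
    qed
    then have "coprime (i + (p - 1)) p" using p(1) by (metis coprime_commute prime_imp_coprime)
    then obtain u where u: "[(i + (p - 1)) * u = 1] (mod p)" using cong_solve_coprime_nat[of "i + (p - 1)" p] by auto
    define l where "l = j * u"
    have l: "[j + l = i * l] (mod p)"
    proof -
      have "[(i + (p - 1)) * u * j + l = 1 * j + l] (mod p)" using u by (intro cong_add cong_mult cong_refl)
      moreover have "(i + (p - 1)) * u * j + l = i * l + p * l"
        using pred_p[of l] by (simp add: l_def algebra_simps)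
      ultimately have "[i * l + p * l = j + l] (mod p)" by simp
      moreover have "[i * l + p * l = i * l + 0] (mod p)" by (intro cong_add cong_refl) (simp add: cong_0_iff)
      ultimately show ?thesis by (metis add_0_right cong_sym cong_trans)
    qed
    have pow: "\<exists>m::nat. \<beta> (E 1 l) = E 1 l [^]\<^bsub>Mc\<^esub> m" if \<beta>: "\<beta> \<in> A" for \<beta>
    proof -
      have iso': "\<beta> \<in> iso Mc Mc" using A \<beta> by blast
      obtain i' j' k' where f': "\<beta> (E 1 0) = E i' j'" "\<beta> (E 0 1) = E (k' * s) 1" using iso_form[OF iso'] by blast
      obtain x where x: "\<alpha> (\<beta> (E 1 0)) = E x (j * i' + j')"
        unfolding f'(1) iso_E[OF iso, of i' j'] f b_pow E_pow E_mult' mult_1 by blast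
      obtain x' where x': "\<beta> (\<alpha> (E 1 0)) = E x' (j' * i + j)"
        unfolding f(1) iso_E[OF iso', of i j] f' b_pow E_pow E_mult' mult_1 by blast
      obtain g where g: "g \<in> carrier Mc" "\<forall>x\<in>carrier Mc. \<alpha> (\<beta> x) = g \<otimes>\<^bsub>Mc\<^esub> \<beta> (\<alpha> x) \<otimes>\<^bsub>Mc\<^esub> inv\<^bsub>Mc\<^esub> g"
        using inner \<alpha>(1) \<beta> by blast
      \<comment> \<open>Equality of the b-exponents of two conjugate elements.\<close>
      have c: "[j * i' + j' = j' * i + j] (mod p)"
        using g(2)[rule_format, OF E_carrier, of 1 0] unfolding x x' by (rule snd_conj[OF _ g(1)])
      have "[int (j + l) = int (i * l)] (mod int p)" using l cong_int_iff by blast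
      then have l': "int p dvd int j + int l - int i * int l" by (simp add: cong_iff_dvd_diff)
      have "[int (j * i' + j') = int (j' * i + j)] (mod int p)" using c cong_int_iff by blast
      then have c': "int p dvd int j * int i' + int j' - (int j' * int i + int j)" by (simp add: cong_iff_dvd_diff)
      \<comment> \<open>Eliminating j by means of the equation for l leaves (i - 1)(i' l - j' - l) =
        0 modulo p, where i - 1 is invertible. So \<open>E 1 l\<close> is an eigenvector of \<beta>
        as well.\<close>
      have "int p dvd (int j * int i' + int j' - (int j' * int i + int j)) - (int i' - 1) * (int j + int l - int i * int l)"
        by (rule dvd_diff[OF c' dvd_mult[OF l']])
      also have "\<dots> = (int i - 1) * (int i' * int l - (int j' + int l))" by (simp add: algebra_simps)
      finally have "int p dvd (int i - 1) * (int i' * int l - (int j' + int l))" .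
      moreover have "\<not> int p dvd int i - 1" using i1 cong_int_iff[of i 1 p] by (simp add: cong_iff_dvd_diff)
      moreover have "Factorial_Ring.prime (int p)" using p(1) by simp
      ultimately have "int p dvd int i' * int l - (int j' + int l)" by (simp add: prime_dvd_mult_iff)
      then have "[int (i' * l) = int (j' + l)] (mod int p)" by (simp add: cong_iff_dvd_diff)
      then have "[j' + l = i' * l] (mod p)" using cong_int_iff cong_sym by blast
      then show ?thesis by (rule diagonal_powers[OF iso' f'(1)])
    qed
    have "\<beta> (\<gamma> (E 1 l)) = \<gamma> (\<beta> (E 1 l))" if \<beta>\<gamma>: "\<beta> \<in> A" "\<gamma> \<in> A" for \<beta> \<gamma>
    proof -
      have iso2: "\<beta> \<in> iso Mc Mc" "\<gamma> \<in> iso Mc Mc" using A \<beta>\<gamma> by auto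
      obtain m m' :: nat where "\<beta> (E 1 l) = E 1 l [^]\<^bsub>Mc\<^esub> m" "\<gamma> (E 1 l) = E 1 l [^]\<^bsub>Mc\<^esub> m'" using pow \<beta>\<gamma> by metis
      then show ?thesis using iso_pow[OF iso2(1)] iso_pow[OF iso2(2)] by (simp add: Mc.nat_pow_pow mult.commute)
    qed
    then have "E 0 1 \<otimes>\<^bsub>Mc\<^esub> E 1 l = E 1 l \<otimes>\<^bsub>Mc\<^esub> E 0 1" using central E_carrier by blast
    then show False using ns by (simp add: E_mult' E_eq_iff)
  qed
qed

end

section \<open>Nonintegrable groups of every excluded order\<close>

text \<open>Let p^e be the exact power of p in N and d = (p - 1)/q. For a primitive root g modulo p,
  the exponent of g in \<open>y\<close> is the totient of p^e divided by q, so y^q = 1 modulo p^e by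
  Euler. A p-power in an exponent is invisible modulo p, so y = g^d there, which is not 1. The
  remaining factor of N is handled by the Chinese remainder theorem with residue 1.\<close>

lemma exists_root_of_unity_mod:
  fixes p q N :: nat
  assumes p: "Factorial_Ring.prime p" and q: "q > 1" "q dvd p - 1" and N: "N > 0" "p dvd N"
  obtains r where "[r ^ q = 1] (mod N)" "\<not> [r = 1] (mod p)"
proof -
  have p1: "p > 1" using p prime_gt_1_nat by blast
  obtain d where d: "p - 1 = q * d" using q(2) by (elim dvdE)
  have "d > 0" using d p1 by (cases d) auto
  moreover have "d < q * d" using q(1) \<open>d > 0\<close> by simp
  ultimately have d0: "0 < d" "d < p - 1" unfolding d .
  have "odd p" using d0 p by (intro prime_odd_nat) auto
  then obtain g where "residue_primroot (p ^ 1) g"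
    using residue_primroot_odd_prime_power_exists[OF p] zero_less_one by metis
  then have g: "residue_primroot p g" by simp
  then have gp: "coprime p g" "ord p g = p - 1" using p by (auto simp: residue_primroot_def totient_prime)
  have gd: "\<not> [g ^ d = 1] (mod p)" using d0 gp ord_divides[of g d p] by (auto dest: dvd_imp_le)
  define e where "e = multiplicity p N"
  have e0: "e > 0" using N p not_prime_unit by (auto simp: e_def prime_multiplicity_gt_zero_iff)
  define y where "y = g ^ (p ^ (e - 1) * d)"
  have "totient (p ^ e) = p ^ (e - 1) * d * q"
    unfolding totient_prime_power[OF p e0] d by (simp only: ac_simps)
  then have "y ^ q = g ^ totient (p ^ e)" by (simp add: y_def flip: power_mult)
  moreover have "coprime g (p ^ e)" using gp by (simp add: coprime_commute)
  ultimately have yq: "[y ^ q = 1] (mod p ^ e)" using euler_theorem by metis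
  have frob: "[h ^ (p ^ k) = h] (mod p)" for h k :: nat
  proof (induction k)
    case (Suc k)
    have "[h ^ p = h] (mod p)"
    proof (cases "p dvd h")
      case True
      then have "[h ^ p = 0] (mod p)" "[h = 0] (mod p)" using p1 by (auto simp: cong_0_iff dvd_power_same intro: dvd_trans[OF _ dvd_power])
      then show ?thesis using cong_sym cong_trans by blast
    next
      case False
      have "h ^ p = h ^ (p - 1) * h" using p1 by (simp flip: power_Suc2)
      then show ?thesis using fermat_theorem[OF p False] cong_scalar_right[of "h ^ (p - 1)" 1 p h] by simp
    qed
    then have "[(h ^ p) ^ (p ^ k) = h ^ (p ^ k)] (mod p)" by (rule cong_pow)
    then show ?case using Suc by (metis cong_trans power_Suc power_mult)
  qed simp
  have "[y = g ^ d] (mod p)" using frob[of "g ^ d" "e - 1"] by (simp add: y_def mult.commute flip: power_mult)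
  then have yp: "\<not> [y = 1] (mod p)" using gd cong_sym cong_trans by blast
  define m where "m = N div p ^ e"
  have Nm: "N = p ^ e * m" by (simp add: m_def e_def multiplicity_dvd)
  have "\<not> p dvd m" unfolding m_def e_def using multiplicity_decompose[of N p] N p not_prime_unit by auto
  then have co: "coprime (p ^ e) m" using p by (metis coprime_power_left_iff prime_imp_coprime)
  then obtain r where r: "[r = y] (mod p ^ e)" "[r = 1] (mod m)" using binary_chinese_remainder_nat by blast
  have "[r ^ q = 1] (mod p ^ e)" using cong_pow[OF r(1)] yq cong_trans by blast
  moreover have "[r ^ q = 1] (mod m)" using cong_pow[OF r(2), of q] by simp
  ultimately have "[r ^ q = 1] (mod N)" unfolding Nm using co by (rule coprime_cong_mult_nat)
  moreover have "[r = y] (mod p)" using r(1) e0 by (metis cong_dvd_modulus_nat dvd_power)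
  then have "\<not> [r = 1] (mod p)" using yp cong_sym cong_trans by blast
  ultimately show ?thesis using that by blast
qed

text \<open>The counterexamples consist of pairs of naturals; an injection into the given infinite
  type moves them there.\<close>

lemma transport_nonintegrable:
  fixes M :: "(nat \<times> nat) monoid"
  assumes M: "group M" and ni: "\<not> integrable_group TYPE('b) M"
  shows "\<exists>G :: 'a::infinite monoid. group G \<and> order G = order M \<and> \<not> integrable_group TYPE('b) G"
proof -
  interpret M: group M by fact
  obtain e :: "nat \<Rightarrow> 'a" where "inj e" using arb_countable_map[of "{}"] by auto
  then have f: "inj (\<lambda>x :: nat \<times> nat. e (to_nat x))"
    using inj_compose[OF _ inj_to_nat] by (simp add: comp_def)
  define f where "f = (\<lambda>x :: nat \<times> nat. e (to_nat x))"
  define g where "g = inv_into UNIV f"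
  have gf: "g (f x) = x" for x using inv_into_f_f[of f UNIV x] f by (simp add: g_def flip: f_def)
  define G :: "'a monoid" where
    "G = \<lparr>carrier = f ` carrier M, monoid.mult = \<lambda>x y. f (g x \<otimes>\<^bsub>M\<^esub> g y), monoid.one = f \<one>\<^bsub>M\<^esub>\<rparr>"
  have iso: "f \<in> iso M G"
    using f by (auto simp: iso_def hom_def G_def gf bij_betw_def f_def[symmetric] intro: inj_on_subset)
  have "group (G\<lparr>one := f \<one>\<^bsub>M\<^esub>\<rparr>)" using M.iso_imp_img_group[OF iso] by simp
  then have G: "group G" by (simp add: G_def)
  have "\<not> integrable_group TYPE('b) G"
  proof
    assume "integrable_group TYPE('b) G"
    then obtain H :: "'b monoid" where H: "group H" "H\<lparr>carrier := derived H (carrier H)\<rparr> \<cong> G"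
      by (auto simp: integrable_group_def integral_of_def)
    moreover have "G \<cong> M" using M.iso_sym[OF is_isoI[OF iso]] .
    ultimately have "integral_of H M" using iso_trans by (auto simp: integral_of_def)
    then show False using ni by (auto simp: integrable_group_def)
  qed
  moreover have "order G = order M" using iso_same_order[OF iso] by simp
  ultimately show ?thesis using G by blast
qed

theorem exists_nonintegrable:
  fixes n :: nat
  assumes n: "n > 0"
    and bad: "\<not> cube_free n \<or> (\<exists>p q. Factorial_Ring.prime p \<and> Factorial_Ring.prime q \<and> p dvd n \<and> q dvd n \<and> q dvd p - 1)"
  shows "\<exists>G :: 'a::infinite monoid. group G \<and> order G = n \<and> \<not> integrable_group TYPE('b) G"
proof -
  have "\<exists>M :: (nat \<times> nat) monoid. group M \<and> order M = n \<and> \<not> integrable_group TYPE('b) M"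
    using bad
  proof (elim disjE exE conjE)
    assume "\<not> cube_free n"
    then obtain p where p: "Factorial_Ring.prime p" "p ^ 3 dvd n" by (auto simp: cube_free_def)
    then obtain m where m: "n = p ^ 3 * m" by (elim dvdE)
    have m0: "m > 0" using n m by (cases m) auto
    show ?thesis
    proof (cases "p = 2")
      case True
      \<comment> \<open>N is n/2, and -1 modulo N is the exponent r of the dihedral group of order
        n.\<close>
      define N where "N = 4 * m"
      have N4: "N \<ge> 4" using m0 by (simp add: N_def)
      have "(N - 1) ^ 2 = 1 + N * (N - 2)"
        using N4 by (auto simp: power2_eq_square algebra_simps dest!: le_Suc_ex)
      moreover have "[1 + N * (N - 2) = 1 + 0] (mod N)" by (intro cong_add cong_refl) (simp add: cong_0_iff)
      ultimately have "[(N - 1) ^ 2 = 1] (mod N)" by simp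
      then interpret metacyclic N 2 "N - 1" using N4 by unfold_locales auto
      have "order Mc = n" unfolding order_Mc by (simp add: m True N_def)
      then show ?thesis using Mc.group_axioms nonintegrable_dihedral[OF refl refl N4] by blast
    next
      case False
      \<comment> \<open>s is n/p^2, so that N = p s is n/p.\<close>
      define s where "s = p * m"
      have ps: "p dvd s" by (simp add: s_def)
      have p0: "p > 0" using p prime_gt_0_nat by blast
      have "odd p" using primes_dvd_imp_eq[OF two_is_prime_nat p(1)] False by blast
      have "[(1 + s) ^ p = 1 + p * s] (mod p * s)" by (rule power_one_add_cong[OF ps])
      moreover have "[1 + p * s = 1 + 0] (mod p * s)" by (intro cong_add cong_refl) (simp add: cong_0_iff)
      ultimately have "[(1 + s) ^ p = 1] (mod p * s)" using cong_trans by fastforce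
      then interpret modular "p * s" p "1 + s" s
        using p(1) \<open>odd p\<close> p0 m0 ps by unfold_locales (auto simp: s_def prime_odd_nat prime_ge_2_nat order_le_less)
      have "order Mc = n" unfolding order_Mc by (simp add: m s_def power3_eq_cube)
      then show ?thesis using Mc.group_axioms nonintegrable by blast
    qed
  next
    fix p q :: nat assume pq: "Factorial_Ring.prime p" "Factorial_Ring.prime q" "p dvd n" "q dvd n" "q dvd p - 1"
    have q1: "q > 1" using pq prime_gt_1_nat by blast
    have p1: "p > 1" using pq prime_gt_1_nat by blast
    have "q < p" using pq(5) p1 by (auto dest: dvd_imp_le)
    then have cop: "coprime p q" using primes_coprime[OF pq(1,2)] by simp
    obtain N where nN: "n = N * q" using pq(4) by (metis dvdE mult.commute)
    have N0: "N > 0" using n nN by (cases N) auto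
    have pN: "p dvd N" using pq(3) cop nN by (simp add: coprime_dvd_mult_left_iff)
    obtain r where r: "[r ^ q = 1] (mod N)" "\<not> [r = 1] (mod p)"
      using exists_root_of_unity_mod[OF pq(1) q1 pq(5) N0 pN] .
    interpret metacyclic N q r by unfold_locales (use N0 q1 r in auto)
    have "order Mc = n" by (simp add: order_Mc nN)
    then show ?thesis using Mc.group_axioms nonintegrable_prime[OF pq(1) pN cop r(2)] by blast
  qed
  then show ?thesis using transport_nonintegrable by metis
qed

theorem theorem7p1:
  fixes n :: nat
  assumes "n > 0"
  shows "(\<forall>G :: 'a::infinite monoid. group G \<and> Coset.order G = n
            \<longrightarrow> integrable_group TYPE('b::infinite) G)
         \<longleftrightarrow> cube_free n \<and>
            \<not> (\<exists>p q :: nat. Factorial_Ring.prime p \<and> Factorial_Ring.prime q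
                    \<and> p dvd n \<and> q dvd n \<and> q dvd p - 1)"
proof
  assume all: "\<forall>G :: 'a monoid. group G \<and> Coset.order G = n \<longrightarrow> integrable_group TYPE('b) G"
  show "cube_free n \<and> \<not> (\<exists>p q. Factorial_Ring.prime p \<and> Factorial_Ring.prime q
      \<and> p dvd n \<and> q dvd n \<and> q dvd p - 1)"
    using exists_nonintegrable[OF assms, where 'a = 'a and 'b = 'b] all by blast
next
  assume good: "cube_free n \<and> \<not> (\<exists>p q. Factorial_Ring.prime p \<and> Factorial_Ring.prime q
      \<and> p dvd n \<and> q dvd n \<and> q dvd p - 1)"
  show "\<forall>G :: 'a monoid. group G \<and> Coset.order G = n \<longrightarrow> integrable_group TYPE('b) G"
  proof (intro allI impI, elim conjE)
    fix G :: "'a monoid" assume "group G" "order G = n"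
    then show "integrable_group TYPE('b) G"
      using good assms by (intro integrable_of_arithmetic) auto
  qed
qed

end
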